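(* Let $(V,B)$ be a Steiner system of type $S(t,n,v)$, where $t<n\le v$, and let $C=C_{(n,v)}\setminus B$. Let $J_C=\bigcap_{\sigma\in C}\mathfrak p_\sigma\subseteq k[V]$. Then $k[V]/J_C^{(m)}$ is Cohen-Macaulay for each $m\ge 1$, where $J_C^{(m)}=\bigcap_{\sigma\in C}\mathfrak p_\sigma^m$ is the $m$-th symbolic power of $J_C$.
   Context: A Steiner system $(V,B)$ of type $S(t,n,v)$ consists of a set $V=\{1,\dots,v\}$ and a collection $B$ of $n$-subsets of $V$ (blocks) such that every $t$-subset of $V$ is contained in a unique block. $C_{(n,v)}$ denotes the set of all $n$-subsets of $V$. $k$ is a field, $k[V]=k[x_1,\dots,x_v]$ is the standard graded polynomial ring, and for $\sigma=\{i_1,\dots,i_n\}\subseteq V$, $\mathfrak p_\sigma=(x_{i_1},\dots,x_{i_n})$. *)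

theory Defs
  imports
    "HOL-Algebra.Algebra"
    "HOL-Library.Poly_Mapping"
    "HOL-Library.Extended_Nat"
begin

section \<open>Steiner systems\<close>

definition subsets_of_size :: "'x set \<Rightarrow> nat \<Rightarrow> 'x set set" where
  "subsets_of_size V n = {\<sigma>. \<sigma> \<subseteq> V \<and> card \<sigma> = n}"

definition steiner_system :: "nat set \<Rightarrow> nat set set \<Rightarrow> nat \<Rightarrow> nat \<Rightarrow> nat \<Rightarrow> bool" where
  "steiner_system V B t n v \<longleftrightarrow>
     V = {1..v} \<and> B \<subseteq> subsets_of_size V n \<and>
     (\<forall>\<tau> \<in> subsets_of_size V t. \<exists>!\<beta>. \<beta> \<in> B \<and> \<tau> \<subseteq> \<beta>)"


section \<open>The polynomial ring \<open>k[V]\<close> and intersections of powers of monomial primes\<close>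

text \<open>Exponent vectors are finitely supported maps to \<^typ>\<open>nat\<close>, polynomials are finitely
  supported maps from exponent vectors to coefficients. The type contains a variable for every
  element of \<^typ>\<open>'x\<close>; \<open>k[V]\<close> is the subring of the polynomials in the variables
  indexed by \<open>V\<close>.\<close>

type_synonym ('x, 'k) mpolynomial = "('x \<Rightarrow>\<^sub>0 nat) \<Rightarrow>\<^sub>0 'k"

definition var :: "'x \<Rightarrow> ('x, 'k::comm_ring_1) mpolynomial" where
  "var i = Poly_Mapping.single (Poly_Mapping.single i 1) 1"

definition mpoly_ring :: "'x set \<Rightarrow> ('x, 'k::comm_ring_1) mpolynomial ring" where
  "mpoly_ring V =
     \<lparr>carrier = {f. \<forall>a \<in> Poly_Mapping.keys f. Poly_Mapping.keys a \<subseteq> V},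
      monoid.mult = (*), one = 1, ring.zero = 0, ring.add = (+)\<rparr>"

definition monomial_prime :: "'x set \<Rightarrow> 'x set \<Rightarrow> ('x, 'k::comm_ring_1) mpolynomial set" where
  "monomial_prime V \<sigma> = Idl\<^bsub>mpoly_ring V\<^esub> (var ` \<sigma>)"

text \<open>In both definitions below the intersection is taken inside \<open>k[V]\<close>, so that it is
  the unit ideal if \<open>C\<close> is empty. The power of an ideal is its power in the monoid
  \<^const>\<open>ideals_set\<close> of ideals under the ideal product.\<close>

definition intersection_ideal :: "'x set \<Rightarrow> 'x set set \<Rightarrow> ('x, 'k::comm_ring_1) mpolynomial set" where
  "intersection_ideal V C = carrier (mpoly_ring V) \<inter> (\<Inter>\<sigma>\<in>C. monomial_prime V \<sigma>)"

definition symbolic_power ::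
    "'x set \<Rightarrow> 'x set set \<Rightarrow> nat \<Rightarrow> ('x, 'k::comm_ring_1) mpolynomial set" where
  "symbolic_power V C m =
     carrier (mpoly_ring V) \<inter>
     (\<Inter>\<sigma>\<in>C. monomial_prime V \<sigma> [^]\<^bsub>ideals_set (mpoly_ring V)\<^esub> m)"


section \<open>Cohen-Macaulay rings\<close>

text \<open>\<open>localization R S\<close> is \<open>S\<inverse>R\<close> for a multiplicative subset \<open>S\<close>; its elements are
  the classes of the pairs \<open>(r, s)\<close>, standing for the fractions \<open>r/s\<close>.\<close>

definition fraction_rel :: "('a, 'b) ring_scheme \<Rightarrow> 'a set \<Rightarrow> (('a \<times> 'a) \<times> ('a \<times> 'a)) set" where
  "fraction_rel R S =
     {((r, s), (r', s')). r \<in> carrier R \<and> s \<in> S \<and> r' \<in> carrier R \<and> s' \<in> S \<and>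
        (\<exists>u\<in>S. u \<otimes>\<^bsub>R\<^esub> (r \<otimes>\<^bsub>R\<^esub> s' \<ominus>\<^bsub>R\<^esub> r' \<otimes>\<^bsub>R\<^esub> s) = \<zero>\<^bsub>R\<^esub>)}"

definition localization :: "('a, 'b) ring_scheme \<Rightarrow> 'a set \<Rightarrow> ('a \<times> 'a) set ring" where
  "localization R S =
     \<lparr>carrier = (carrier R \<times> S) // fraction_rel R S,
      monoid.mult = (\<lambda>F G. \<Union>(r, s)\<in>F. \<Union>(r', s')\<in>G.
                fraction_rel R S `` {(r \<otimes>\<^bsub>R\<^esub> r', s \<otimes>\<^bsub>R\<^esub> s')}),
      one = fraction_rel R S `` {(\<one>\<^bsub>R\<^esub>, \<one>\<^bsub>R\<^esub>)},
      ring.zero = fraction_rel R S `` {(\<zero>\<^bsub>R\<^esub>, \<one>\<^bsub>R\<^esub>)},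
      ring.add = (\<lambda>F G. \<Union>(r, s)\<in>F. \<Union>(r', s')\<in>G.
               fraction_rel R S `` {(r \<otimes>\<^bsub>R\<^esub> s' \<oplus>\<^bsub>R\<^esub> r' \<otimes>\<^bsub>R\<^esub> s, s \<otimes>\<^bsub>R\<^esub> s')})\<rparr>"

text \<open>Supremum of the lengths \<open>n\<close> of the chains \<open>P 0 \<subset> \<dots> \<subset> P n\<close> of prime ideals. The zero ring
  gets dimension \<open>0\<close> here, but only dimensions of local rings are used below.\<close>

definition krull_dim :: "('a, 'b) ring_scheme \<Rightarrow> enat" where
  "krull_dim R =
     Sup {enat n | n. \<exists>P :: nat \<Rightarrow> 'a set.
       (\<forall>i\<le>n. primeideal (P i) R) \<and> (\<forall>i<n. P i \<subset> P (Suc i))}"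

text \<open>Each \<open>x\<^sub>i\<close> is a nonzerodivisor on \<open>R/(x\<^sub>1,\<dots>,x\<^sub>i\<^sub>-\<^sub>1)\<close>, and \<open>R/(x\<^sub>1,\<dots>,x\<^sub>n)\<close> is nonzero.\<close>

definition regular_sequence :: "('a, 'b) ring_scheme \<Rightarrow> 'a list \<Rightarrow> bool" where
  "regular_sequence R xs \<longleftrightarrow>
     set xs \<subseteq> carrier R \<and>
     (\<forall>i<length xs. \<forall>a\<in>carrier R.
        xs ! i \<otimes>\<^bsub>R\<^esub> a \<in> Idl\<^bsub>R\<^esub> (set (take i xs)) \<longrightarrow> a \<in> Idl\<^bsub>R\<^esub> (set (take i xs))) \<and>
     Idl\<^bsub>R\<^esub> (set xs) \<noteq> carrier R"

definition depth :: "('a, 'b) ring_scheme \<Rightarrow> 'a set \<Rightarrow> enat" where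
  "depth R M = Sup {enat (length xs) | xs. regular_sequence R xs \<and> set xs \<subseteq> M}"

definition cohen_macaulay_local :: "('a, 'b) ring_scheme \<Rightarrow> bool" where
  "cohen_macaulay_local R \<longleftrightarrow>
     cring R \<and> noetherian_ring R \<and>
     (\<exists>M. {N. maximalideal N R} = {M} \<and> depth R M = krull_dim R)"

definition cohen_macaulay :: "('a, 'b) ring_scheme \<Rightarrow> bool" where
  "cohen_macaulay R \<longleftrightarrow>
     cring R \<and> noetherian_ring R \<and>
     (\<forall>M. maximalideal M R \<longrightarrow> cohen_macaulay_local (localization R (carrier R - M)))"


section \<open>Well-definedness\<close>

lemma cring_mpoly_ring: "cring (mpoly_ring V :: ('x, 'k::comm_ring_1) mpolynomial ring)"
proof -
  let ?R = "mpoly_ring V :: ('x, 'k) mpolynomial ring"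
  have carrier: "f \<in> carrier ?R \<longleftrightarrow> (\<forall>a\<in>Poly_Mapping.keys f. Poly_Mapping.keys a \<subseteq> V)" for f
    by (simp add: mpoly_ring_def)
  have ops: "f \<otimes>\<^bsub>?R\<^esub> g = f * g" "f \<oplus>\<^bsub>?R\<^esub> g = f + g" "\<one>\<^bsub>?R\<^esub> = 1" "\<zero>\<^bsub>?R\<^esub> = 0" for f g
    by (simp_all add: mpoly_ring_def)
  have add: "f + g \<in> carrier ?R" if "f \<in> carrier ?R" "g \<in> carrier ?R" for f g
    using that Poly_Mapping.keys_add[of f g] unfolding carrier by blast
  have mult: "f * g \<in> carrier ?R" if f: "f \<in> carrier ?R" and g: "g \<in> carrier ?R" for f g
    unfolding carrier
  proof
    fix c assume "c \<in> Poly_Mapping.keys (f * g)"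
    then obtain a b where c: "c = a + b" "a \<in> Poly_Mapping.keys f" "b \<in> Poly_Mapping.keys g"
      using keys_mult[of f g] by blast
    then have "Poly_Mapping.keys a \<subseteq> V" "Poly_Mapping.keys b \<subseteq> V"
      using f g unfolding carrier by blast+
    then show "Poly_Mapping.keys c \<subseteq> V"
      using Poly_Mapping.keys_add[of a b] c(1) by blast
  qed
  have uminus: "- f \<in> carrier ?R" if "f \<in> carrier ?R" for f
    using that unfolding carrier by simp
  have zero_one: "0 \<in> carrier ?R" "1 \<in> carrier ?R"
    unfolding carrier by simp_all
  show ?thesis
  proof (rule cringI)
    show "abelian_group ?R"
    proof (rule abelian_groupI, unfold ops)
      fix f assume "f \<in> carrier ?R"
      then show "\<exists>g\<in>carrier ?R. g + f = 0"
        by (intro bexI[of _ "- f"] uminus) simp_all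
    qed (simp_all add: add zero_one ac_simps)
    show "comm_monoid ?R"
      by (rule comm_monoidI, unfold ops) (simp_all add: mult zero_one ac_simps)
  qed (simp add: ops distrib_right)
qed

lemma var_in_mpoly_ring: "i \<in> V \<Longrightarrow> var i \<in> carrier (mpoly_ring V)"
  by (simp add: var_def mpoly_ring_def)

lemma ideal_monomial_prime:
  fixes V \<sigma> :: "'x set"
  assumes "\<sigma> \<subseteq> V"
  shows "ideal (monomial_prime V \<sigma> :: ('x, 'k::comm_ring_1) mpolynomial set) (mpoly_ring V)"
proof -
  interpret cring "mpoly_ring V :: ('x, 'k) mpolynomial ring"
    by (rule cring_mpoly_ring)
  show ?thesis
    unfolding monomial_prime_def using assms by (intro genideal_ideal) (auto intro: var_in_mpoly_ring)
qed

lemma ideal_symbolic_power: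
  assumes "\<And>\<sigma>. \<sigma> \<in> C \<Longrightarrow> \<sigma> \<subseteq> V"
  shows "ideal (symbolic_power V C m :: ('x, 'k::comm_ring_1) mpolynomial set) (mpoly_ring V)"
proof -
  let ?R = "mpoly_ring V :: ('x, 'k) mpolynomial ring"
  interpret cring ?R by (rule cring_mpoly_ring)
  interpret I: comm_monoid "ideals_set ?R" by (rule ideals_set_is_comm_monoid)
  define F where "F = insert (carrier ?R)
    ((\<lambda>\<sigma>. monomial_prime V \<sigma> [^]\<^bsub>ideals_set ?R\<^esub> m) ` C)"
  have "monomial_prime V \<sigma> [^]\<^bsub>ideals_set ?R\<^esub> m \<in> carrier (ideals_set ?R)" if "\<sigma> \<in> C" for \<sigma>
    using that ideal_monomial_prime[OF assms]
    by (intro I.nat_pow_closed) (simp add: ideals_set_def)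
  then have "ideal I ?R" if "I \<in> F" for I
    using that oneideal by (auto simp: F_def ideals_set_def)
  then have "ideal (\<Inter>F) ?R"
    by (intro i_Intersect) (auto simp: F_def)
  then show ?thesis by (simp add: F_def symbolic_power_def)
qed

lemma symbolic_power_1:
  assumes "\<And>\<sigma>. \<sigma> \<in> C \<Longrightarrow> \<sigma> \<subseteq> V"
  shows "symbolic_power V C 1 = (intersection_ideal V C :: ('x, 'k::comm_ring_1) mpolynomial set)"
proof -
  let ?R = "mpoly_ring V :: ('x, 'k) mpolynomial ring"
  interpret cring ?R by (rule cring_mpoly_ring)
  interpret I: comm_monoid "ideals_set ?R" by (rule ideals_set_is_comm_monoid)
  have "monomial_prime V \<sigma> [^]\<^bsub>ideals_set ?R\<^esub> (1::nat) = monomial_prime V \<sigma>" if "\<sigma> \<in> C" for \<sigma>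
    using that ideal_monomial_prime[OF assms, of \<sigma>]
    by (intro I.nat_pow_eone) (simp add: ideals_set_def)
  then show ?thesis by (auto simp: symbolic_power_def intersection_ideal_def)
qed

locale multiplicative_subset = cring R for R (structure) and S +
  assumes S_carrier: "S \<subseteq> carrier R"
    and S_one: "\<one> \<in> S"
    and S_mult: "s \<in> S \<Longrightarrow> s' \<in> S \<Longrightarrow> s \<otimes> s' \<in> S"
begin

lemma S_in_carrier [simp]: "s \<in> S \<Longrightarrow> s \<in> carrier R"
  using S_carrier by blast

lemma fraction_relI:
  assumes "r \<in> carrier R" "s \<in> S" "r' \<in> carrier R" "s' \<in> S" "u \<in> S"
    and "u \<otimes> (r \<otimes> s' \<ominus> r' \<otimes> s) = \<zero>"
  shows "((r, s), (r', s')) \<in> fraction_rel R S"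
  using assms unfolding fraction_rel_def by blast

lemma fraction_relE:
  assumes "(p, p') \<in> fraction_rel R S"
  obtains r s r' s' u where "p = (r, s)" "p' = (r', s')"
    "r \<in> carrier R" "s \<in> S" "r' \<in> carrier R" "s' \<in> S" "u \<in> S"
    "u \<otimes> (r \<otimes> s' \<ominus> r' \<otimes> s) = \<zero>"
  using assms unfolding fraction_rel_def by blast

lemma equiv_fraction_rel: "equiv (carrier R \<times> S) (fraction_rel R S)"
proof (rule equivI)
  show "fraction_rel R S \<subseteq> (carrier R \<times> S) \<times> (carrier R \<times> S)"
    by (auto simp: fraction_rel_def)
  show "refl_on (carrier R \<times> S) (fraction_rel R S)"
    using S_one by (auto simp: refl_on_def fraction_rel_def r_minus minus_eq r_neg intro!: bexI[of _ \<one>])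
  show "sym (fraction_rel R S)"
  proof (rule symI)
    fix p q assume "(p, q) \<in> fraction_rel R S"
    then obtain r s r' s' u where *: "p = (r, s)" "q = (r', s')"
      "r \<in> carrier R" "s \<in> S" "r' \<in> carrier R" "s' \<in> S" "u \<in> S"
      "u \<otimes> (r \<otimes> s' \<ominus> r' \<otimes> s) = \<zero>"
      by (rule fraction_relE)
    have "s \<in> carrier R" "s' \<in> carrier R" "u \<in> carrier R" using * by auto
    then have "u \<otimes> (r' \<otimes> s \<ominus> r \<otimes> s') = \<ominus> (u \<otimes> (r \<otimes> s' \<ominus> r' \<otimes> s))"
      using *(3,5) by algebra
    with * show "(q, p) \<in> fraction_rel R S" by (auto intro: fraction_relI)
  qed
  show "trans (fraction_rel R S)"
  proof (rule transI)
    fix p q o' assume "(p, q) \<in> fraction_rel R S" "(q, o') \<in> fraction_rel R S"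
    then obtain r s r' s' u r'' s'' w where *: "p = (r, s)" "q = (r', s')" "o' = (r'', s'')"
      "r \<in> carrier R" "s \<in> S" "r' \<in> carrier R" "s' \<in> S" "u \<in> S"
      "r'' \<in> carrier R" "s'' \<in> S" "w \<in> S" and
      u: "u \<otimes> (r \<otimes> s' \<ominus> r' \<otimes> s) = \<zero>" and
      w: "w \<otimes> (r' \<otimes> s'' \<ominus> r'' \<otimes> s') = \<zero>"
      by (auto elim!: fraction_relE)
    have c: "s \<in> carrier R" "s' \<in> carrier R" "u \<in> carrier R" "s'' \<in> carrier R" "w \<in> carrier R"
      using * by auto
    have "(s' \<otimes> u \<otimes> w) \<otimes> (r \<otimes> s'' \<ominus> r'' \<otimes> s) =
      (w \<otimes> s'') \<otimes> (u \<otimes> (r \<otimes> s' \<ominus> r' \<otimes> s)) \<oplus> (u \<otimes> s) \<otimes> (w \<otimes> (r' \<otimes> s'' \<ominus> r'' \<otimes> s'))"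
      using *(4,6,9) c by algebra
    also have "\<dots> = \<zero>" unfolding u w using c by simp
    finally show "(p, o') \<in> fraction_rel R S"
      using * S_mult by (auto intro!: fraction_relI[where u = "s' \<otimes> u \<otimes> w"])
  qed
qed

abbreviation fraction :: "'a \<Rightarrow> 'a \<Rightarrow> ('a \<times> 'a) set" where
  "fraction r s \<equiv> fraction_rel R S `` {(r, s)}"

lemma fraction_eqI:
  assumes "r \<in> carrier R" "s \<in> S" "r' \<in> carrier R" "s' \<in> S"
    and "r \<otimes> s' = r' \<otimes> s"
  shows "fraction r s = fraction r' s'"
  using assms S_one
  by (intro equiv_class_eq[OF equiv_fraction_rel] fraction_relI[where u = \<one>])
    (auto simp: minus_eq r_neg)

lemma carrier_localization:
  "carrier (localization R S) = {fraction r s | r s. r \<in> carrier R \<and> s \<in> S}"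
  by (auto simp: localization_def quotient_def)

lemma mult_localization:
  assumes "r \<in> carrier R" "s \<in> S" "r' \<in> carrier R" "s' \<in> S"
  shows "fraction r s \<otimes>\<^bsub>localization R S\<^esub> fraction r' s' = fraction (r \<otimes> r') (s \<otimes> s')"
proof -
  have "congruent2 (fraction_rel R S) (fraction_rel R S)
    (\<lambda>p q. (case p of (r, s) \<Rightarrow> case q of (r', s') \<Rightarrow> fraction (r \<otimes> r') (s \<otimes> s')))"
  proof (rule congruent2_commuteI[OF equiv_fraction_rel])
    fix p q o' assume "o' \<in> carrier R \<times> S" "(p, q) \<in> fraction_rel R S"
    then obtain r s r' s' u a b where *: "p = (r, s)" "q = (r', s')" "o' = (a, b)"
      "r \<in> carrier R" "s \<in> S" "r' \<in> carrier R" "s' \<in> S" "u \<in> S" "a \<in> carrier R" "b \<in> S"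
      and u: "u \<otimes> (r \<otimes> s' \<ominus> r' \<otimes> s) = \<zero>"
      by (auto elim!: fraction_relE)
    have c: "s \<in> carrier R" "s' \<in> carrier R" "u \<in> carrier R" "b \<in> carrier R" using * by auto
    have "u \<otimes> ((a \<otimes> r) \<otimes> (b \<otimes> s') \<ominus> (a \<otimes> r') \<otimes> (b \<otimes> s)) =
      (a \<otimes> b) \<otimes> (u \<otimes> (r \<otimes> s' \<ominus> r' \<otimes> s))"
      using *(4,6,9) c by algebra
    also have "\<dots> = \<zero>" unfolding u using c *(9) by simp
    finally show "(case o' of (r, s) \<Rightarrow> case p of (r', s') \<Rightarrow> fraction (r \<otimes> r') (s \<otimes> s')) =
      (case o' of (r, s) \<Rightarrow> case q of (r', s') \<Rightarrow> fraction (r \<otimes> r') (s \<otimes> s'))"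
      using * S_mult
      by (auto intro!: equiv_class_eq[OF equiv_fraction_rel] fraction_relI[where u = u])
  qed (auto simp: m_comm)
  from UN_equiv_class2[OF equiv_fraction_rel equiv_fraction_rel this, of "(r, s)" "(r', s')"]
  show ?thesis using assms by (simp add: localization_def case_prod_unfold)
qed

lemma add_localization:
  assumes "r \<in> carrier R" "s \<in> S" "r' \<in> carrier R" "s' \<in> S"
  shows "fraction r s \<oplus>\<^bsub>localization R S\<^esub> fraction r' s' =
    fraction (r \<otimes> s' \<oplus> r' \<otimes> s) (s \<otimes> s')"
proof -
  have "congruent2 (fraction_rel R S) (fraction_rel R S)
    (\<lambda>p q. (case p of (r, s) \<Rightarrow> case q of (r', s') \<Rightarrow>
      fraction (r \<otimes> s' \<oplus> r' \<otimes> s) (s \<otimes> s')))"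
  proof (rule congruent2_commuteI[OF equiv_fraction_rel])
    fix p q o' assume "o' \<in> carrier R \<times> S" "(p, q) \<in> fraction_rel R S"
    then obtain r s r' s' u a b where *: "p = (r, s)" "q = (r', s')" "o' = (a, b)"
      "r \<in> carrier R" "s \<in> S" "r' \<in> carrier R" "s' \<in> S" "u \<in> S" "a \<in> carrier R" "b \<in> S"
      and u: "u \<otimes> (r \<otimes> s' \<ominus> r' \<otimes> s) = \<zero>"
      by (auto elim!: fraction_relE)
    have c: "s \<in> carrier R" "s' \<in> carrier R" "u \<in> carrier R" "b \<in> carrier R" using * by auto
    have "u \<otimes> ((a \<otimes> s \<oplus> r \<otimes> b) \<otimes> (b \<otimes> s') \<ominus> (a \<otimes> s' \<oplus> r' \<otimes> b) \<otimes> (b \<otimes> s)) =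
      (b \<otimes> b) \<otimes> (u \<otimes> (r \<otimes> s' \<ominus> r' \<otimes> s))"
      using *(4,6,9) c by algebra
    also have "\<dots> = \<zero>" unfolding u using c by simp
    finally show "(case o' of (r, s) \<Rightarrow> case p of (r', s') \<Rightarrow>
        fraction (r \<otimes> s' \<oplus> r' \<otimes> s) (s \<otimes> s')) =
      (case o' of (r, s) \<Rightarrow> case q of (r', s') \<Rightarrow> fraction (r \<otimes> s' \<oplus> r' \<otimes> s) (s \<otimes> s'))"
      using * S_mult
      by (auto intro!: equiv_class_eq[OF equiv_fraction_rel] fraction_relI[where u = u])
  qed (auto simp: m_comm a_comm)
  from UN_equiv_class2[OF equiv_fraction_rel equiv_fraction_rel this, of "(r, s)" "(r', s')"]
  show ?thesis using assms by (simp add: localization_def case_prod_unfold)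
qed

lemma one_localization: "\<one>\<^bsub>localization R S\<^esub> = fraction \<one> \<one>"
  and zero_localization: "\<zero>\<^bsub>localization R S\<^esub> = fraction \<zero> \<one>"
  by (simp_all add: localization_def)

lemmas localization_simps =
  mult_localization add_localization one_localization zero_localization

lemma cring_localization: "cring (localization R S)"
proof (rule cringI)
  let ?L = "localization R S"
  have cases: thesis if "F \<in> carrier ?L"
    "\<And>r s. F = fraction r s \<Longrightarrow> r \<in> carrier R \<Longrightarrow> s \<in> S \<Longrightarrow> thesis" for F thesis
    using that unfolding carrier_localization by blast
  have frac_in: "fraction r s \<in> carrier ?L" if "r \<in> carrier R" "s \<in> S" for r s
    using that unfolding carrier_localization by blast
  note [simp] = S_one S_mult localization_simps
  show "abelian_group ?L"
  proof (rule abelian_groupI)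
    fix F G assume F: "F \<in> carrier ?L" and G: "G \<in> carrier ?L"
    obtain r s where [simp]: "F = fraction r s" "r \<in> carrier R" "s \<in> S"
      using F by (rule cases)
    obtain r' s' where [simp]: "G = fraction r' s'" "r' \<in> carrier R" "s' \<in> S"
      using G by (rule cases)
    show "F \<oplus>\<^bsub>?L\<^esub> G \<in> carrier ?L" by (simp add: frac_in)
    show "F \<oplus>\<^bsub>?L\<^esub> G = G \<oplus>\<^bsub>?L\<^esub> F" by (simp add: m_comm a_comm)
  next
    show "\<zero>\<^bsub>?L\<^esub> \<in> carrier ?L" by (simp add: frac_in)
  next
    fix F G H assume *: "F \<in> carrier ?L" "G \<in> carrier ?L" "H \<in> carrier ?L"
    obtain r s where [simp]: "F = fraction r s" "r \<in> carrier R" "s \<in> S"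
      using *(1) by (rule cases)
    obtain r' s' where [simp]: "G = fraction r' s'" "r' \<in> carrier R" "s' \<in> S"
      using *(2) by (rule cases)
    obtain r'' s'' where [simp]: "H = fraction r'' s''" "r'' \<in> carrier R" "s'' \<in> S"
      using *(3) by (rule cases)
    have c: "s \<in> carrier R" "s' \<in> carrier R" "s'' \<in> carrier R" by simp_all
    show "F \<oplus>\<^bsub>?L\<^esub> G \<oplus>\<^bsub>?L\<^esub> H = F \<oplus>\<^bsub>?L\<^esub> (G \<oplus>\<^bsub>?L\<^esub> H)"
    proof -
      have "(r \<otimes> s' \<oplus> r' \<otimes> s) \<otimes> s'' \<oplus> r'' \<otimes> (s \<otimes> s') =
        r \<otimes> (s' \<otimes> s'') \<oplus> (r' \<otimes> s'' \<oplus> r'' \<otimes> s') \<otimes> s"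
        using c \<open>r \<in> carrier R\<close> \<open>r' \<in> carrier R\<close> \<open>r'' \<in> carrier R\<close> by algebra
      then show ?thesis using c by (simp add: m_assoc)
    qed
  next
    fix F assume F: "F \<in> carrier ?L"
    obtain r s where [simp]: "F = fraction r s" "r \<in> carrier R" "s \<in> S" using F by (rule cases)
    show "\<zero>\<^bsub>?L\<^esub> \<oplus>\<^bsub>?L\<^esub> F = F" by simp
    have "fraction (\<ominus> r) s \<oplus>\<^bsub>?L\<^esub> F = \<zero>\<^bsub>?L\<^esub>"
      by (simp, rule fraction_eqI) (simp_all add: l_minus l_neg)
    then show "\<exists>G\<in>carrier ?L. G \<oplus>\<^bsub>?L\<^esub> F = \<zero>\<^bsub>?L\<^esub>"
      by (intro bexI[of _ "fraction (\<ominus> r) s"]) (simp_all add: frac_in)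
  qed
  show "comm_monoid ?L"
  proof (rule comm_monoidI)
    fix F G assume F: "F \<in> carrier ?L" and G: "G \<in> carrier ?L"
    obtain r s where [simp]: "F = fraction r s" "r \<in> carrier R" "s \<in> S"
      using F by (rule cases)
    obtain r' s' where [simp]: "G = fraction r' s'" "r' \<in> carrier R" "s' \<in> S"
      using G by (rule cases)
    show "F \<otimes>\<^bsub>?L\<^esub> G \<in> carrier ?L" by (simp add: frac_in)
    show "F \<otimes>\<^bsub>?L\<^esub> G = G \<otimes>\<^bsub>?L\<^esub> F" by (simp add: m_comm)
  next
    show "\<one>\<^bsub>?L\<^esub> \<in> carrier ?L" by (simp add: frac_in)
  next
    fix F G H assume *: "F \<in> carrier ?L" "G \<in> carrier ?L" "H \<in> carrier ?L"
    obtain r s where [simp]: "F = fraction r s" "r \<in> carrier R" "s \<in> S"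
      using *(1) by (rule cases)
    obtain r' s' where [simp]: "G = fraction r' s'" "r' \<in> carrier R" "s' \<in> S"
      using *(2) by (rule cases)
    obtain r'' s'' where [simp]: "H = fraction r'' s''" "r'' \<in> carrier R" "s'' \<in> S"
      using *(3) by (rule cases)
    have c: "s \<in> carrier R" "s' \<in> carrier R" "s'' \<in> carrier R" by simp_all
    show "F \<otimes>\<^bsub>?L\<^esub> G \<otimes>\<^bsub>?L\<^esub> H = F \<otimes>\<^bsub>?L\<^esub> (G \<otimes>\<^bsub>?L\<^esub> H)" by (simp add: m_assoc)
  next
    fix F assume F: "F \<in> carrier ?L"
    obtain r s where [simp]: "F = fraction r s" "r \<in> carrier R" "s \<in> S" using F by (rule cases)
    show "\<one>\<^bsub>?L\<^esub> \<otimes>\<^bsub>?L\<^esub> F = F" by simp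
  qed
  fix F G H assume *: "F \<in> carrier ?L" "G \<in> carrier ?L" "H \<in> carrier ?L"
  obtain r s where [simp]: "F = fraction r s" "r \<in> carrier R" "s \<in> S"
      using *(1) by (rule cases)
    obtain r' s' where [simp]: "G = fraction r' s'" "r' \<in> carrier R" "s' \<in> S"
      using *(2) by (rule cases)
    obtain r'' s'' where [simp]: "H = fraction r'' s''" "r'' \<in> carrier R" "s'' \<in> S"
      using *(3) by (rule cases)
    have c: "s \<in> carrier R" "s' \<in> carrier R" "s'' \<in> carrier R" by simp_all
  show "(F \<oplus>\<^bsub>?L\<^esub> G) \<otimes>\<^bsub>?L\<^esub> H = F \<otimes>\<^bsub>?L\<^esub> H \<oplus>\<^bsub>?L\<^esub> G \<otimes>\<^bsub>?L\<^esub> H"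
  proof -
    have "((r \<otimes> s' \<oplus> r' \<otimes> s) \<otimes> r'') \<otimes> ((s \<otimes> s'') \<otimes> (s' \<otimes> s'')) =
      ((r \<otimes> r'') \<otimes> (s' \<otimes> s'') \<oplus> (r' \<otimes> r'') \<otimes> (s \<otimes> s'')) \<otimes> ((s \<otimes> s') \<otimes> s'')"
      using c \<open>r \<in> carrier R\<close> \<open>r' \<in> carrier R\<close> \<open>r'' \<in> carrier R\<close> by algebra
    then show ?thesis by (simp add: fraction_eqI)
  qed
qed

end

lemma (in primeideal) multiplicative_subset_complement:
  "multiplicative_subset R (carrier R - I)"
proof (unfold_locales)
  show "\<one> \<in> carrier R - I"
    using I_notcarr one_imp_carrier by blast
qed (use I_prime in auto)

end

theory Submission
  imports Defs "HOL-Library.Nat_Bijection"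
begin

text \<open>
  Write \<open>S = k[V]\<close>, \<open>I = J\<^sub>C\<^sup>(\<^sup>m\<^sup>)\<close> and \<open>d = v - n\<close>. A monomial \<open>x\<^sup>a\<close> lies outside \<open>I\<close> iff some
  \<open>\<sigma> \<in> C\<close> has \<open>a(\<sigma>) < m\<close>. Sort these monomials by the \<open>\<sigma> \<in> C\<close> minimizing \<open>a(\<sigma>)\<close> (ties broken by a
  generic perturbation) and by the restriction of \<open>a\<close> to \<open>\<sigma>\<close>. Two blocks never differ by exchanging one
  point, so \<open>C\<close> consists of the bases of a matroid, and minimality of \<open>\<sigma>\<close> can be tested on single
  exchanges; hence each class is a translate of the monomials of \<open>k[V - \<sigma>]\<close>. Removing the classes in the
  order of increasing minimal weight gives a filtration of \<open>S/I\<close> with factors \<open>S/\<pp>\<^sub>\<sigma>\<close>, \<open>\<sigma> \<in> C\<close>, so a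
  sequence which is regular on every \<open>S/\<pp>\<^sub>\<sigma>\<close> is regular on \<open>S/I\<close>.

  Given a maximal ideal \<open>M\<close>, the Nullstellensatz provides nonzero \<open>y\<^sub>j \<in> M\<close> which are polynomials in
  \<open>x\<^sub>j\<close> alone without constant term. The elementary symmetric polynomials \<open>e\<^sub>d(y), \<dots>, e\<^sub>1(y)\<close>, in this
  order, are regular on every \<open>S/\<pp>\<^sub>\<sigma>\<close>: modulo \<open>\<pp>\<^sub>\<sigma>\<close> the first one is the product of the \<open>y\<^sub>j\<close> with
  \<open>j \<notin> \<sigma>\<close>, and one continues by induction modulo each factor. So the local ring at \<open>M\<close> has depth at least
  \<open>d\<close>. Its dimension is at most \<open>d\<close>, since a prime over \<open>I\<close> contains some \<open>\<pp>\<^sub>\<sigma>\<close> and transcendence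
  degrees drop along chains of primes.
\<close>

section \<open>Weakly regular sequences\<close>

text \<open>The maximal ideal M is arbitrary: it need not contain any variable, and k may be finite
  or not algebraically closed, so neither the variables nor general linear forms can serve as
  parameters. The \<open>y_j\<close> take the place of the variables, and their symmetric functions
  treat all \<open>\<sigma>\<close> alike, so that one sequence serves every factor of the
  filtration although the sets \<open>V - \<sigma>\<close> differ. The missing constant term puts
  \<open>y_j\<close> into the prime of \<open>\<sigma>\<close> whenever
  \<open>j \<in> \<sigma>\<close>; exactly d of the \<open>y_j\<close> then survive, which is why
  the degrees start at d and decrease. All factors have the same dimension d, and the conclusion is
  a squeeze: d \<le> depth \<le> dimension \<le> d. Ties must be broken because the classes are
  disjoint only if the minimal \<open>\<sigma>\<close> is unique. The perturbed weight has to remain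
  a sum over the points of \<open>\<sigma>\<close>, since the exchange argument compares weights
  point by point.\<close>

locale comm_subring =
  fixes A :: "'a::comm_ring_1 set"
  assumes one_mem [simp]: "1 \<in> A"
    and add_mem [intro]: "x \<in> A \<Longrightarrow> y \<in> A \<Longrightarrow> x + y \<in> A"
    and uminus_mem [intro]: "x \<in> A \<Longrightarrow> - x \<in> A"
    and mult_mem [intro]: "x \<in> A \<Longrightarrow> y \<in> A \<Longrightarrow> x * y \<in> A"
begin

lemma diff_mem [intro]: "x \<in> A \<Longrightarrow> y \<in> A \<Longrightarrow> x - y \<in> A"
  using add_mem[of x "- y"] by auto

lemma zero_mem [simp]: "0 \<in> A"
  using diff_mem[OF one_mem one_mem] by simp

lemma sum_mem: "(\<And>i. i \<in> F \<Longrightarrow> f i \<in> A) \<Longrightarrow> sum f F \<in> A"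
  by (induction F rule: infinite_finite_induct) auto

lemma prod_mem: "(\<And>i. i \<in> F \<Longrightarrow> f i \<in> A) \<Longrightarrow> prod f F \<in> A"
  by (induction F rule: infinite_finite_induct) auto

lemma power_mem: "x \<in> A \<Longrightarrow> x ^ n \<in> A"
  by (induction n) auto

definition ideal_of :: "'a set \<Rightarrow> bool" where
  "ideal_of I \<longleftrightarrow> I \<subseteq> A \<and> 0 \<in> I \<and> (\<forall>x\<in>I. \<forall>y\<in>I. x + y \<in> I) \<and> (\<forall>a\<in>A. \<forall>x\<in>I. a * x \<in> I)"

definition adjoin :: "'a set \<Rightarrow> 'a \<Rightarrow> 'a set" where
  "adjoin I f = {x + a * f | x a. x \<in> I \<and> a \<in> A}"

definition nonzerodivisor_mod :: "'a set \<Rightarrow> 'a \<Rightarrow> bool" where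
  "nonzerodivisor_mod I f \<longleftrightarrow> (\<forall>a\<in>A. f * a \<in> I \<longrightarrow> a \<in> I)"

text \<open>Nothing asks the last quotient to be nonzero: the filtrations pass through zero
  quotients, on which every sequence qualifies. Properness comes back at the end because the
  sequence lies in a maximal ideal.\<close>

primrec weakly_regular :: "'a set \<Rightarrow> 'a list \<Rightarrow> bool" where
  "weakly_regular I [] \<longleftrightarrow> True"
| "weakly_regular I (f # fs) \<longleftrightarrow> nonzerodivisor_mod I f \<and> weakly_regular (adjoin I f) fs"

lemma ideal_ofD:
  assumes "ideal_of I"
  shows "x \<in> I \<Longrightarrow> x \<in> A" "0 \<in> I" "x \<in> I \<Longrightarrow> y \<in> I \<Longrightarrow> x + y \<in> I"
    "a \<in> A \<Longrightarrow> x \<in> I \<Longrightarrow> a * x \<in> I" "a \<in> A \<Longrightarrow> x \<in> I \<Longrightarrow> x * a \<in> I"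
    "x \<in> I \<Longrightarrow> - x \<in> I" "x \<in> I \<Longrightarrow> y \<in> I \<Longrightarrow> x - y \<in> I"
proof -
  note * = assms[unfolded ideal_of_def]
  show 1: "x \<in> I \<Longrightarrow> x \<in> A" and "0 \<in> I" and add: "x \<in> I \<Longrightarrow> y \<in> I \<Longrightarrow> x + y \<in> I"
    and l: "a \<in> A \<Longrightarrow> x \<in> I \<Longrightarrow> a * x \<in> I" for x y a
    using * by auto
  show "a \<in> A \<Longrightarrow> x \<in> I \<Longrightarrow> x * a \<in> I"
    using l[of a x] by (simp add: mult.commute)
  show um: "x \<in> I \<Longrightarrow> - x \<in> I" for x
    using l[of "- 1" x] uminus_mem[OF one_mem] by simp
  show "x \<in> I \<Longrightarrow> y \<in> I \<Longrightarrow> x - y \<in> I"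
    using add[of x "- y"] um[of y] by simp
qed

lemma ideal_of_whole: "ideal_of A"
  by (auto simp: ideal_of_def)

lemma ideal_of_sum: "ideal_of I \<Longrightarrow> (\<And>i. i \<in> F \<Longrightarrow> f i \<in> I) \<Longrightarrow> sum f F \<in> I"
  by (induction F rule: infinite_finite_induct) (auto intro: ideal_ofD)

lemma adjoinI: "x \<in> I \<Longrightarrow> a \<in> A \<Longrightarrow> x + a * f \<in> adjoin I f"
  unfolding adjoin_def by blast

lemma adjoinE:
  assumes "z \<in> adjoin I f"
  obtains x a where "x \<in> I" "a \<in> A" "z = x + a * f"
  using assms unfolding adjoin_def by blast

lemma ideal_of_adjoin:
  assumes I: "ideal_of I" and f: "f \<in> A"
  shows "ideal_of (adjoin I f)"
  unfolding ideal_of_def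
proof (intro conjI ballI)
  show "adjoin I f \<subseteq> A"
    using f by (auto elim!: adjoinE intro: ideal_ofD(1)[OF I])
  show "0 \<in> adjoin I f"
    using adjoinI[of 0 I 0 f] ideal_ofD(2)[OF I] by simp
next
  fix x y assume "x \<in> adjoin I f" "y \<in> adjoin I f"
  then obtain i a j b where *: "i \<in> I" "a \<in> A" "x = i + a * f" "j \<in> I" "b \<in> A" "y = j + b * f"
    by (auto elim!: adjoinE)
  then have "x + y = (i + j) + (a + b) * f" by (simp add: algebra_simps)
  moreover have "(i + j) + (a + b) * f \<in> adjoin I f"
    using * by (intro adjoinI ideal_ofD(3)[OF I]) auto
  ultimately show "x + y \<in> adjoin I f" by simp
next
  fix c x assume "c \<in> A" "x \<in> adjoin I f"
  then obtain i a where *: "i \<in> I" "a \<in> A" "x = i + a * f" by (auto elim!: adjoinE)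
  then have "c * x = c * i + (c * a) * f" by (simp add: algebra_simps)
  moreover have "c * i + (c * a) * f \<in> adjoin I f"
    using * \<open>c \<in> A\<close> by (intro adjoinI ideal_ofD(4)[OF I]) auto
  ultimately show "c * x \<in> adjoin I f" by simp
qed

lemma subset_adjoin: "x \<in> I \<Longrightarrow> x \<in> adjoin I f"
  using adjoinI[of x I 0 f] by simp

lemma self_adjoin: "ideal_of I \<Longrightarrow> f \<in> adjoin I f"
  using adjoinI[of 0 I 1 f] ideal_ofD(2) by simp

lemma adjoin_minimal:
  "ideal_of J \<Longrightarrow> I \<subseteq> J \<Longrightarrow> f \<in> J \<Longrightarrow> adjoin I f \<subseteq> J"
  by (auto elim!: adjoinE intro!: ideal_ofD(3)[of J] ideal_ofD(4)[of J])

lemma adjoin_commute: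
  assumes I: "ideal_of I" and "f \<in> A" "g \<in> A"
  shows "adjoin (adjoin I f) g = adjoin (adjoin I g) f"
proof -
  have "adjoin (adjoin I f) g \<subseteq> adjoin (adjoin I g) f" if "f \<in> A" "g \<in> A" for f g
    using that I
    by (intro adjoin_minimal ideal_of_adjoin subsetI)
      (auto intro: subset_adjoin self_adjoin ideal_of_adjoin)
  with assms show ?thesis by blast
qed

lemma adjoin_cong:
  assumes I: "ideal_of I" and "f \<in> A" "g \<in> A" "f - g \<in> I"
  shows "adjoin I f = adjoin I g"
proof -
  have "adjoin I f \<subseteq> adjoin I g" if "f \<in> A" "g \<in> A" "f - g \<in> I" for f g
  proof (intro adjoin_minimal ideal_of_adjoin subsetI)
    show "f \<in> adjoin I g"
      using adjoinI[of "f - g" I 1 g] that by simp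
  qed (use that I in \<open>auto intro: subset_adjoin\<close>)
  moreover have "g - f \<in> I"
    using ideal_ofD(6)[OF I assms(4)] by simp
  ultimately show ?thesis using assms by blast
qed

lemma adjoin_one: "ideal_of I \<Longrightarrow> adjoin I 1 = A"
  using ideal_of_adjoin[of I 1] adjoinI[of 0 I _ 1]
  by (auto simp: ideal_of_def)

lemma weakly_regular_whole: "set fs \<subseteq> A \<Longrightarrow> weakly_regular A fs"
proof (induction fs)
  case (Cons f fs)
  have "adjoin A f = A"
    using Cons.prems adjoin_minimal[OF ideal_of_whole, of A f] subset_adjoin[of _ A f] by auto
  with Cons show ?case by (simp add: nonzerodivisor_mod_def)
qed simp

definition colon :: "'a set \<Rightarrow> 'a \<Rightarrow> 'a set" where
  "colon I u = {a \<in> A. u * a \<in> I}"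

text \<open>The exact sequence \<open>0 \<rightarrow> A/(I : u) \<rightarrow> A/I \<rightarrow> A/(I + u) \<rightarrow> 0\<close> stays exact modulo \<open>f\<close> when \<open>f\<close> is
  regular on its right-hand term.\<close>

lemma weakly_regular_colon:
  assumes "ideal_of I" "u \<in> A" "set fs \<subseteq> A"
    and "weakly_regular (colon I u) fs" "weakly_regular (adjoin I u) fs"
  shows "weakly_regular I fs"
  using assms
proof (induction fs arbitrary: I)
  case (Cons f fs)
  note I = Cons.prems(1) and u = Cons.prems(2)
  have f: "f \<in> A" and fs: "set fs \<subseteq> A" using Cons.prems(3) by auto
  have J: "a \<in> A \<Longrightarrow> f * a \<in> colon I u \<Longrightarrow> a \<in> colon I u"
    and K: "a \<in> A \<Longrightarrow> f * a \<in> adjoin I u \<Longrightarrow> a \<in> adjoin I u" for a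
    using Cons.prems(4,5) by (auto simp: nonzerodivisor_mod_def)
  have "nonzerodivisor_mod I f"
    unfolding nonzerodivisor_mod_def
  proof (intro ballI impI)
    fix a assume a: "a \<in> A" "f * a \<in> I"
    then have "a \<in> adjoin I u" using K subset_adjoin by blast
    then obtain i b where b: "i \<in> I" "b \<in> A" "a = i + b * u" by (rule adjoinE)
    have "u * (f * b) = f * a - f * i" using b by (simp add: algebra_simps)
    moreover have "f * a - f * i \<in> I"
      using a b f I by (auto intro!: ideal_ofD(7)[OF I] ideal_ofD(4)[OF I])
    ultimately have "f * b \<in> colon I u" using b f by (auto simp: colon_def)
    then have "u * b \<in> I" using J b(2) by (auto simp: colon_def)
    then show "a \<in> I" using b ideal_ofD(3)[OF I b(1), of "u * b"] by (simp add: mult.commute)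
  qed
  moreover have "weakly_regular (adjoin I f) fs"
  proof (rule Cons.IH)
    \<comment> \<open>This is the exactness on the left after reduction modulo f. If
      \<open>u * a\<close> is b times f modulo I, then b lies in I + (u) because f is regular there,
      and subtracting a multiple of f moves a into I : u.\<close>
    have "colon (adjoin I f) u = adjoin (colon I u) f"
    proof (intro equalityI subsetI)
      fix a assume "a \<in> colon (adjoin I f) u"
      then have a: "a \<in> A" "u * a \<in> adjoin I f" by (auto simp: colon_def)
      from a(2) obtain i b where b: "i \<in> I" "b \<in> A" "u * a = i + b * f" by (rule adjoinE)
      have "f * b = - i + a * u" using b(3) by (simp add: algebra_simps)
      then have "f * b \<in> adjoin I u" using adjoinI[OF ideal_ofD(6)[OF I b(1)] a(1), of u] by simp
      then have "b \<in> adjoin I u" using K b by auto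
      then obtain j c where c: "j \<in> I" "c \<in> A" "b = j + c * u" by (rule adjoinE)
      have "u * (a - c * f) = i + f * j" using b(3) c(3) by (simp add: algebra_simps)
      then have "a - c * f \<in> colon I u"
        using a b c f by (auto simp: colon_def intro!: ideal_ofD(3)[OF I] ideal_ofD(4)[OF I])
      then show "a \<in> adjoin (colon I u) f" using adjoinI[of "a - c * f" _ c f] c by simp
    next
      fix a assume "a \<in> adjoin (colon I u) f"
      then obtain b c where "b \<in> colon I u" "c \<in> A" "a = b + c * f" by (rule adjoinE)
      moreover from this have "u * a = u * b + (u * c) * f" by (simp add: algebra_simps)
      ultimately show "a \<in> colon (adjoin I f) u"
        using f u adjoinI[of "u * b" I "u * c" f] by (auto simp: colon_def)
    qed
    then show "weakly_regular (colon (adjoin I f) u) fs" using Cons.prems(4) by simp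
    show "weakly_regular (adjoin (adjoin I f) u) fs"
      using Cons.prems(5) adjoin_commute[OF I u f] by simp
  qed (use I f u fs in \<open>auto intro: ideal_of_adjoin\<close>)
  ultimately show ?case by simp
qed simp

text \<open>In A/(I + uw) the class of u generates a copy of A/(I + w), because u is regular modulo
  I, and the quotient by it is A/(I + u).\<close>

lemma weakly_regular_adjoin_mult:
  assumes I: "ideal_of I" and "u \<in> A" "w \<in> A" "set fs \<subseteq> A"
    and nzd: "nonzerodivisor_mod I u"
    and "weakly_regular (adjoin I u) fs" "weakly_regular (adjoin I w) fs"
  shows "weakly_regular (adjoin I (u * w)) fs"
proof (rule weakly_regular_colon[of _ u])
  have "colon (adjoin I (u * w)) u = adjoin I w"
  proof (intro equalityI subsetI)
    fix a assume "a \<in> colon (adjoin I (u * w)) u"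
    then have a: "a \<in> A" "u * a \<in> adjoin I (u * w)" by (auto simp: colon_def)
    from a(2) obtain i b where b: "i \<in> I" "b \<in> A" "u * a = i + b * (u * w)" by (rule adjoinE)
    then have "u * (a - b * w) \<in> I" by (simp add: algebra_simps)
    then have "a - b * w \<in> I" using nzd a b \<open>w \<in> A\<close> by (auto simp: nonzerodivisor_mod_def)
    then show "a \<in> adjoin I w" using adjoinI[of "a - b * w" I b w] b by simp
  next
    fix a assume "a \<in> adjoin I w"
    then obtain i b where b: "i \<in> I" "b \<in> A" "a = i + b * w" by (rule adjoinE)
    then have "u * a = u * i + b * (u * w)" by (simp add: algebra_simps)
    moreover have "u * i + b * (u * w) \<in> adjoin I (u * w)"
      using b assms by (intro adjoinI ideal_ofD(4)[OF I])
    moreover have "a \<in> A" using b assms ideal_ofD(1)[OF I b(1)] by auto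
    ultimately show "a \<in> colon (adjoin I (u * w)) u" by (simp add: colon_def)
  qed
  then show "weakly_regular (colon (adjoin I (u * w)) u) fs" using assms by simp
  have "adjoin (adjoin I (u * w)) u = adjoin I u"
  proof (intro equalityI adjoin_minimal subsetI)
    show "u * w \<in> adjoin I u"
      using adjoinI[of 0 I w u] ideal_ofD(2)[OF I] assms by (simp add: mult.commute)
    show "u \<in> adjoin (adjoin I (u * w)) u"
      using assms by (intro self_adjoin ideal_of_adjoin) auto
  qed (use assms in \<open>auto intro: ideal_of_adjoin self_adjoin subset_adjoin\<close>)
  then show "weakly_regular (adjoin (adjoin I (u * w)) u) fs" using assms by simp
qed (use assms in \<open>auto intro: ideal_of_adjoin\<close>)

end

section \<open>Elementary symmetric polynomials as regular sequences\<close>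

definition esym :: "('i \<Rightarrow> 'a::comm_ring_1) \<Rightarrow> 'i set \<Rightarrow> nat \<Rightarrow> 'a" where
  "esym y V c = (\<Sum>T | T \<subseteq> V \<and> card T = c. \<Prod>j\<in>T. y j)"

text \<open>In decreasing degree, so that the tail of the list for \<open>Suc c\<close> is the list
  for c, which is the one needed once one more \<open>y j\<close> has become zero.\<close>

primrec esyms :: "('i \<Rightarrow> 'a::comm_ring_1) \<Rightarrow> 'i set \<Rightarrow> nat \<Rightarrow> 'a list" where
  "esyms y V 0 = []"
| "esyms y V (Suc c) = esym y V (Suc c) # esyms y V c"

lemma length_esyms [simp]: "length (esyms y V c) = c"
  by (induction c) auto

context comm_subring
begin

lemma esyms_subset:
  assumes I: "ideal_of I" and y: "\<And>j. j \<in> V \<Longrightarrow> y j \<in> I"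
  shows "set (esyms y V c) \<subseteq> I"
proof (induction c)
  case (Suc c)
  have "(\<Prod>j\<in>T. y j) \<in> I" if "T \<subseteq> V" "card T = Suc c" for T
  proof -
    have "T \<noteq> {}" using that by auto
    then obtain j where "j \<in> T" by blast
    moreover have "finite T" using that card.infinite by fastforce
    ultimately show ?thesis
      using y that by (subst prod.remove[of T j])
        (auto intro!: ideal_ofD(5)[OF I] prod_mem intro: ideal_ofD(1)[OF I])
  qed
  then show ?case using Suc unfolding esyms.simps esym_def by (auto intro!: ideal_of_sum[OF I])
qed simp

text \<open>Modulo the \<open>y j\<close> with \<open>j \<in> G\<close> the elementary symmetric polynomial of degree \<open>c = card (V - G)\<close>
  is the product of the remaining \<open>y j\<close>, and \<open>A/(J + \<Prod>y j)\<close> is filtered by the \<open>A/(J + y j)\<close>.\<close>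

lemma weakly_regular_esyms:
  assumes V: "finite V" and y: "\<And>j. j \<in> V \<Longrightarrow> y j \<in> A"
    and ideal: "\<And>J G. Q J G \<Longrightarrow> ideal_of J"
    and mem: "\<And>J G j. Q J G \<Longrightarrow> j \<in> G \<Longrightarrow> y j \<in> J"
    and nzd: "\<And>J G j. Q J G \<Longrightarrow> j \<in> V - G \<Longrightarrow> nonzerodivisor_mod J (y j)"
    and step: "\<And>J G j. Q J G \<Longrightarrow> j \<in> V - G \<Longrightarrow> Q (adjoin J (y j)) (insert j G)"
    and "Q J G" "card (V - G) = c"
  shows "weakly_regular J (esyms y V c)"
  using assms(7,8)
proof (induction c arbitrary: J G)
  case (Suc c)
  note J = ideal[OF Suc.prems(1)]
  have esA: "set (esyms y V c) \<subseteq> A" by (rule esyms_subset[OF ideal_of_whole y])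
  let ?p = "\<Prod>j\<in>V - G. y j"
  have pA: "?p \<in> A" using y by (auto intro: prod_mem)
  have eA: "esym y V (Suc c) \<in> A"
    using esyms_subset[of A V y "Suc c"] ideal_of_whole y by simp
  \<comment> \<open>A set of size \<open>Suc c = card (V - G)\<close> other than
    \<open>V - G\<close> itself meets G, so its product has a factor in J.\<close>
  have diff: "esym y V (Suc c) - ?p \<in> J"
  proof -
    have "finite {T. T \<subseteq> V \<and> card T = Suc c}" using V by simp
    moreover have "V - G \<in> {T. T \<subseteq> V \<and> card T = Suc c}" using Suc.prems by auto
    ultimately have "esym y V (Suc c) =
        ?p + (\<Sum>T\<in>{T. T \<subseteq> V \<and> card T = Suc c} - {V - G}. \<Prod>j\<in>T. y j)"
      unfolding esym_def by (subst sum.remove) auto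
    moreover have "(\<Prod>j\<in>T. y j) \<in> J" if T: "T \<subseteq> V" "card T = Suc c" "T \<noteq> V - G" for T
    proof -
      have "\<not> T \<subseteq> V - G"
        using T Suc.prems(2) V card_subset_eq[of "V - G" T] by auto
      then obtain j where "j \<in> T" "j \<in> G" using T by blast
      moreover have "finite T" using T V finite_subset by blast
      ultimately show ?thesis
        using y T mem[OF Suc.prems(1)] by (subst prod.remove[of T j]) 
          (auto intro!: ideal_ofD(5)[OF J] prod_mem)
    qed
    ultimately show ?thesis by (auto intro!: ideal_of_sum[OF J])
  qed
  \<comment> \<open>One factor \<open>y j\<close> is split off at a time: modulo \<open>y j\<close>
    the outer induction applies with j added to G, and the remaining product is covered by the inner
    induction. The empty product 1 gives the zero quotient.\<close>
  have nzdp: "nonzerodivisor_mod J (\<Prod>j\<in>H. y j) \<and> weakly_regular (adjoin J (\<Prod>j\<in>H. y j)) (esyms y V c)"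
    if "H \<subseteq> V - G" for H
  proof -
    have "finite H" using that V finite_subset by blast
    then show ?thesis using that
    proof induction
      case empty
      then show ?case using weakly_regular_whole[OF esA] adjoin_one[OF J] by (auto simp: nonzerodivisor_mod_def)
    next
      case (insert j H)
      then have j: "j \<in> V - G" by auto
      have "prod y H \<in> A" using y insert.prems by (auto intro: prod_mem)
      moreover have "card (V - insert j G) = c"
        using Suc.prems(2) j V by (metis Diff_insert card_Diff_singleton diff_Suc_1)
      then have "weakly_regular (adjoin J (y j)) (esyms y V c)"
        using Suc.IH[OF step[OF Suc.prems(1) j]] by simp
      ultimately have "weakly_regular (adjoin J (y j * prod y H)) (esyms y V c)"
        using insert y j esA nzd[OF Suc.prems(1) j] by (intro weakly_regular_adjoin_mult J) auto
      moreover have "nonzerodivisor_mod J (y j * prod y H)"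
        using nzd[OF Suc.prems(1) j] insert \<open>prod y H \<in> A\<close>
        unfolding nonzerodivisor_mod_def by (metis insert_subset mult.assoc mult_mem)
      ultimately show ?case using insert by simp
    qed
  qed
  have "nonzerodivisor_mod J (esym y V (Suc c))"
    unfolding nonzerodivisor_mod_def
  proof (intro ballI impI)
    fix a assume a: "a \<in> A" "esym y V (Suc c) * a \<in> J"
    have "esym y V (Suc c) * a - (esym y V (Suc c) - ?p) * a \<in> J"
      by (intro ideal_ofD(7)[OF J] a ideal_ofD(5)[OF J] diff)
    then have "?p * a \<in> J" by (simp add: algebra_simps)
    with nzdp[OF order.refl] a show "a \<in> J" by (auto simp: nonzerodivisor_mod_def)
  qed
  moreover have "adjoin J (esym y V (Suc c)) = adjoin J ?p"
    by (intro adjoin_cong J eA pA diff)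
  ultimately show ?case using nzdp[OF order.refl] by simp
qed simp

end

section \<open>Local rings of quotients\<close>

lemma (in cring) mem_idealI_unit:
  assumes "ideal J R" "u \<in> Units R" "x \<in> carrier R" "u \<otimes> x \<in> J"
  shows "x \<in> J"
proof -
  have "inv u \<otimes> (u \<otimes> x) \<in> J"
    using assms by (simp add: ideal.I_l_closed)
  moreover have "inv u \<otimes> (u \<otimes> x) = (inv u \<otimes> u) \<otimes> x"
    using assms(2,3) Units_closed[OF assms(2)] by (simp add: m_assoc del: Units_l_inv)
  then have "inv u \<otimes> (u \<otimes> x) = x"
    using assms by simp
  ultimately show ?thesis by simp
qed

lemma (in cring) maximalideal_unique:
  assumes N: "ideal N R" "N \<noteq> carrier R" and units: "\<And>x. x \<in> carrier R \<Longrightarrow> x \<notin> N \<Longrightarrow> x \<in> Units R"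
  shows "{N'. maximalideal N' R} = {N}"
proof -
  have sub: "J \<subseteq> N" if J: "ideal J R" "J \<noteq> carrier R" for J
  proof (rule ccontr)
    assume "\<not> J \<subseteq> N"
    then obtain x where x: "x \<in> J" "x \<notin> N" by blast
    then have "x \<in> Units R" using units ideal.Icarr[OF J(1)] by blast
    then have "\<one> \<in> J" using x ideal.Icarr[OF J(1) x(1)]
      mem_idealI_unit[OF J(1), of x \<one>] by simp
    then show False using J ideal.one_imp_carrier by blast
  qed
  have "N \<subseteq> carrier R" using ideal.Icarr[OF N(1)] by blast
  have "maximalideal N R"
  proof (rule maximalidealI[OF N(1)])
    show "J = N \<or> J = carrier R" if "ideal J R" "N \<subseteq> J" "J \<subseteq> carrier R" for J
      using sub[OF that(1)] that by blast
  qed (use N in blast)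
  moreover have "N' = N" if N': "maximalideal N' R" for N'
  proof -
    have "N' \<subseteq> N" using N' sub[of N'] maximalideal.axioms(1)[OF N'] maximalideal.I_notcarr[OF N'] by blast
    then show ?thesis using maximalideal.I_maximal[OF N' N(1)] N(2) \<open>N \<subseteq> carrier R\<close> by blast
  qed
  ultimately show ?thesis by blast
qed

text \<open>Describes h, up to isomorphism, as the canonical map from R to the fractions of R/I with
  denominators in T, so that no argument has to handle classes of pairs of cosets. With T = {1} it
  is the quotient map, with T the complement of a maximal ideal it leads to the local rings.\<close>

locale fraction_hom = ring_hom_cring R S h for R (structure) and S (structure) and h +
  fixes T :: "'a set" and I :: "'a set"
  assumes T_carrier: "T \<subseteq> carrier R" and T_one: "\<one> \<in> T"
    and T_mult: "s \<in> T \<Longrightarrow> t \<in> T \<Longrightarrow> s \<otimes> t \<in> T"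
    and T_Units: "t \<in> T \<Longrightarrow> h t \<in> Units S"
    and I_ideal: "ideal I R"
    and h_I: "r \<in> I \<Longrightarrow> h r = \<zero>\<^bsub>S\<^esub>"
    and h_zeroD: "r \<in> carrier R \<Longrightarrow> h r = \<zero>\<^bsub>S\<^esub> \<Longrightarrow> \<exists>u\<in>T. u \<otimes> r \<in> I"
    and h_frac: "x \<in> carrier S \<Longrightarrow> \<exists>r\<in>carrier R. \<exists>t\<in>T. h t \<otimes>\<^bsub>S\<^esub> x = h r"
begin

lemma T_mem [simp]: "t \<in> T \<Longrightarrow> t \<in> carrier R"
  using T_carrier by blast

lemma vimage_ideal: "ideal J S \<Longrightarrow> ideal {r \<in> carrier R. h r \<in> J} R"
  by (rule ring.ideal_vimage)

lemma mem_ideal_iff: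
  assumes "ideal J S" "x \<in> carrier S" "t \<in> T" "h t \<otimes>\<^bsub>S\<^esub> x = h r"
  shows "x \<in> J \<longleftrightarrow> h r \<in> J"
  using assms S.mem_idealI_unit[OF assms(1) T_Units[OF assms(3)] assms(2)]
    ideal.I_l_closed[OF assms(1), of x "h t"] by auto

text \<open>Each element of S is an image up to a unit, so an ideal of S is governed by its
  contraction to R. This passes finite generation on to S and keeps contracted chains of primes
  strict.\<close>

lemma ideal_eq_of_vimage_subset:
  assumes "ideal J S" "ideal K S" "{r \<in> carrier R. h r \<in> J} \<subseteq> K'" "K' \<subseteq> {r \<in> carrier R. h r \<in> K}"
  shows "J \<subseteq> K"
proof
  fix x assume x: "x \<in> J"
  then have xS: "x \<in> carrier S" using ideal.Icarr[OF assms(1)] by blast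
  obtain r t where "r \<in> carrier R" "t \<in> T" "h t \<otimes>\<^bsub>S\<^esub> x = h r" using h_frac[OF xS] by blast
  then show "x \<in> K"
    using x assms mem_ideal_iff[OF assms(1) xS] mem_ideal_iff[OF assms(2) xS] by blast
qed

lemma noetherian_image:
  assumes "noetherian_ring R"
  shows "noetherian_ring S"
proof (rule S.noetherian_ringI)
  fix J assume J: "ideal J S"
  obtain A where A: "A \<subseteq> carrier R" "finite A" "{r \<in> carrier R. h r \<in> J} = Idl A"
    using noetherian_ring.finetely_gen[OF assms vimage_ideal[OF J]] by blast
  have hA: "h ` A \<subseteq> carrier S" using A(1) by auto
  have "A \<subseteq> Idl A" by (rule R.genideal_self[OF A(1)])
  then have "h ` A \<subseteq> J" using A(3) by auto
  then have "Idl\<^bsub>S\<^esub> (h ` A) \<subseteq> J" using S.genideal_minimal[OF J] by simp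
  moreover have "J \<subseteq> Idl\<^bsub>S\<^esub> (h ` A)"
  proof (rule ideal_eq_of_vimage_subset[OF J S.genideal_ideal[OF hA]])
    show "{r \<in> carrier R. h r \<in> J} \<subseteq> Idl A" using A(3) by simp
    show "Idl A \<subseteq> {r \<in> carrier R. h r \<in> Idl\<^bsub>S\<^esub> (h ` A)}"
      using A(1) S.genideal_self[OF hA]
      by (intro R.genideal_minimal vimage_ideal S.genideal_ideal hA) auto
  qed
  ultimately show "\<exists>B\<subseteq>carrier S. finite B \<and> J = Idl\<^bsub>S\<^esub> B" using A(2) hA by blast
qed

lemma vimage_prime:
  assumes P: "primeideal P S"
  shows "primeideal {r \<in> carrier R. h r \<in> P} R" "I \<subseteq> {r \<in> carrier R. h r \<in> P}"
proof -
  note PI = primeideal.axioms(1)[OF P]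
  show "primeideal {r \<in> carrier R. h r \<in> P} R"
  proof (rule primeidealI[OF vimage_ideal[OF PI] R.is_cring])
    have "\<one>\<^bsub>S\<^esub> \<notin> P" using ideal.one_imp_carrier[OF PI] primeideal.I_notcarr[OF P] by blast
    then have "\<one> \<notin> {r \<in> carrier R. h r \<in> P}" by simp
    then show "carrier R \<noteq> {r \<in> carrier R. h r \<in> P}" using R.one_closed by metis
  qed (use primeideal.I_prime[OF P] in auto)
  show "I \<subseteq> {r \<in> carrier R. h r \<in> P}"
    using h_I ideal.Icarr[OF I_ideal] additive_subgroup.zero_closed[OF ideal.axioms(1)[OF PI]] by auto
qed

lemma vimage_strict_mono:
  assumes "ideal P S" "ideal P' S" "P \<subset> P'"
  shows "{r \<in> carrier R. h r \<in> P} \<subset> {r \<in> carrier R. h r \<in> P'}"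
  using assms ideal_eq_of_vimage_subset[OF assms(2,1)] by blast

lemma krull_dim_le:
  assumes "\<And>P e. (\<forall>i\<le>e. primeideal (P i) R) \<Longrightarrow> (\<forall>i<e. P i \<subset> P (Suc i)) \<Longrightarrow> I \<subseteq> P 0 \<Longrightarrow> e \<le> d"
  shows "krull_dim S \<le> enat d"
  unfolding krull_dim_def
proof (rule Sup_least, clarify)
  fix n and P :: "nat \<Rightarrow> _"
  assume P: "\<forall>i\<le>n. primeideal (P i) S" and ch: "\<forall>i<n. P i \<subset> P (Suc i)"
  have "n \<le> d"
  proof (rule assms)
    show "\<forall>i\<le>n. primeideal {r \<in> carrier R. h r \<in> P i} R" using P vimage_prime(1) by blast
    show "I \<subseteq> {r \<in> carrier R. h r \<in> P 0}" using P vimage_prime(2) by blast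
    show "\<forall>i<n. {r \<in> carrier R. h r \<in> P i} \<subset> {r \<in> carrier R. h r \<in> P (Suc i)}"
    proof (intro allI impI vimage_strict_mono)
      fix i assume "i < n"
      then show "ideal (P i) S" "ideal (P (Suc i)) S" "P i \<subset> P (Suc i)"
        using P ch by (auto intro: primeideal.axioms(1))
    qed
  qed
  then show "enat n \<le> enat d" by simp
qed

text \<open>The ideal of S generated by the image of K, when K is an ideal; the form as a set of
  fractions hands out a numerator in K for each member.\<close>

definition extension :: "'a set \<Rightarrow> 'c set" where
  "extension K = {x \<in> carrier S. \<exists>r\<in>K. \<exists>t\<in>T. h t \<otimes>\<^bsub>S\<^esub> x = h r}"

lemma ideal_extension:
  assumes K: "ideal K R"
  shows "ideal (extension K) S"
proof (rule idealI)
  have K_sub: "\<And>r. r \<in> K \<Longrightarrow> r \<in> carrier R" using ideal.Icarr[OF K] .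
  have K0: "\<zero> \<in> K" by (rule additive_subgroup.zero_closed[OF ideal.axioms(1)[OF K]])
  have closed: "a \<otimes>\<^bsub>S\<^esub> x \<in> extension K" if x: "x \<in> extension K" and a: "a \<in> carrier S" for a x
  proof -
    obtain r t where x: "x \<in> carrier S" "r \<in> K" "t \<in> T" "h t \<otimes>\<^bsub>S\<^esub> x = h r"
      using x by (auto simp: extension_def)
    obtain q u where a': "q \<in> carrier R" "u \<in> T" "h u \<otimes>\<^bsub>S\<^esub> a = h q" using h_frac[OF a] by blast
    have "h (u \<otimes> t) \<otimes>\<^bsub>S\<^esub> (a \<otimes>\<^bsub>S\<^esub> x) = (h u \<otimes>\<^bsub>S\<^esub> a) \<otimes>\<^bsub>S\<^esub> (h t \<otimes>\<^bsub>S\<^esub> x)"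
      using x(1,3) a a'(2) by (simp add: S.m_ac)
    also have "\<dots> = h (q \<otimes> r)" unfolding x(4) a'(3) using x a' K_sub by simp
    finally show ?thesis
      using x a a' T_mult ideal.I_l_closed[OF K x(2) a'(1)] unfolding extension_def by blast
  qed
  then show "a \<otimes>\<^bsub>S\<^esub> x \<in> extension K" "x \<otimes>\<^bsub>S\<^esub> a \<in> extension K"
    if "x \<in> extension K" "a \<in> carrier S" for a x
    using that S.m_comm[of x a] by (auto simp: extension_def)
  have add: "x \<oplus>\<^bsub>S\<^esub> x' \<in> extension K" if xx: "x \<in> extension K" "x' \<in> extension K" for x x'
  proof -
    obtain r t where x: "x \<in> carrier S" "r \<in> K" "t \<in> T" "h t \<otimes>\<^bsub>S\<^esub> x = h r"
      using xx by (auto simp: extension_def)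
    obtain r' t' where x': "x' \<in> carrier S" "r' \<in> K" "t' \<in> T" "h t' \<otimes>\<^bsub>S\<^esub> x' = h r'"
      using xx by (auto simp: extension_def)
    have "h (t \<otimes> t') \<otimes>\<^bsub>S\<^esub> (x \<oplus>\<^bsub>S\<^esub> x')
        = h t' \<otimes>\<^bsub>S\<^esub> (h t \<otimes>\<^bsub>S\<^esub> x) \<oplus>\<^bsub>S\<^esub> h t \<otimes>\<^bsub>S\<^esub> (h t' \<otimes>\<^bsub>S\<^esub> x')"
      using x(1,3) x'(1,3) by (simp add: S.m_ac S.r_distr)
    also have "\<dots> = h (t' \<otimes> r \<oplus> t \<otimes> r')" unfolding x(4) x'(4) using x x' K_sub by simp
    finally have eq: "h (t \<otimes> t') \<otimes>\<^bsub>S\<^esub> (x \<oplus>\<^bsub>S\<^esub> x') = h (t' \<otimes> r \<oplus> t \<otimes> r')" .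
    have "t' \<otimes> r \<oplus> t \<otimes> r' \<in> K"
      using x x' by (intro additive_subgroup.a_closed[OF ideal.axioms(1)[OF K]] ideal.I_l_closed[OF K]) auto
    then show ?thesis using x x' T_mult eq S.a_closed unfolding extension_def by blast
  qed
  show "subgroup (extension K) (add_monoid S)"
  proof (rule group.subgroupI)
    show "group (add_monoid S)" by (rule S.add.is_group)
    show "extension K \<subseteq> carrier (add_monoid S)" by (auto simp: extension_def)
    have "\<zero>\<^bsub>S\<^esub> \<in> extension K"
      unfolding extension_def using K0 T_one
      by (auto intro!: bexI[of _ \<zero>] bexI[of _ \<one>, OF _ T_one])
    then show "extension K \<noteq> {}" by blast
    show "inv\<^bsub>add_monoid S\<^esub> x \<in> extension K" if "x \<in> extension K" for x
    proof -
      have "x \<in> carrier S" using that by (simp add: extension_def)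
      then have "\<ominus>\<^bsub>S\<^esub> x = (\<ominus>\<^bsub>S\<^esub> \<one>\<^bsub>S\<^esub>) \<otimes>\<^bsub>S\<^esub> x" using S.l_minus by simp
      then have "\<ominus>\<^bsub>S\<^esub> x \<in> extension K" using closed[OF that, of "\<ominus>\<^bsub>S\<^esub> \<one>\<^bsub>S\<^esub>"] by simp
      then show ?thesis by (simp add: a_inv_def)
    qed
    show "x \<otimes>\<^bsub>add_monoid S\<^esub> y \<in> extension K" if "x \<in> extension K" "y \<in> extension K" for x y
      using add[OF that] by simp
  qed
qed (rule S.ring_axioms)

lemma h_mem_extension: "ideal K R \<Longrightarrow> r \<in> K \<Longrightarrow> h r \<in> extension K"
  using ideal.Icarr[of K R r] T_one
  unfolding extension_def by (auto intro!: bexI[of _ r] bexI[of _ \<one>, OF _ T_one])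

text \<open>Contracting an extended ideal gives back K up to multiplication by T; that K contains I
  absorbs the kernel of h.\<close>

lemma h_mem_extensionD:
  assumes K: "ideal K R" "I \<subseteq> K" and r: "r \<in> carrier R" "h r \<in> extension K"
  shows "\<exists>u\<in>T. u \<otimes> r \<in> K"
proof -
  obtain q t where q: "q \<in> K" "t \<in> T" "h t \<otimes>\<^bsub>S\<^esub> h r = h q"
    using r by (auto simp: extension_def)
  have qR: "q \<in> carrier R" using ideal.Icarr[OF K(1) q(1)] .
  have "h (t \<otimes> r \<ominus> q) = \<zero>\<^bsub>S\<^esub>"
    using q qR r by (simp add: R.minus_eq S.r_neg)
  then obtain u where u: "u \<in> T" "u \<otimes> (t \<otimes> r \<ominus> q) \<in> I"
    using h_zeroD[of "t \<otimes> r \<ominus> q"] q qR r by auto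
  have "u \<otimes> (t \<otimes> r \<ominus> q) \<oplus> u \<otimes> q \<in> K"
    using u K(2) q additive_subgroup.a_closed[OF ideal.axioms(1)[OF K(1)]] ideal.I_l_closed[OF K(1) q(1)] by auto
  moreover have "u \<otimes> (t \<otimes> r \<ominus> q) \<oplus> u \<otimes> q = (u \<otimes> t) \<otimes> r"
  proof -
    have "u \<in> carrier R" "t \<in> carrier R" using u q by auto
    then show ?thesis using qR r(1) by algebra
  qed
  ultimately show ?thesis using T_mult[OF u(1) q(2)] by metis
qed

lemma Idl_image:
  assumes F: "F \<subseteq> carrier R"
  shows "Idl\<^bsub>S\<^esub> (h ` F) = extension (Idl (I \<union> F))"
proof
  have IF: "I \<union> F \<subseteq> carrier R" using F ideal.Icarr[OF I_ideal] by blast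
  note K = R.genideal_ideal[OF IF]
  have hF: "h ` F \<subseteq> carrier S" using F by auto
  show "Idl\<^bsub>S\<^esub> (h ` F) \<subseteq> extension (Idl (I \<union> F))"
    using R.genideal_self[OF IF] h_mem_extension[OF K]
    by (intro S.genideal_minimal ideal_extension K) auto
  note J = S.genideal_ideal[OF hF]
  have "Idl (I \<union> F) \<subseteq> {r \<in> carrier R. h r \<in> Idl\<^bsub>S\<^esub> (h ` F)}"
    using IF S.genideal_self[OF hF] h_I additive_subgroup.zero_closed[OF ideal.axioms(1)[OF J]]
    by (intro R.genideal_minimal vimage_ideal J) auto
  then show "extension (Idl (I \<union> F)) \<subseteq> Idl\<^bsub>S\<^esub> (h ` F)"
    using mem_ideal_iff[OF J] by (auto simp: extension_def)
qed

end

text \<open>Abstracts the canonical map from \<open>R\<close> to the local ring of \<open>R/I\<close> at a maximal ideal.\<close>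

locale local_fraction_hom = fraction_hom R S h "carrier R - M" I
  for R (structure) and S (structure) and h and M I +
  assumes M: "maximalideal M R" and I_M: "I \<subseteq> M"
begin

lemma M_ideal: "ideal M R" by (rule maximalideal.axioms(1)[OF M])

lemma extension_M_neq: "extension M \<noteq> carrier S"
proof
  assume "extension M = carrier S"
  then have "h \<one> \<in> extension M" by simp
  then obtain u where "u \<in> carrier R - M" "u \<otimes> \<one> \<in> M"
    using h_mem_extensionD[OF M_ideal I_M R.one_closed] by metis
  then show False by simp
qed

lemma maximalideals: "{N. maximalideal N S} = {extension M}"
proof (rule S.maximalideal_unique[OF ideal_extension[OF M_ideal] extension_M_neq])
  fix x assume x: "x \<in> carrier S" "x \<notin> extension M"
  obtain r t where r: "r \<in> carrier R" "t \<in> carrier R - M" "h t \<otimes>\<^bsub>S\<^esub> x = h r"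
    using h_frac[OF x(1)] by blast
  then have "r \<notin> M" using x by (auto simp: extension_def)
  then have "h t \<otimes>\<^bsub>S\<^esub> x \<in> Units S" using r T_Units[of r] by simp
  then show "x \<in> Units S" 
    using x(1) r(2) S.prod_unit_r[OF _ T_Units[OF r(2)] x(1)] S.m_comm[of x "h t"] by simp
qed

text \<open>Clearing denominators turns regularity in S modulo earlier images into regularity in R
  modulo I and the earlier members. The ideal of the images stays proper because it lies in the
  extension of M.\<close>

lemma regular_sequence_image:
  assumes fs: "set fs \<subseteq> M"
    and reg: "\<And>i a. i < length fs \<Longrightarrow> a \<in> carrier R \<Longrightarrow> fs ! i \<otimes> a \<in> Idl (I \<union> set (take i fs))
      \<Longrightarrow> a \<in> Idl (I \<union> set (take i fs))"
  shows "regular_sequence S (map h fs)"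
  unfolding regular_sequence_def
proof (intro conjI allI impI ballI)
  have fsR: "set fs \<subseteq> carrier R" using fs ideal.Icarr[OF M_ideal] by blast
  then show "set (map h fs) \<subseteq> carrier S" by auto
  have "Idl (I \<union> set fs) \<subseteq> M" using fs I_M by (intro R.genideal_minimal M_ideal) auto
  then have "Idl\<^bsub>S\<^esub> (h ` set fs) \<subseteq> extension M"
    unfolding Idl_image[OF fsR] by (auto simp: extension_def)
  moreover have "extension M \<subset> carrier S" using extension_M_neq by (auto simp: extension_def)
  ultimately show "Idl\<^bsub>S\<^esub> (set (map h fs)) \<noteq> carrier S" by auto
  fix i x assume i: "i < length (map h fs)" and x: "x \<in> carrier S"
    and mem: "map h fs ! i \<otimes>\<^bsub>S\<^esub> x \<in> Idl\<^bsub>S\<^esub> (set (take i (map h fs)))"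
  let ?F = "set (take i fs)" and ?f = "fs ! i"
  have F: "?F \<subseteq> carrier R" using fsR set_take_subset[of i fs] by blast
  have f: "?f \<in> carrier R" using i fsR by auto
  have IF: "I \<union> ?F \<subseteq> carrier R" using F ideal.Icarr[OF I_ideal] by blast
  note K = R.genideal_ideal[OF IF]
  have IK: "I \<subseteq> Idl (I \<union> ?F)" using R.genideal_self[OF IF] by blast
  have Idl: "Idl\<^bsub>S\<^esub> (set (take i (map h fs))) = extension (Idl (I \<union> ?F))"
    using Idl_image[OF F] by (simp add: take_map)
  note E = ideal_extension[OF K]
  obtain r t where r: "r \<in> carrier R" "t \<in> carrier R - M" "h t \<otimes>\<^bsub>S\<^esub> x = h r"
    using h_frac[OF x] by blast
  have "h t \<otimes>\<^bsub>S\<^esub> (h ?f \<otimes>\<^bsub>S\<^esub> x) \<in> extension (Idl (I \<union> ?F))"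
    using mem i r unfolding Idl by (simp add: ideal.I_l_closed[OF E])
  moreover have "h t \<otimes>\<^bsub>S\<^esub> (h ?f \<otimes>\<^bsub>S\<^esub> x) = h ?f \<otimes>\<^bsub>S\<^esub> (h t \<otimes>\<^bsub>S\<^esub> x)"
    using r(1,2) f x by (simp add: S.m_lcomm)
  moreover have "\<dots> = h (?f \<otimes> r)"
    unfolding r(3) using r f by simp
  ultimately have "h (?f \<otimes> r) \<in> extension (Idl (I \<union> ?F))" by simp
  then obtain u where u: "u \<in> carrier R - M" "u \<otimes> (?f \<otimes> r) \<in> Idl (I \<union> ?F)"
    using h_mem_extensionD[OF K IK R.m_closed[OF f r(1)]] by blast
  have uR: "u \<in> carrier R" using u(1) by blast
  have "?f \<otimes> (u \<otimes> r) \<in> Idl (I \<union> ?F)"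
    using u(2) unfolding R.m_lcomm[OF uR f r(1)] .
  then have "u \<otimes> r \<in> Idl (I \<union> ?F)" using reg[of i "u \<otimes> r"] i uR r(1) by simp
  then have "h (u \<otimes> r) \<in> extension (Idl (I \<union> ?F))" by (rule h_mem_extension[OF K])
  then have "h u \<otimes>\<^bsub>S\<^esub> h r \<in> extension (Idl (I \<union> ?F))"
    unfolding hom_mult[OF uR r(1)] .
  then have "h r \<in> extension (Idl (I \<union> ?F))"
    using r(1) S.mem_idealI_unit[OF E T_Units[OF u(1)], of "h r"] by blast
  then show "x \<in> Idl\<^bsub>S\<^esub> (set (take i (map h fs)))"
    unfolding Idl using mem_ideal_iff[OF E x r(2,3)] by simp
qed

end

section \<open>Primes avoiding a multiplicative set, and depth bounded by dimension\<close>

lemma (in cring) exists_primeideal_disjoint: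
  assumes J: "ideal J R" and T: "\<one> \<in> T" "T \<subseteq> carrier R" "\<And>s t. s \<in> T \<Longrightarrow> t \<in> T \<Longrightarrow> s \<otimes> t \<in> T"
    and disj: "J \<inter> T = {}"
  shows "\<exists>P. primeideal P R \<and> J \<subseteq> P \<and> P \<inter> T = {}"
proof -
  define \<A> where "\<A> = {K. ideal K R \<and> J \<subseteq> K \<and> K \<inter> T = {}}"
  have "\<exists>P\<in>\<A>. \<forall>K\<in>\<A>. P \<subseteq> K \<longrightarrow> K = P"
  proof (rule subset_Zorn_nonempty)
    show "\<A> \<noteq> {}" using J disj by (auto simp: \<A>_def)
    show "\<Union>\<C> \<in> \<A>" if C: "\<C> \<noteq> {}" "subset.chain \<A> \<C>" for \<C>
    proof -
      have "\<And>K. K \<in> \<C> \<Longrightarrow> K \<in> \<A>" using C by (auto simp: subset.chain_def)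
      then have K: "\<And>K. K \<in> \<C> \<Longrightarrow> ideal K R" "\<And>K. K \<in> \<C> \<Longrightarrow> J \<subseteq> K" "\<And>K. K \<in> \<C> \<Longrightarrow> K \<inter> T = {}"
        by (auto simp: \<A>_def)
      have "subset.chain {K. ideal K R} \<C>" using C K(1) by (auto simp: subset.chain_def)
      then have "ideal (\<Union>\<C>) R" using chain_Union_is_ideal[of \<C>] C(1) by simp
      moreover have "J \<subseteq> \<Union>\<C>" using C(1) K(2) by blast
      ultimately show ?thesis using K(3) by (auto simp: \<A>_def)
    qed
  qed
  then obtain P where P: "ideal P R" "J \<subseteq> P" "P \<inter> T = {}"
    and max: "\<And>K. ideal K R \<Longrightarrow> P \<subset> K \<Longrightarrow> K \<inter> T \<noteq> {}"
    unfolding \<A>_def by (smt (verit) mem_Collect_eq order.trans psubset_eq)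
  have Pc: "P \<subseteq> carrier R" using ideal.Icarr[OF P(1)] by blast
  have "primeideal P R"
  proof (rule primeidealI[OF P(1) is_cring])
    show "carrier R \<noteq> P" using T(1) P(3) one_closed by blast
    fix a b assume ab: "a \<in> carrier R" "b \<in> carrier R" "a \<otimes> b \<in> P"
    show "a \<in> P \<or> b \<in> P"
    proof (rule ccontr)
      assume notP: "\<not> (a \<in> P \<or> b \<in> P)"
      \<comment> \<open>By maximality P + (c) meets T. For a and b outside P with ab in P, the
        product of the two elements of T found this way lies in P as well as in T.\<close>
      have *: "\<exists>p\<in>P. \<exists>x\<in>carrier R. p \<oplus> x \<otimes> c \<in> T" if c: "c \<in> carrier R" "c \<notin> P" for c
      proof -
        have "ideal (P <+>\<^bsub>R\<^esub> PIdl c) R" by (intro add_ideals P cgenideal_ideal c)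
        moreover have "P \<subset> P <+>\<^bsub>R\<^esub> PIdl c"
        proof -
          have "p \<in> P <+>\<^bsub>R\<^esub> PIdl c" if "p \<in> P" for p
          proof -
            have "\<zero> \<in> PIdl c" using additive_subgroup.zero_closed[OF ideal.axioms(1)[OF cgenideal_ideal[OF c(1)]]] .
            then have "p \<oplus> \<zero> \<in> P <+>\<^bsub>R\<^esub> PIdl c" using that unfolding set_add_def' by blast
            then show ?thesis using that Pc by (simp add: subsetD)
          qed
          moreover have "c \<in> P <+>\<^bsub>R\<^esub> PIdl c"
          proof -
            have "\<zero> \<in> P" using additive_subgroup.zero_closed[OF ideal.axioms(1)[OF P(1)]] .
            then have "\<zero> \<oplus> c \<in> P <+>\<^bsub>R\<^esub> PIdl c" using cgenideal_self[OF c(1)] unfolding set_add_def' by blast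
            then show ?thesis using c by simp
          qed
          ultimately show ?thesis using c by blast
        qed
        ultimately obtain z where "z \<in> T" "z \<in> P <+>\<^bsub>R\<^esub> PIdl c" using max by blast
        then show ?thesis unfolding set_add_def' cgenideal_def by blast
      qed
      obtain p x where p: "p \<in> P" "x \<in> carrier R" "p \<oplus> x \<otimes> a \<in> T"
        using *[of a] ab notP by blast
      obtain q y where q: "q \<in> P" "y \<in> carrier R" "q \<oplus> y \<otimes> b \<in> T"
        using *[of b] ab notP by blast
      have pq: "p \<in> carrier R" "q \<in> carrier R" using p q Pc by auto
      have "(p \<oplus> x \<otimes> a) \<otimes> (q \<oplus> y \<otimes> b) = (q \<oplus> y \<otimes> b) \<otimes> p \<oplus> ((x \<otimes> a) \<otimes> q \<oplus> (x \<otimes> y) \<otimes> (a \<otimes> b))"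
        using pq p(2) q(2) ab(1,2) by algebra
      also have "\<dots> \<in> P"
        using p(1,2) q(1,2) pq ab
        by (simp add: additive_subgroup.a_closed[OF ideal.axioms(1)[OF P(1)]] ideal.I_l_closed[OF P(1)])
      finally show False using T(3)[OF p(3) q(3)] P(3) by blast
    qed
  qed
  with P show ?thesis by blast
qed

text \<open>A prime \<open>P\<close> over \<open>x\<^sub>1, \<dots>, x\<^sub>i\<^sub>+\<^sub>1\<close> contains a strictly smaller prime over \<open>x\<^sub>1, \<dots>, x\<^sub>i\<close>: since
  \<open>x\<^sub>i\<^sub>+\<^sub>1\<close> is a nonzerodivisor modulo \<open>x\<^sub>1, \<dots>, x\<^sub>i\<close>, no \<open>s x\<^sub>i\<^sub>+\<^sub>1\<^sup>k\<close> with \<open>s \<notin> P\<close> lies in \<open>(x\<^sub>1, \<dots>, x\<^sub>i)\<close>.\<close>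

lemma (in cring) regular_sequence_le_krull_dim:
  assumes xs: "regular_sequence R xs"
  shows "enat (length xs) \<le> krull_dim R"
proof -
  let ?n = "length xs"
  have xsR: "set xs \<subseteq> carrier R" using xs by (simp add: regular_sequence_def)
  have takeR: "set (take i xs) \<subseteq> carrier R" for i using xsR set_take_subset[of i xs] by blast
  \<comment> \<open>The chain grows downwards: \<open>P 0\<close> is its smallest member, and a
    prime found below it is put in front by \<open>case_nat\<close>.\<close>
  have chain: "\<exists>P. (\<forall>i\<le>k. primeideal (P i) R) \<and> (\<forall>i<k. P i \<subset> P (Suc i)) \<and> set (take (?n - k) xs) \<subseteq> P 0"
    if "k \<le> ?n" for k
    using that
  proof (induction k)
    case 0
    let ?J = "Idl (set xs)"
    have J: "ideal ?J R" by (rule genideal_ideal[OF xsR])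
    have "\<one> \<notin> ?J" using ideal.one_imp_carrier[OF J] xs by (auto simp: regular_sequence_def)
    then obtain P where "primeideal P R" "?J \<subseteq> P"
      using exists_primeideal_disjoint[OF J, of "{\<one>}"] by auto
    then show ?case using genideal_self[OF xsR] by (intro exI[of _ "\<lambda>_. P"]) auto
  next
    case (Suc k)
    then obtain P where P: "\<forall>i\<le>k. primeideal (P i) R" "\<forall>i<k. P i \<subset> P (Suc i)"
      "set (take (?n - k) xs) \<subseteq> P 0" by auto
    let ?i = "?n - Suc k"
    let ?x = "xs ! ?i" and ?J = "Idl (set (take ?i xs))"
    have i: "?i < ?n" "Suc ?i = ?n - k" using Suc.prems by auto
    have J: "ideal ?J R" by (rule genideal_ideal[OF takeR])
    have take_Suc: "set (take (?n - k) xs) = insert ?x (set (take ?i xs))"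
      using i by (metis set_simps(2) rotate1.simps(2) set_rotate1 take_Suc_conv_app_nth)
    have x: "?x \<in> carrier R" using xsR i by auto
    have nzd: "a \<in> ?J" if "a \<in> carrier R" "?x \<otimes> a \<in> ?J" for a
      using xs that i unfolding regular_sequence_def by blast
    have P0: "primeideal (P 0) R" using P by simp
    note P0I = primeideal.axioms(1)[OF P0]
    have JP: "?J \<subseteq> P 0" using P(3) take_Suc by (intro genideal_minimal P0I) auto
    have nzd_pow: "s \<in> ?J" if "s \<in> carrier R" "s \<otimes> (?x [^] (m::nat)) \<in> ?J" for s m
      using that
    proof (induction m)
      case (Suc m)
      have "s \<otimes> ?x [^] Suc m = ?x \<otimes> (s \<otimes> ?x [^] m)" using Suc.prems x by (simp add: m_ac)
      then show ?case using Suc nzd[of "s \<otimes> ?x [^] m"] x by simp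
    qed simp
    have oneP: "\<one> \<notin> P 0" using ideal.one_imp_carrier[OF P0I] primeideal.I_notcarr[OF P0] by blast
    \<comment> \<open>A prime avoiding this set lies inside \<open>P 0\<close> (take m = 0) and
      misses \<open>?x\<close> (take s = 1 and m = 1), so it is strictly smaller than
      \<open>P 0\<close>.\<close>
    have "\<exists>Q. primeideal Q R \<and> ?J \<subseteq> Q \<and> Q \<inter> {s \<otimes> (?x [^] m) | s (m::nat). s \<in> carrier R - P 0} = {}"
    proof (rule exists_primeideal_disjoint[OF J])
      show "\<one> \<in> {s \<otimes> (?x [^] m) | s (m::nat). s \<in> carrier R - P 0}"
        using oneP by (auto intro!: exI[of _ \<one>] exI[of _ "0::nat"])
      show "{s \<otimes> (?x [^] m) | s (m::nat). s \<in> carrier R - P 0} \<subseteq> carrier R" using x by auto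
      show "?J \<inter> {s \<otimes> (?x [^] m) | s (m::nat). s \<in> carrier R - P 0} = {}"
        using nzd_pow JP by blast
      fix a b assume "a \<in> {s \<otimes> (?x [^] m) | s (m::nat). s \<in> carrier R - P 0}"
        "b \<in> {s \<otimes> (?x [^] m) | s (m::nat). s \<in> carrier R - P 0}"
      then obtain s m s' and m' :: nat where *: "a = s \<otimes> (?x [^] (m::nat))" "s \<in> carrier R - P 0"
        "b = s' \<otimes> (?x [^] m')" "s' \<in> carrier R - P 0" by blast
      have "a \<otimes> b = (s \<otimes> s') \<otimes> (?x [^] m \<otimes> ?x [^] m')"
        using * x by (simp add: m_ac)
      also have "\<dots> = (s \<otimes> s') \<otimes> ?x [^] (m + m')" using x by (simp add: nat_pow_mult)
      finally show "a \<otimes> b \<in> {s \<otimes> (?x [^] m) | s (m::nat). s \<in> carrier R - P 0}"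
        using * primeideal.I_prime[OF P0, of s s'] by blast
    qed
    then obtain Q where Q: "primeideal Q R" "?J \<subseteq> Q"
      and disj: "\<And>s m. s \<in> carrier R - P 0 \<Longrightarrow> s \<otimes> (?x [^] (m::nat)) \<notin> Q" by blast
    have "Q \<subseteq> P 0"
    proof
      fix s assume "s \<in> Q"
      moreover from this have "s \<in> carrier R" using ideal.Icarr[OF primeideal.axioms(1)[OF Q(1)]] by blast
      ultimately show "s \<in> P 0" using disj[of s 0] by auto
    qed
    moreover have "?x \<notin> Q" using disj[of \<one> 1] oneP x by auto
    moreover have "?x \<in> P 0" using P(3) take_Suc by auto
    ultimately have QP: "Q \<subset> P 0" by blast
    have "set (take ?i xs) \<subseteq> Q" using Q(2) genideal_self[OF takeR, of ?i] by blast
    moreover have "primeideal (case_nat Q P j) R" if "j \<le> Suc k" for j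
      using that P(1) Q(1) by (cases j) auto
    moreover have "case_nat Q P j \<subset> case_nat Q P (Suc j)" if "j < Suc k" for j
      using that P(2) QP by (cases j) auto
    ultimately show ?case by (intro exI[of _ "case_nat Q P"]) auto
  qed
  show ?thesis unfolding krull_dim_def
    by (rule Sup_upper) (use chain[OF order.refl] in blast)
qed

section \<open>Localizations of a quotient ring and the Cohen-Macaulay criterion\<close>

lemma carrier_Quot: "carrier (R Quot I) = (+>\<^bsub>R\<^esub>) I ` carrier R"
  unfolding FactRing_def A_RCOSETS_def' by auto

lemma zero_Quot: "\<zero>\<^bsub>R Quot I\<^esub> = I"
  by (simp add: FactRing_def)

lemma (in cring) maximalideal_vimage_Quot:
  assumes I: "ideal I R" and M': "maximalideal M' (R Quot I)"
  shows "maximalideal {r \<in> carrier R. I +> r \<in> M'} R" "I \<subseteq> {r \<in> carrier R. I +> r \<in> M'}"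
proof -
  let ?M = "{r \<in> carrier R. I +> r \<in> M'}"
  note M'I = maximalideal.axioms(1)[OF M']
  interpret pi: ring_hom_cring R "R Quot I" "(+>) I" by (rule ideal.rcos_ring_hom_cring[OF I is_cring])
  have surj: "\<exists>r\<in>carrier R. x = I +> r" if "x \<in> carrier (R Quot I)" for x
    using that unfolding carrier_Quot by blast
  have zero: "I +> i = \<zero>\<^bsub>R Quot I\<^esub>" if "i \<in> I" for i
    using a_rcos_zero[OF I that] zero_Quot by metis
  show IM: "I \<subseteq> ?M"
    using zero ideal.Icarr[OF I] additive_subgroup.zero_closed[OF ideal.axioms(1)[OF M'I]] by auto
  have "\<one>\<^bsub>R Quot I\<^esub> \<notin> M'"
    using ideal.one_imp_carrier[OF M'I] maximalideal.I_notcarr[OF M'] by blast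
  then have one: "\<one> \<notin> ?M" using pi.hom_one by simp
  show "maximalideal ?M R"
  proof (rule maximalidealI)
    show "ideal ?M R" by (rule pi.ring.ideal_vimage[OF M'I])
    show "carrier R \<noteq> ?M" using one one_closed by metis
    fix J assume J: "ideal J R" "?M \<subseteq> J" "J \<subseteq> carrier R"
    have imJ: "ideal ((+>) I ` J) (R Quot I)" by (rule ring_ideal_imp_quot_ideal[OF I J(1)])
    have "M' \<subseteq> (+>) I ` J"
    proof
      fix x assume x: "x \<in> M'"
      then obtain r where "r \<in> carrier R" "x = I +> r" using surj ideal.Icarr[OF M'I] by blast
      with x J(2) show "x \<in> (+>) I ` J" by blast
    qed
    then consider "(+>) I ` J = M'" | "(+>) I ` J = carrier (R Quot I)"
      using maximalideal.I_maximal[OF M' imJ] ideal.Icarr[OF imJ] by blast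
    then show "J = ?M \<or> J = carrier R"
    proof cases
      case 1
      then show ?thesis using J by blast
    next
      case 2
      then obtain j where j: "j \<in> J" "I +> \<one> = I +> j" using pi.hom_closed[OF one_closed] by blast
      then have "\<one> \<ominus> j \<in> I" using quotient_eq_iff_same_a_r_cos[OF I one_closed, of j] J(3) by blast
      then have "\<one> \<ominus> j \<in> J" using IM J(2) by blast
      then have "(\<one> \<ominus> j) \<oplus> j \<in> J" using j additive_subgroup.a_closed[OF ideal.axioms(1)[OF J(1)]] by blast
      moreover have "(\<one> \<ominus> j) \<oplus> j = \<one>" using j(1) J(3) by (simp add: subsetD minus_eq a_assoc l_neg)
      ultimately show ?thesis using ideal.one_imp_carrier[OF J(1)] by simp
    qed
  qed
qed

text \<open>The only place where the fractions of cosets are opened up: h sends r to the fraction of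
  its coset by 1, and M is the preimage of \<open>M'\<close> in R.\<close>

lemma (in cring) local_fraction_hom_localization:
  assumes I: "ideal I R" and M': "maximalideal M' (R Quot I)"
  shows "\<exists>h M. local_fraction_hom R (localization (R Quot I) (carrier (R Quot I) - M')) h M I"
proof -
  let ?Q = "R Quot I" and ?M = "{r \<in> carrier R. I +> r \<in> M'}"
  let ?S = "carrier ?Q - M'"
  let ?L = "localization ?Q ?S"
  interpret Q: cring ?Q by (rule ideal.quotient_is_cring[OF I is_cring])
  interpret pi: ring_hom_cring R ?Q "(+>) I" by (rule ideal.rcos_ring_hom_cring[OF I is_cring])
  interpret L: multiplicative_subset ?Q ?S
    by (rule primeideal.multiplicative_subset_complement[OF Q.maximalideal_prime[OF M']])
  interpret LC: cring ?L by (rule L.cring_localization)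
  have surj: "\<exists>r\<in>carrier R. x = I +> r" if "x \<in> carrier ?Q" for x
    using that unfolding carrier_Quot by blast
  have zeroQ: "\<zero>\<^bsub>?Q\<^esub> = I" by (rule zero_Quot)
  define h where "h = (\<lambda>r. L.fraction (I +> r) \<one>\<^bsub>?Q\<^esub>)"
  have frac_in: "L.fraction a s \<in> carrier ?L" if "a \<in> carrier ?Q" "s \<in> ?S" for a s
    using that unfolding L.carrier_localization by blast
  have S1: "\<one>\<^bsub>?Q\<^esub> \<in> ?S" by (rule L.S_one)
  have hom: "h \<in> ring_hom R ?L"
  proof (rule ring_hom_memI)
    show "h r \<in> carrier ?L" if "r \<in> carrier R" for r
      using that S1 unfolding h_def by (intro frac_in) auto
    show "h (r \<otimes> s) = h r \<otimes>\<^bsub>?L\<^esub> h s" if "r \<in> carrier R" "s \<in> carrier R" for r s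
      unfolding h_def using that S1 by (subst L.mult_localization) auto
    show "h (r \<oplus> s) = h r \<oplus>\<^bsub>?L\<^esub> h s" if "r \<in> carrier R" "s \<in> carrier R" for r s
      unfolding h_def using that S1 by (subst L.add_localization) auto
    show "h \<one> = \<one>\<^bsub>?L\<^esub>" unfolding h_def L.one_localization by simp
  qed
  have lift: "I +> t \<in> ?S" if "t \<in> carrier R - ?M" for t using that by auto
  have "local_fraction_hom R ?L h ?M I"
  proof (intro local_fraction_hom.intro fraction_hom.intro ring_hom_cring.intro
      ring_hom_cring_axioms.intro fraction_hom_axioms.intro local_fraction_hom_axioms.intro)
    note max = maximalideal_vimage_Quot[OF I M']
    note prime = maximalideal_prime[OF max(1)]
    show "maximalideal ?M R" "I \<subseteq> ?M" by (fact max)+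
    show "\<one> \<in> carrier R - ?M"
      using S1 by auto
    show "s \<otimes> t \<in> carrier R - ?M" if "s \<in> carrier R - ?M" "t \<in> carrier R - ?M" for s t
      using that primeideal.I_prime[OF prime, of s t] by blast
    show "h t \<in> Units ?L" if t: "t \<in> carrier R - ?M" for t
    proof -
      have "h t \<otimes>\<^bsub>?L\<^esub> L.fraction \<one>\<^bsub>?Q\<^esub> (I +> t) = \<one>\<^bsub>?L\<^esub>"
      proof -
        have "I +> t \<in> carrier ?Q" using t by auto
        then show ?thesis
          unfolding h_def using lift[OF t] S1 L.mult_localization[of "I +> t" "\<one>\<^bsub>?Q\<^esub>" "\<one>\<^bsub>?Q\<^esub>" "I +> t"]
            L.fraction_eqI[of "I +> t" "I +> t" "\<one>\<^bsub>?Q\<^esub>" "\<one>\<^bsub>?Q\<^esub>"]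
          by (simp add: L.one_localization)
      qed
      moreover have "L.fraction \<one>\<^bsub>?Q\<^esub> (I +> t) \<in> carrier ?L" "h t \<in> carrier ?L"
        using lift[OF t] t S1 ring_hom_closed[OF hom] by (auto intro!: frac_in)
      ultimately show ?thesis using LC.m_comm unfolding Units_def by fastforce
    qed
    show "ideal I R" by (rule I)
    show "h r = \<zero>\<^bsub>?L\<^esub>" if "r \<in> I" for r
      unfolding h_def L.zero_localization using a_rcos_zero[OF I that] zeroQ by simp
    show "\<exists>u\<in>carrier R - ?M. u \<otimes> r \<in> I" if r: "r \<in> carrier R" "h r = \<zero>\<^bsub>?L\<^esub>" for r
    proof -
      have "L.fraction (I +> r) \<one>\<^bsub>?Q\<^esub> = L.fraction \<zero>\<^bsub>?Q\<^esub> \<one>\<^bsub>?Q\<^esub>" using r(2) by (simp add: h_def L.zero_localization)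
      then have "((I +> r, \<one>\<^bsub>?Q\<^esub>), (\<zero>\<^bsub>?Q\<^esub>, \<one>\<^bsub>?Q\<^esub>)) \<in> fraction_rel ?Q ?S"
        using eq_equiv_class[OF _ L.equiv_fraction_rel] S1 by auto
      then obtain u' where u': "u' \<in> ?S"
        "u' \<otimes>\<^bsub>?Q\<^esub> ((I +> r) \<otimes>\<^bsub>?Q\<^esub> \<one>\<^bsub>?Q\<^esub> \<ominus>\<^bsub>?Q\<^esub> \<zero>\<^bsub>?Q\<^esub> \<otimes>\<^bsub>?Q\<^esub> \<one>\<^bsub>?Q\<^esub>) = \<zero>\<^bsub>?Q\<^esub>"
        by (auto simp: fraction_rel_def)
      obtain u where u: "u \<in> carrier R" "u' = I +> u" using surj u'(1) by blast
      have "I +> (u \<otimes> r) = \<zero>\<^bsub>?Q\<^esub>" using u u' r(1) by (simp add: Q.minus_eq)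
      then have "I +> (u \<otimes> r) = I" unfolding zeroQ .
      then have "u \<otimes> r \<in> I" using ideal.rcos_const_imp_mem[OF I] u r(1) by simp
      then show ?thesis using u u' by auto
    qed
    show "\<exists>r\<in>carrier R. \<exists>t\<in>carrier R - ?M. h t \<otimes>\<^bsub>?L\<^esub> x = h r" if x: "x \<in> carrier ?L" for x
    proof -
      obtain q s where qs: "q \<in> carrier ?Q" "s \<in> ?S" "x = L.fraction q s"
        using x unfolding L.carrier_localization by blast
      obtain r t where r: "r \<in> carrier R" "q = I +> r" "t \<in> carrier R" "s = I +> t"
        using surj qs by (meson DiffD1)
      have s: "s \<in> carrier ?Q" using qs by blast
      have "h t \<otimes>\<^bsub>?L\<^esub> x = L.fraction (s \<otimes>\<^bsub>?Q\<^esub> q) (\<one>\<^bsub>?Q\<^esub> \<otimes>\<^bsub>?Q\<^esub> s)"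
        unfolding h_def qs(3) r(4)[symmetric] by (rule L.mult_localization[OF s S1 qs(1,2)])
      also have "\<dots> = L.fraction q \<one>\<^bsub>?Q\<^esub>"
        using s qs(1,2) S1 by (intro L.fraction_eqI) (simp_all add: Q.m_comm)
      finally have "h t \<otimes>\<^bsub>?L\<^esub> x = h r" by (simp add: h_def r(2))
      then show ?thesis using r qs by auto
    qed
  qed (use hom is_cring LC.is_cring in auto)
  then show ?thesis by blast
qed

text \<open>The degenerate case of trivial denominators, used to carry the Noetherian property over
  to R/I.\<close>

lemma (in cring) fraction_hom_Quot:
  assumes I: "ideal I R"
  shows "fraction_hom R (R Quot I) ((+>) I) {\<one>} I"
proof (intro fraction_hom.intro fraction_hom_axioms.intro)
  let ?Q = "R Quot I"
  interpret Q: cring ?Q by (rule ideal.quotient_is_cring[OF I is_cring])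
  show hom: "ring_hom_cring R ?Q ((+>) I)" by (rule ideal.rcos_ring_hom_cring[OF I is_cring])
  have one: "I +> \<one> = \<one>\<^bsub>?Q\<^esub>" by (rule ring_hom_one[OF ideal.rcos_ring_hom[OF I]])
  show "I +> t \<in> Units ?Q" if "t \<in> {\<one>}" for t
    using that Q.Units_one_closed unfolding one[symmetric] by blast
  show "I +> r = \<zero>\<^bsub>?Q\<^esub>" if "r \<in> I" for r using a_rcos_zero[OF I that] zero_Quot by metis
  show "\<exists>u\<in>{\<one>}. u \<otimes> r \<in> I" if "r \<in> carrier R" "I +> r = \<zero>\<^bsub>?Q\<^esub>" for r
  proof -
    have "I +> r = I" using that(2) unfolding zero_Quot .
    then have "r \<in> I" by (rule ideal.rcos_const_imp_mem[OF I that(1)])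
    then show ?thesis using that(1) by simp
  qed
  show "\<exists>r\<in>carrier R. \<exists>t\<in>{\<one>}. (I +> t) \<otimes>\<^bsub>?Q\<^esub> x = I +> r" if "x \<in> carrier ?Q" for x
  proof -
    from that[unfolded carrier_Quot] obtain r where r: "x = I +> r" "r \<in> carrier R" by (rule imageE)
    have "(I +> \<one>) \<otimes>\<^bsub>?Q\<^esub> x = I +> r" unfolding one Q.l_one[OF that] by (rule r(1))
    then show ?thesis by (rule bexI[OF bexI[OF _ singletonI] r(2)])
  qed
qed (use I in auto)

text \<open>At each maximal ideal the sequences of \<open>reg\<close> give depth at least d and
  \<open>chain\<close> gives dimension at most d; the general bound of depth by dimension closes the
  circle. Both assumptions speak of R and I alone, so polynomials need no cosets or
  fractions.\<close>

theorem (in cring) cohen_macaulay_QuotI: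
  assumes R: "noetherian_ring R" and I: "ideal I R"
    and chain: "\<And>P e. (\<forall>i\<le>e. primeideal (P i) R) \<Longrightarrow> (\<forall>i<e. P i \<subset> P (Suc i)) \<Longrightarrow> I \<subseteq> P 0 \<Longrightarrow> e \<le> d"
    and reg: "\<And>M. maximalideal M R \<Longrightarrow> I \<subseteq> M \<Longrightarrow> \<exists>fs. length fs = d \<and> set fs \<subseteq> M \<and>
      (\<forall>i<d. \<forall>a\<in>carrier R. fs ! i \<otimes> a \<in> Idl (I \<union> set (take i fs)) \<longrightarrow> a \<in> Idl (I \<union> set (take i fs)))"
  shows "cohen_macaulay (R Quot I)"
  unfolding cohen_macaulay_def
proof (intro conjI allI impI)
  let ?Q = "R Quot I"
  show Q: "cring ?Q" by (rule ideal.quotient_is_cring[OF I is_cring])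
  interpret Q: cring ?Q by (rule Q)
  show "noetherian_ring ?Q" by (rule fraction_hom.noetherian_image[OF fraction_hom_Quot[OF I] R])
  fix M' assume "maximalideal M' ?Q"
  then obtain h M where "local_fraction_hom R (localization ?Q (carrier ?Q - M')) h M I"
    using local_fraction_hom_localization[OF I] by blast
  then interpret h: local_fraction_hom R "localization ?Q (carrier ?Q - M')" h M I .
  let ?L = "localization ?Q (carrier ?Q - M')"
  obtain fs where fs: "length fs = d" "set fs \<subseteq> M" and reg_fs:
      "\<And>i a. i < d \<Longrightarrow> a \<in> carrier R \<Longrightarrow> fs ! i \<otimes> a \<in> Idl (I \<union> set (take i fs)) \<Longrightarrow> a \<in> Idl (I \<union> set (take i fs))"
    using reg[OF h.M h.I_M] by blast
  have "regular_sequence ?L (map h fs)"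
    by (rule h.regular_sequence_image[OF fs(2)]) (use fs(1) reg_fs in auto)
  moreover have "set (map h fs) \<subseteq> h.extension M"
    using fs h.h_mem_extension[OF h.M_ideal] by auto
  ultimately have "enat d \<in> {enat (length xs) | xs. regular_sequence ?L xs \<and> set xs \<subseteq> h.extension M}"
    using fs(1) by (metis (mono_tags, lifting) length_map mem_Collect_eq)
  then have ge: "enat d \<le> depth ?L (h.extension M)"
    unfolding depth_def by (rule Sup_upper)
  have "depth ?L (h.extension M) \<le> krull_dim ?L"
    unfolding depth_def by (rule Sup_least) (auto intro: h.S.regular_sequence_le_krull_dim)
  moreover have "krull_dim ?L \<le> enat d" by (rule h.krull_dim_le[OF chain])
  ultimately have "depth ?L (h.extension M) = krull_dim ?L" using ge by simp
  then show "cohen_macaulay_local ?L"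
    unfolding cohen_macaulay_local_def
    using h.S.is_cring h.noetherian_image[OF R] h.maximalideals by blast
qed

section \<open>Polynomials\<close>

abbreviation "lookup \<equiv> Poly_Mapping.lookup"
abbreviation "keys \<equiv> Poly_Mapping.keys"
abbreviation "single \<equiv> Poly_Mapping.single"

definition polys :: "'x set \<Rightarrow> ('x, 'k::comm_ring_1) mpolynomial set" where
  "polys V = {f. \<forall>a\<in>keys f. keys a \<subseteq> V}"

lemma carrier_mpoly_ring: "carrier (mpoly_ring V) = polys V"
  by (simp add: mpoly_ring_def polys_def)

lemma mpoly_ring_simps [simp]:
  "f \<otimes>\<^bsub>mpoly_ring V\<^esub> g = f * g" "f \<oplus>\<^bsub>mpoly_ring V\<^esub> g = f + g"
  "\<one>\<^bsub>mpoly_ring V\<^esub> = 1" "\<zero>\<^bsub>mpoly_ring V\<^esub> = 0"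
  by (simp_all add: mpoly_ring_def)

global_interpretation polys: comm_subring "polys V :: ('x, 'k::comm_ring_1) mpolynomial set"
proof
  interpret cring "mpoly_ring V :: ('x, 'k) mpolynomial ring" by (rule cring_mpoly_ring)
  show "1 \<in> (polys V :: ('x, 'k) mpolynomial set)"
    using one_closed by (simp add: carrier_mpoly_ring)
  fix f g :: "('x, 'k) mpolynomial" assume f: "f \<in> polys V"
  then show "- f \<in> polys V" by (simp add: polys_def)
  assume "g \<in> polys V"
  with f show "f + g \<in> polys V" "f * g \<in> polys V"
    using a_closed[of f g] m_closed[of f g] by (simp_all add: carrier_mpoly_ring)
qed

lemma single_mem_polys: "keys a \<subseteq> V \<Longrightarrow> single a c \<in> polys V"
  by (simp add: polys_def)

lemma polys_mono: "V \<subseteq> W \<Longrightarrow> polys V \<subseteq> polys W"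
  by (auto simp: polys_def)

lemma ideal_of_iff_ideal:
  "polys.ideal_of V I \<longleftrightarrow> ideal I (mpoly_ring V :: ('x, 'k::comm_ring_1) mpolynomial ring)"
proof
  let ?R = "mpoly_ring V :: ('x, 'k) mpolynomial ring"
  interpret R: cring ?R by (rule cring_mpoly_ring)
  show "polys.ideal_of V I" if "ideal I ?R"
  proof -
    interpret I: ideal I ?R by (rule that)
    show ?thesis
      unfolding polys.ideal_of_def
      using I.a_subset I.zero_closed I.a_closed I.I_l_closed by (simp add: carrier_mpoly_ring)
  qed
  show "ideal I ?R" if I: "polys.ideal_of V I"
  proof (rule idealI[OF R.ring_axioms])
    show "subgroup I (add_monoid ?R)"
    proof (rule group.subgroupI[OF R.add.is_group])
      show "I \<subseteq> carrier (add_monoid ?R)" using polys.ideal_ofD(1)[OF I] by (auto simp: carrier_mpoly_ring)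
      show "I \<noteq> {}" using polys.ideal_ofD(2)[OF I] by blast
      fix x assume x: "x \<in> I"
      then have xR: "x \<in> carrier ?R" using polys.ideal_ofD(1)[OF I] by (simp add: carrier_mpoly_ring)
      have mxR: "- x \<in> carrier ?R" using xR by (auto simp: carrier_mpoly_ring)
      have "\<ominus>\<^bsub>?R\<^esub> x = - x"
        by (rule R.minus_equality[OF _ xR mxR]) simp
      then show "inv\<^bsub>add_monoid ?R\<^esub> x \<in> I"
        using polys.ideal_ofD(6)[OF I x] by (simp add: a_inv_def)
      show "x \<otimes>\<^bsub>add_monoid ?R\<^esub> y \<in> I" if "y \<in> I" for y
        using polys.ideal_ofD(3)[OF I x that] by simp
    qed
    show "x \<otimes>\<^bsub>?R\<^esub> a \<in> I" "a \<otimes>\<^bsub>?R\<^esub> x \<in> I" if "a \<in> I" "x \<in> carrier ?R" for a x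
      using polys.ideal_ofD(4,5)[OF I] that by (simp_all add: carrier_mpoly_ring)
  qed
qed

text \<open>Translates the recursion, which enlarges the ideal step by step, into the indexed form
  of a regular sequence, where the ideal is generated by I and an initial segment.\<close>

lemma weakly_regular_nth:
  fixes I :: "('x, 'k::comm_ring_1) mpolynomial set"
  assumes "polys.weakly_regular V I fs" "polys.ideal_of V I" "set fs \<subseteq> polys V" "i < length fs" "a \<in> polys V"
    and "fs ! i * a \<in> Idl\<^bsub>mpoly_ring V\<^esub> (I \<union> set (take i fs))"
  shows "a \<in> Idl\<^bsub>mpoly_ring V\<^esub> (I \<union> set (take i fs))"
  using assms
proof (induction fs arbitrary: I i)
  case (Cons f fs)
  let ?R = "mpoly_ring V :: ('x, 'k) mpolynomial ring"
  interpret R: cring ?R by (rule cring_mpoly_ring)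
  note I = Cons.prems(2)
  have f: "f \<in> polys V" and fs: "set fs \<subseteq> polys V" using Cons.prems(3) by auto
  have Isub: "I \<subseteq> polys V" using polys.ideal_ofD(1)[OF I] by blast
  have adj: "polys.ideal_of V (polys.adjoin V I f)" by (rule polys.ideal_of_adjoin[OF I f])
  show ?case
  proof (cases i)
    case 0
    have "Idl\<^bsub>?R\<^esub> I = I"
      using R.genideal_self[of I] R.genideal_minimal[of I I] Isub I
      unfolding carrier_mpoly_ring ideal_of_iff_ideal by blast
    then show ?thesis using Cons.prems 0 by (simp add: polys.nonzerodivisor_mod_def)
  next
    case (Suc j)
    let ?F = "set (take j fs)"
    have F: "?F \<subseteq> polys V" using fs set_take_subset[of j fs] by blast
    have "Idl\<^bsub>?R\<^esub> (I \<union> insert f ?F) = Idl\<^bsub>?R\<^esub> (polys.adjoin V I f \<union> ?F)"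
    proof
      have sub: "polys.adjoin V I f \<union> ?F \<subseteq> carrier ?R"
        using F polys.ideal_ofD(1)[OF adj] by (auto simp: carrier_mpoly_ring)
      have sub': "I \<union> insert f ?F \<subseteq> carrier ?R" using F Isub f by (auto simp: carrier_mpoly_ring)
      note J = R.genideal_ideal[OF sub] and J' = R.genideal_ideal[OF sub']
      show "Idl\<^bsub>?R\<^esub> (I \<union> insert f ?F) \<subseteq> Idl\<^bsub>?R\<^esub> (polys.adjoin V I f \<union> ?F)"
        using R.genideal_self[OF sub] polys.subset_adjoin[of _ I V f] polys.self_adjoin[OF I, of f]
        by (intro R.genideal_minimal J) auto
      have "polys.adjoin V I f \<subseteq> Idl\<^bsub>?R\<^esub> (I \<union> insert f ?F)"
        using R.genideal_self[OF sub'] by (intro polys.adjoin_minimal J'[folded ideal_of_iff_ideal]) auto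
      then show "Idl\<^bsub>?R\<^esub> (polys.adjoin V I f \<union> ?F) \<subseteq> Idl\<^bsub>?R\<^esub> (I \<union> insert f ?F)"
        using R.genideal_self[OF sub'] by (intro R.genideal_minimal J') auto
    qed
    then show ?thesis using Cons.IH[OF _ adj fs, of j] Cons.prems Suc by simp
  qed
qed simp

section \<open>Exponents, monomial expansions and coefficients in one variable\<close>

lemma lookup_exponent_diff: "lookup (a - b) i = lookup a i - lookup (b :: 'x \<Rightarrow>\<^sub>0 nat) i"
  by (simp add: lookup_minus)

lemma exponent_add_diff:
  assumes "\<And>i. lookup b i \<le> lookup a i"
  shows "b + (a - b) = (a :: 'x \<Rightarrow>\<^sub>0 nat)"
  using assms by (intro poly_mapping_eqI) (simp add: lookup_add lookup_exponent_diff)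

lemma keys_exponent_add: "keys (a + b) = keys a \<union> keys (b :: 'x \<Rightarrow>\<^sub>0 nat)"
  by (auto simp: in_keys_iff lookup_add)

lemma sum_monomials:
  fixes f :: "'a \<Rightarrow>\<^sub>0 'b::comm_monoid_add"
  shows "(\<Sum>a\<in>keys f. single a (lookup f a)) = f"
proof (rule poly_mapping_eqI)
  fix b
  have "lookup (\<Sum>a\<in>keys f. single a (lookup f a)) b = (\<Sum>a\<in>keys f. if a = b then lookup f a else 0)"
    unfolding lookup_sum by (intro sum.cong) (auto simp: lookup_single when_def)
  then show "lookup (\<Sum>a\<in>keys f. single a (lookup f a)) b = lookup f b"
    by (auto simp: in_keys_iff)
qed

lemma monomial_induct [case_names zero add monomial]:
  fixes f :: "'a \<Rightarrow>\<^sub>0 'b::comm_monoid_add"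
  assumes "P 0" "\<And>f g. P f \<Longrightarrow> P g \<Longrightarrow> P (f + g)" "\<And>a. a \<in> keys f \<Longrightarrow> P (single a (lookup f a))"
  shows "P f"
proof -
  have "P (\<Sum>a\<in>A. single a (lookup f a))" if "A \<subseteq> keys f" for A
    using that by (induction A rule: infinite_finite_induct) (auto intro: assms)
  from this[OF order.refl] show ?thesis by (simp add: sum_monomials)
qed

lemma lookup_single_mult_add:
  fixes a b :: "'x \<Rightarrow>\<^sub>0 nat"
  shows "lookup (single a c * f) (a + b) = c * lookup f b"
proof (induction f rule: monomial_induct)
  case (monomial d)
  then show ?case by (simp add: mult_single lookup_single when_def)
qed (simp_all add: distrib_left lookup_add)

lemma keys_single_mult:
  fixes a :: "'x \<Rightarrow>\<^sub>0 nat" and f :: "('x, 'k::comm_ring_1) mpolynomial"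
  shows "keys (single a 1 * f) = (+) a ` keys f"
proof
  show "keys (single a 1 * f) \<subseteq> (+) a ` keys f"
    using keys_mult[of "single a 1" f] by fastforce
  show "(+) a ` keys f \<subseteq> keys (single a 1 * f)"
    by (auto simp: in_keys_iff lookup_single_mult_add)
qed

text \<open>The coefficient of the t-th power of the variable j when f is expanded in powers of that
  variable, as a polynomial in the other variables.\<close>

lift_definition slice :: "'x \<Rightarrow> nat \<Rightarrow> ('x, 'k::comm_ring_1) mpolynomial \<Rightarrow> ('x, 'k) mpolynomial"
  is "\<lambda>j t f b. f (b + single j t) when lookup b j = 0"
proof -
  fix j :: 'x and t and f :: "('x \<Rightarrow>\<^sub>0 nat) \<Rightarrow> 'k" assume fin: "finite {b. f b \<noteq> 0}"
  have "{b. (f (b + single j t) when lookup b j = 0) \<noteq> 0} \<subseteq> (\<lambda>a. a - single j t) ` {b. f b \<noteq> 0}"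
  proof
    fix b assume "b \<in> {b. (f (b + single j t) when lookup b j = 0) \<noteq> 0}"
    moreover have "b = (b + single j t) - single j t" by simp
    ultimately show "b \<in> (\<lambda>a. a - single j t) ` {b. f b \<noteq> 0}"
      by (intro image_eqI[of _ _ "b + single j t"]) auto
  qed
  then show "finite {b. (f (b + single j t) when lookup b j = 0) \<noteq> 0}"
    using fin finite_surj by blast
qed

lemma slice_add: "slice j t (f + g) = slice j t f + slice j t g"
  by (rule poly_mapping_eqI) (simp add: slice.rep_eq lookup_add when_def)

lemma slice_zero [simp]: "slice j t 0 = 0"
  by (rule poly_mapping_eqI) (simp add: slice.rep_eq)

lemma slice_sum: "slice j t (sum F S) = (\<Sum>i\<in>S. slice j t (F i))"
  by (induction S rule: infinite_finite_induct) (simp_all add: slice_add)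

lemma slice_single:
  "slice j t (single a c) = (single (a - single j t) c when lookup a j = t)"
proof (rule poly_mapping_eqI)
  fix b
  have "a = b + single j t \<longleftrightarrow> b = a - single j t" if "lookup a j = t" "lookup b j = 0"
  proof
    assume b: "b = a - single j t"
    show "a = b + single j t"
      unfolding b using that by (intro poly_mapping_eqI) (auto simp: lookup_add lookup_exponent_diff lookup_single when_def)
  qed simp
  moreover have "lookup a j = t" if "a = b + single j t" "lookup b j = 0"
    using that by (simp add: lookup_add)
  moreover have "lookup (a - single j t) j = 0" if "lookup a j = t"
    using that by (simp add: lookup_exponent_diff)
  ultimately show "lookup (slice j t (single a c)) b = lookup (single (a - single j t) c when lookup a j = t) b"
    by (auto simp: slice.rep_eq lookup_single when_def)
qed

lemma keys_slice: "b \<in> keys (slice j t f) \<Longrightarrow> lookup b j = 0 \<and> b + single j t \<in> keys f"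
  by (auto simp: in_keys_iff slice.rep_eq when_def split: if_splits)

lemma slice_mem_polys: "f \<in> polys V \<Longrightarrow> slice j t f \<in> polys (V - {j})"
proof -
  assume f: "f \<in> polys V"
  show ?thesis unfolding polys_def
  proof (clarify)
    fix b i assume b: "b \<in> keys (slice j t f)" "i \<in> keys b"
    then have "lookup b j = 0" "keys (b + single j t) \<subseteq> V"
      using keys_slice[OF b(1)] f by (auto simp: polys_def)
    then show "i \<in> V - {j}" using b(2) by (auto simp: keys_exponent_add in_keys_iff)
  qed
qed

lemma slice_mult:
  assumes "g \<in> polys (UNIV - {j})"
  shows "slice j t (g * f) = g * slice j t f"
proof -
  have "slice j t (single a c * f) = single a c * slice j t f" if a: "lookup a j = 0" for a c
  proof (induction f rule: monomial_induct)
    case (monomial d)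
    have "a + d - single j t = a + (d - single j t)" if "lookup d j = t"
      using that by (intro poly_mapping_eqI) (auto simp: lookup_add lookup_exponent_diff lookup_single when_def)
    then show ?case using a by (simp add: mult_single slice_single lookup_add when_def)
  qed (simp_all add: slice_add distrib_left)
  moreover have "lookup a j = 0" if "a \<in> keys g" for a
  proof -
    have "j \<notin> keys a" using that assms by (auto simp: polys_def)
    then show ?thesis by (simp add: in_keys_iff)
  qed
  ultimately have "slice j t (\<Sum>a\<in>keys g. single a (lookup g a) * f) = (\<Sum>a\<in>keys g. single a (lookup g a) * slice j t f)"
    by (simp add: slice_sum)
  then show ?thesis by (simp add: sum_distrib_right[symmetric] sum_monomials)
qed

lemma slice_var_power_mult:
  "slice j t (single (single j s) c * f) = (if s \<le> t then single 0 c * slice j (t - s) f else 0)"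
proof (induction f rule: monomial_induct)
  case (monomial d)
  have "single j s + d - single j t = d - single j (t - s)" if "s \<le> t"
    using that by (intro poly_mapping_eqI) (auto simp: lookup_add lookup_exponent_diff lookup_single when_def)
  then show ?case by (auto simp: mult_single slice_single lookup_add when_def)
qed (simp_all add: slice_add distrib_left)

lemma sum_slices:
  fixes f :: "('x, 'k::comm_ring_1) mpolynomial"
  assumes "\<And>a. a \<in> keys f \<Longrightarrow> lookup a j \<le> N"
  shows "(\<Sum>t\<le>N. slice j t f * single (single j t) 1) = f"
  using assms
proof -
  have 1: "(\<Sum>t\<le>N. slice j t (single a c) * single (single j t) 1) = single a c"
    if "lookup a j \<le> N" for a and c :: 'k
  proof -
    have "a - single j (lookup a j) + single j (lookup a j) = a"
      by (intro poly_mapping_eqI) (auto simp: lookup_add lookup_exponent_diff lookup_single when_def)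
    then have "(\<Sum>t\<le>N. slice j t (single a c) * single (single j t) 1)
        = (\<Sum>t\<le>N. if t = lookup a j then single a c else 0)"
      by (intro sum.cong refl) (auto simp: slice_single mult_single when_def)
    then show ?thesis using that by simp
  qed
  have "(\<Sum>t\<le>N. slice j t f * single (single j t) 1)
      = (\<Sum>t\<le>N. \<Sum>a\<in>keys f. slice j t (single a (lookup f a)) * single (single j t) 1)"
    by (subst (1) sum_monomials[symmetric]) (simp add: slice_sum sum_distrib_right)
  also have "\<dots> = (\<Sum>a\<in>keys f. single a (lookup f a))"
    using assms by (subst sum.swap) (simp add: 1)
  finally show ?thesis by (simp add: sum_monomials)
qed

lemma exponent_bound: "\<exists>N. \<forall>a\<in>keys f. lookup a j \<le> (N :: nat)"
  by (intro exI[of _ "Max ((\<lambda>a. lookup a j) ` keys f)"]) simp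

text \<open>Stability under slices means that J is extended from the ring without the variable j.
  The lowest nonzero coefficient \<open>q s\<close> of y is a unit of k, so the coefficient of
  degree \<open>t + s\<close> in \<open>y * f\<close> determines the t-th slice of f modulo J from
  the earlier slices.\<close>

lemma nonzerodivisor_univariate:
  fixes y :: "('x, 'k::field) mpolynomial"
  assumes J: "polys.ideal_of V J" and stable: "\<And>f t. f \<in> J \<Longrightarrow> slice j t f \<in> J"
    and j: "j \<in> V" and y: "y \<in> polys {j}" "y \<noteq> 0"
  shows "polys.nonzerodivisor_mod V J y"
  unfolding polys.nonzerodivisor_mod_def
proof (intro ballI impI)
  fix f assume f: "f \<in> polys V" "y * f \<in> J"
  define q where "q u = lookup y (single j u)" for u
  have key: "a = single j (lookup a j)" if "a \<in> keys y" for a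
  proof (rule poly_mapping_eqI)
    fix i
    have "keys a \<subseteq> {j}" using that y(1) by (auto simp: polys_def)
    then show "lookup a i = lookup (single j (lookup a j)) i"
      by (auto simp: lookup_single when_def in_keys_iff)
  qed
  obtain N where N: "\<And>a. a \<in> keys y \<Longrightarrow> lookup a j \<le> N" using exponent_bound[of y j] by metis
  have ysum: "(\<Sum>u\<le>N. single (single j u) (q u)) = y"
  proof (rule poly_mapping_eqI)
    fix b
    have "lookup (\<Sum>u\<le>N. single (single j u) (q u)) b
        = (\<Sum>u\<le>N. if u = lookup b j then (if single j u = b then lookup y b else 0) else 0)"
      unfolding lookup_sum by (intro sum.cong refl) (auto simp: lookup_single when_def q_def)
    also have "\<dots> = (if lookup b j \<le> N then if single j (lookup b j) = b then lookup y b else 0 else 0)"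
      by simp
    also have "\<dots> = lookup y b"
      using key[of b, symmetric] N[of b] by (cases "b \<in> keys y") (simp_all add: in_keys_iff)
    finally show "lookup (\<Sum>u\<le>N. single (single j u) (q u)) b = lookup y b" .
  qed
  have "\<exists>s. q s \<noteq> 0"
  proof (rule ccontr)
    assume "\<nexists>s. q s \<noteq> 0"
    then have "y = 0" by (subst ysum[symmetric]) simp
    with y(2) show False ..
  qed
  define s where "s = (LEAST s. q s \<noteq> 0)"
  have s: "q s \<noteq> 0" and s_min: "u < s \<Longrightarrow> q u = 0" for u
    using LeastI_ex[OF \<open>\<exists>s. q s \<noteq> 0\<close>] not_less_Least[of u "\<lambda>s. q s \<noteq> 0"] unfolding s_def by blast+
  have sN: "s \<le> N" using N[of "single j s"] s by (auto simp: q_def in_keys_iff)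
  have const: "single 0 c * g \<in> J" if "g \<in> J" for c g
    using polys.ideal_ofD(4)[OF J _ that] single_mem_polys[of 0 V c] by simp
  have slices: "slice j t f \<in> J" for t
  proof (induction t rule: less_induct)
    case (less t)
    have "slice j (t + s) (y * f) = (\<Sum>u\<le>N. if u \<le> t + s then single 0 (q u) * slice j (t + s - u) f else 0)"
      by (subst ysum[symmetric]) (simp add: sum_distrib_right slice_sum slice_var_power_mult)
    also have "\<dots> = single 0 (q s) * slice j t f
        + (\<Sum>u\<in>{..N} - {s}. if u \<le> t + s then single 0 (q u) * slice j (t + s - u) f else 0)"
      using sN by (subst sum.remove[of _ s]) auto
    finally have "single 0 (q s) * slice j t f = slice j (t + s) (y * f)
        - (\<Sum>u\<in>{..N} - {s}. if u \<le> t + s then single 0 (q u) * slice j (t + s - u) f else 0)"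
      by simp
    also have "\<dots> \<in> J"
    proof (intro polys.ideal_ofD(7)[OF J] stable f(2) polys.ideal_of_sum[OF J])
      \<comment> \<open>Terms with \<open>u < s\<close> vanish because s is the order of y; for
        \<open>u > s\<close> the slice index \<open>t + s - u\<close> is below t, so the induction
        applies.\<close>
      fix u assume u: "u \<in> {..N} - {s}"
      show "(if u \<le> t + s then single 0 (q u) * slice j (t + s - u) f else 0) \<in> J"
      proof (cases "u < s")
        case True
        then show ?thesis using s_min polys.ideal_ofD(2)[OF J] by simp
      next
        case False
        then show ?thesis using u less[of "t + s - u"] const polys.ideal_ofD(2)[OF J] by auto
      qed
    qed
    finally have "single 0 (inverse (q s)) * (single 0 (q s) * slice j t f) \<in> J" by (rule const)
    then show ?case using s by (simp add: mult.assoc[symmetric] mult_single)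
  qed
  obtain N' where N': "\<And>a. a \<in> keys f \<Longrightarrow> lookup a j \<le> N'" using exponent_bound[of f j] by metis
  have "(\<Sum>t\<le>N'. slice j t f * single (single j t) 1) \<in> J"
    using j by (intro polys.ideal_of_sum[OF J] polys.ideal_ofD(5)[OF J] slices single_mem_polys) auto
  then show "f \<in> J" by (subst (asm) sum_slices) (use N' in auto)
qed

section \<open>Monomial ideals\<close>

text \<open>For an arbitrary set U of exponents this is only a span of monomials;
  \<open>up_closed\<close> makes it an ideal. Keeping U as a plain set lets cones be added and
  removed by set operations.\<close>

definition monomial_ideal :: "'x set \<Rightarrow> ('x \<Rightarrow>\<^sub>0 nat) set \<Rightarrow> ('x, 'k::comm_ring_1) mpolynomial set" where
  "monomial_ideal V U = {f \<in> polys V. keys f \<subseteq> U}"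

definition up_closed :: "'x set \<Rightarrow> ('x \<Rightarrow>\<^sub>0 nat) set \<Rightarrow> bool" where
  "up_closed V U \<longleftrightarrow> (\<forall>a\<in>U. \<forall>b. keys b \<subseteq> V \<longrightarrow> a + b \<in> U)"

text \<open>The order of a monomial along the prime of \<open>\<sigma>\<close>: for
  \<open>\<sigma> \<subseteq> V\<close> the m-th power of that prime is spanned by the monomials for
  which this number is at least m.\<close>

definition multidegree :: "'x set \<Rightarrow> ('x \<Rightarrow>\<^sub>0 nat) \<Rightarrow> nat" where
  "multidegree \<sigma> a = (\<Sum>i\<in>\<sigma>. lookup a i)"

lemma multidegree_add: "multidegree \<sigma> (a + b) = multidegree \<sigma> a + multidegree \<sigma> b"
  by (simp add: multidegree_def lookup_add sum.distrib)

lemma multidegree_eq_0_iff: "finite \<sigma> \<Longrightarrow> multidegree \<sigma> a = 0 \<longleftrightarrow> keys a \<inter> \<sigma> = {}"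
  by (auto simp: multidegree_def in_keys_iff)

lemma up_closed_multidegree: "up_closed V {a. m \<le> multidegree \<sigma> a}"
  by (auto simp: up_closed_def multidegree_add)

lemma monomial_mem_monomial_ideal: "keys a \<subseteq> V \<Longrightarrow> a \<in> U \<Longrightarrow> single a c \<in> monomial_ideal V U"
  by (simp add: monomial_ideal_def single_mem_polys)

lemma ideal_of_monomial_ideal:
  assumes U: "up_closed V U"
  shows "polys.ideal_of V (monomial_ideal V U :: ('x, 'k::comm_ring_1) mpolynomial set)"
  unfolding polys.ideal_of_def
proof (intro conjI ballI)
  fix f g :: "('x, 'k) mpolynomial"
  assume g: "g \<in> monomial_ideal V U"
  show "f + g \<in> monomial_ideal V U" if "f \<in> monomial_ideal V U"
    using g that Poly_Mapping.keys_add[of f g] by (auto simp: monomial_ideal_def)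
  show "f * g \<in> monomial_ideal V U" if f: "f \<in> polys V"
  proof -
    have "c \<in> U" if c: "c \<in> keys (f * g)" for c
    proof -
      obtain a b where ab: "c = a + b" "a \<in> keys f" "b \<in> keys g" using c keys_mult[of f g] by blast
      then have "b \<in> U" "keys a \<subseteq> V" using f g by (auto simp: polys_def monomial_ideal_def)
      then have "b + a \<in> U" using U unfolding up_closed_def by blast
      then show ?thesis unfolding ab(1) by (simp only: add.commute)
    qed
    then show ?thesis using f g by (auto simp: monomial_ideal_def)
  qed
qed (auto simp: monomial_ideal_def)

lemma monomial_ideal_subset_ideal:
  fixes J :: "('x, 'k::comm_ring_1) mpolynomial set"
  assumes J: "polys.ideal_of V J" and "\<And>a c. a \<in> U \<Longrightarrow> keys a \<subseteq> V \<Longrightarrow> single a c \<in> J"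
  shows "monomial_ideal V U \<subseteq> J"
proof
  fix f :: "('x, 'k) mpolynomial" assume f: "f \<in> monomial_ideal V U"
  have "(\<Sum>a\<in>keys f. single a (lookup f a)) \<in> J"
    using f assms(2) by (intro polys.ideal_of_sum[OF J]) (auto simp: monomial_ideal_def polys_def)
  then show "f \<in> J" by (simp add: sum_monomials)
qed

lemma monomial_prime_eq:
  fixes \<sigma> V :: "'x set"
  assumes \<sigma>: "\<sigma> \<subseteq> V" "finite V"
  shows "(monomial_prime V \<sigma> :: ('x, 'k::comm_ring_1) mpolynomial set) = monomial_ideal V {a. 1 \<le> multidegree \<sigma> a}"
proof
  let ?R = "mpoly_ring V :: ('x, 'k) mpolynomial ring"
  interpret R: cring ?R by (rule cring_mpoly_ring)
  have fin: "finite \<sigma>" using \<sigma> finite_subset by blast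
  have var: "(var ` \<sigma> :: ('x, 'k) mpolynomial set) \<subseteq> carrier ?R"
    by (rule image_subsetI, rule var_in_mpoly_ring) (use \<sigma>(1) in blast)
  note U = up_closed_multidegree[of V 1 \<sigma>]
  have "(var ` \<sigma> :: ('x, 'k) mpolynomial set) \<subseteq> monomial_ideal V {a. 1 \<le> multidegree \<sigma> a}"
  proof (rule image_subsetI)
    fix i assume i: "i \<in> \<sigma>"
    have "multidegree \<sigma> (single i 1) = 1"
      using i fin by (simp add: multidegree_def lookup_single when_def)
    then show "var i \<in> (monomial_ideal V {a. 1 \<le> multidegree \<sigma> a} :: ('x, 'k) mpolynomial set)"
      unfolding var_def using i \<sigma> by (intro monomial_mem_monomial_ideal) auto
  qed
  then show "(monomial_prime V \<sigma> :: ('x, 'k) mpolynomial set) \<subseteq> monomial_ideal V {a. 1 \<le> multidegree \<sigma> a}"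
    unfolding monomial_prime_def
    by (rule R.genideal_minimal[OF ideal_of_monomial_ideal[OF U, unfolded ideal_of_iff_ideal]])
  have J: "polys.ideal_of V (monomial_prime V \<sigma> :: ('x, 'k) mpolynomial set)"
    unfolding ideal_of_iff_ideal by (rule ideal_monomial_prime[OF \<sigma>(1)])
  show "monomial_ideal V {a. 1 \<le> multidegree \<sigma> a} \<subseteq> (monomial_prime V \<sigma> :: ('x, 'k) mpolynomial set)"
  proof (rule monomial_ideal_subset_ideal[OF J])
    fix a and c :: 'k assume a: "a \<in> {a. 1 \<le> multidegree \<sigma> a}" "keys a \<subseteq> V"
    then have "multidegree \<sigma> a \<noteq> 0" by simp
    then obtain i where i: "i \<in> \<sigma>" "lookup a i \<noteq> 0"
      unfolding multidegree_def by (metis sum.neutral)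
    have "a = (a - single i 1) + single i 1"
      using i by (intro poly_mapping_eqI) (auto simp: lookup_add lookup_exponent_diff lookup_single when_def)
    then have eq: "single a c = single (a - single i 1) c * var i" by (simp add: var_def mult_single)
    have "keys (a - single i 1) \<subseteq> V"
      using a(2) by (auto simp: in_keys_iff lookup_exponent_diff)
    moreover have "var i \<in> (monomial_prime V \<sigma> :: ('x, 'k) mpolynomial set)"
      unfolding monomial_prime_def using R.genideal_self[OF var] i by blast
    ultimately show "single a c \<in> (monomial_prime V \<sigma> :: ('x, 'k) mpolynomial set)"
      unfolding eq by (intro polys.ideal_ofD(4)[OF J] single_mem_polys)
  qed
qed

text \<open>A monomial of degree above m in the variables of \<open>\<sigma>\<close> is divisible by
  one of them, and the cofactor still has degree at least m; so it lies in the product ideal. The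
  converse inclusion is additivity of the degree.\<close>

lemma monomial_prime_pow:
  fixes \<sigma> V :: "'x set"
  assumes \<sigma>: "\<sigma> \<subseteq> V" "finite V"
  shows "(monomial_prime V \<sigma> :: ('x, 'k::comm_ring_1) mpolynomial set) [^]\<^bsub>ideals_set (mpoly_ring V)\<^esub> m
    = monomial_ideal V {a. m \<le> multidegree \<sigma> a}"
proof (induction m)
  case 0
  show ?case by (auto simp: ideals_set_def carrier_mpoly_ring monomial_ideal_def)
next
  case (Suc m)
  let ?R = "mpoly_ring V :: ('x, 'k) mpolynomial ring"
  let ?P = "monomial_prime V \<sigma> :: ('x, 'k) mpolynomial set"
  let ?D = "\<lambda>m. monomial_ideal V {a. m \<le> multidegree \<sigma> a} :: ('x, 'k) mpolynomial set"
  interpret R: cring ?R by (rule cring_mpoly_ring)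
  have fin: "finite \<sigma>" using \<sigma> finite_subset by blast
  have D: "polys.ideal_of V (?D m)" for m by (rule ideal_of_monomial_ideal[OF up_closed_multidegree])
  have "?P [^]\<^bsub>ideals_set ?R\<^esub> Suc m = ideal_prod ?R (?P [^]\<^bsub>ideals_set ?R\<^esub> m) ?P"
    by (simp add: ideals_set_def)
  also have "\<dots> = ideal_prod ?R (?D m) (?D 1)"
    unfolding Suc by (simp only: monomial_prime_eq[OF \<sigma>])
  also have "\<dots> = ?D (Suc m)"
  proof
    have J: "ideal (ideal_prod ?R (?D m) (?D 1)) ?R"
      using D unfolding ideal_of_iff_ideal by (intro R.ideal_prod_is_ideal) blast+
    show "?D (Suc m) \<subseteq> ideal_prod ?R (?D m) (?D 1)"
    proof (rule monomial_ideal_subset_ideal[OF J[folded ideal_of_iff_ideal]])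
      fix a and c :: 'k assume a: "a \<in> {a. Suc m \<le> multidegree \<sigma> a}" "keys a \<subseteq> V"
      then have "multidegree \<sigma> a \<noteq> 0" by simp
      then obtain i where i: "i \<in> \<sigma>" "lookup a i \<noteq> 0"
      unfolding multidegree_def by (metis sum.neutral)
      define b where "b = a - single i 1"
      have ab: "a = b + single i 1"
        unfolding b_def using i by (intro poly_mapping_eqI) (auto simp: lookup_add lookup_exponent_diff lookup_single when_def)
      have deg1: "multidegree \<sigma> (single i 1) = 1"
        using i fin by (simp add: multidegree_def lookup_single when_def)
      then have "m \<le> multidegree \<sigma> b" using a(1) by (simp add: ab multidegree_add del: One_nat_def)
      moreover have "keys b \<subseteq> V" "keys (single i (1::nat)) \<subseteq> V"
        using a(2) unfolding ab keys_exponent_add by auto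
      ultimately have "single b c \<in> ?D m" "single (single i 1) 1 \<in> ?D 1"
        using deg1 by (auto intro!: monomial_mem_monomial_ideal)
      from ideal_prod.prod[OF this, of ?R] show "single a c \<in> ideal_prod ?R (?D m) (?D 1)"
        unfolding ab by (simp add: mult_single)
    qed
    show "ideal_prod ?R (?D m) (?D 1) \<subseteq> ?D (Suc m)"
    proof
      fix f assume "f \<in> ideal_prod ?R (?D m) (?D 1)"
      then show "f \<in> ?D (Suc m)"
      proof induction
        case (prod f g)
        have "Suc m \<le> multidegree \<sigma> c" if c: "c \<in> keys (f * g)" for c
        proof -
          obtain a b where "c = a + b" "a \<in> keys f" "b \<in> keys g" using c keys_mult[of f g] by blast
          moreover from this have "m \<le> multidegree \<sigma> a" "1 \<le> multidegree \<sigma> b"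
            using prod unfolding monomial_ideal_def by blast+
          ultimately show ?thesis by (simp add: multidegree_add)
        qed
        then show ?case using prod by (auto simp: monomial_ideal_def)
      next
        case (sum f g)
        then show ?case using polys.ideal_ofD(3)[OF D] by simp
      qed
    qed
  qed
  finally show ?case .
qed

lemma symbolic_power_eq:
  fixes V :: "'x set"
  assumes "finite V" and "\<And>\<sigma>. \<sigma> \<in> C \<Longrightarrow> \<sigma> \<subseteq> V"
  shows "(symbolic_power V C m :: ('x, 'k::comm_ring_1) mpolynomial set)
    = monomial_ideal V {a. keys a \<subseteq> V \<and> (\<forall>\<sigma>\<in>C. m \<le> multidegree \<sigma> a)}"
  unfolding symbolic_power_def using assms
  by (auto simp: monomial_prime_pow carrier_mpoly_ring monomial_ideal_def polys_def)

text \<open>Modulo U the monomial of u generates the ideal of \<open>U \<union> K\<close>, and its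
  annihilator is the prime of \<open>\<sigma>\<close>: multiplying by a monomial leaves the cone,
  and hence lands in U, exactly when a variable of \<open>\<sigma>\<close> occurs.\<close>

lemma weakly_regular_remove_cone:
  fixes fs :: "('x, 'k::comm_ring_1) mpolynomial list"
  assumes U: "up_closed V U" and UK: "up_closed V (U \<union> K)" and disj: "U \<inter> K = {}"
    and K: "K = {u + b | b. keys b \<subseteq> V - \<sigma>}" and u: "keys u \<subseteq> V" and fin: "finite \<sigma>"
    and fs: "set fs \<subseteq> polys V"
    and "polys.weakly_regular V (monomial_ideal V (U \<union> K)) fs"
    and "polys.weakly_regular V (monomial_ideal V {a. 1 \<le> multidegree \<sigma> a}) fs"
  shows "polys.weakly_regular V (monomial_ideal V U) fs"
proof (rule polys.weakly_regular_colon[of _ _ "single u 1"])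
  let ?U = "monomial_ideal V U :: ('x, 'k) mpolynomial set"
  let ?x = "single u 1 :: ('x, 'k) mpolynomial"
  show I: "polys.ideal_of V ?U" by (rule ideal_of_monomial_ideal[OF U])
  show x: "?x \<in> polys V" using u by (rule single_mem_polys)
  have uK: "u \<in> K" unfolding K by (auto intro!: exI[of _ 0])
  have mem: "u + a \<in> U \<longleftrightarrow> 1 \<le> multidegree \<sigma> a" if a: "keys a \<subseteq> V" for a
  proof -
    have "u + a \<in> U \<union> K" using UK uK a unfolding up_closed_def by blast
    moreover have "u + a \<in> K \<longleftrightarrow> keys a \<inter> \<sigma> = {}" unfolding K using a by auto
    ultimately show ?thesis using disj multidegree_eq_0_iff[OF fin, of a] by (auto simp: Suc_le_eq)
  qed
  have "polys.colon V ?U ?x = monomial_ideal V {a. 1 \<le> multidegree \<sigma> a}"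
  proof -
    have "f \<in> polys.colon V ?U ?x \<longleftrightarrow> f \<in> monomial_ideal V {a. 1 \<le> multidegree \<sigma> a}" if f: "f \<in> polys V" for f
    proof -
      have "?x * f \<in> ?U \<longleftrightarrow> (\<forall>a\<in>keys f. u + a \<in> U)"
        using f x polys.mult_mem[OF x f] unfolding monomial_ideal_def by (auto simp: keys_single_mult)
      also have "\<dots> \<longleftrightarrow> f \<in> monomial_ideal V {a. 1 \<le> multidegree \<sigma> a}"
        using f mem by (auto simp: monomial_ideal_def polys_def)
      finally show ?thesis using f by (simp add: polys.colon_def)
    qed
    then show ?thesis by (auto simp: polys.colon_def monomial_ideal_def)
  qed
  then show "polys.weakly_regular V (polys.colon V ?U ?x) fs" using assms(9) by simp
  have adj: "polys.ideal_of V (polys.adjoin V ?U ?x)" by (rule polys.ideal_of_adjoin[OF I x])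
  have "polys.adjoin V ?U ?x = monomial_ideal V (U \<union> K)"
  proof
    show "polys.adjoin V ?U ?x \<subseteq> monomial_ideal V (U \<union> K)"
      using uK u by (intro polys.adjoin_minimal ideal_of_monomial_ideal UK monomial_mem_monomial_ideal)
        (auto simp: monomial_ideal_def)
    show "monomial_ideal V (U \<union> K) \<subseteq> polys.adjoin V ?U ?x"
    proof (rule monomial_ideal_subset_ideal[OF adj])
      fix a and c :: 'k assume a: "a \<in> U \<union> K" "keys a \<subseteq> V"
      show "single a c \<in> polys.adjoin V ?U ?x"
      proof (cases "a \<in> U")
        case True
        then show ?thesis using a by (intro polys.subset_adjoin monomial_mem_monomial_ideal)
      next
        case False
        then obtain b where b: "a = u + b" "keys b \<subseteq> V - \<sigma>" using a K by blast
        then have "single a c = single b c * ?x" by (simp add: mult_single add.commute)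
        moreover have "single b c \<in> polys V" using b by (intro single_mem_polys) auto
        ultimately show ?thesis
          using polys.ideal_ofD(4)[OF adj] polys.self_adjoin[OF I, of ?x] by simp
      qed
    qed
  qed
  then show "polys.weakly_regular V (polys.adjoin V ?U ?x) fs" using assms(8) by simp
qed (rule fs)

text \<open>Removing the cones one by one, in the order of increasing \<open>w\<close>, is a prime filtration of
  \<open>k[V]\<close> modulo the monomial ideal of \<open>U\<close>.\<close>

lemma weakly_regular_remove_cones:
  fixes fs :: "('x, 'k::comm_ring_1) mpolynomial list" and w :: "('x \<Rightarrow>\<^sub>0 nat) \<Rightarrow> nat"
  assumes "finite \<Gamma>" and fs: "set fs \<subseteq> polys V" and U: "up_closed V U"
    and cone: "\<And>K. K \<in> \<Gamma> \<Longrightarrow> \<exists>u \<sigma>. keys u \<subseteq> V \<and> finite \<sigma> \<and> K = {u + b | b. keys b \<subseteq> V - \<sigma>} \<and>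
      polys.weakly_regular V (monomial_ideal V {a. 1 \<le> multidegree \<sigma> a}) fs"
    and disj: "\<And>K. K \<in> \<Gamma> \<Longrightarrow> K \<inter> U = {}" "\<And>K K'. K \<in> \<Gamma> \<Longrightarrow> K' \<in> \<Gamma> \<Longrightarrow> K \<noteq> K' \<Longrightarrow> K \<inter> K' = {}"
    and const: "\<And>K a b. K \<in> \<Gamma> \<Longrightarrow> a \<in> K \<Longrightarrow> b \<in> K \<Longrightarrow> w a = w b"
    and mono: "\<And>K K' a b. K \<in> \<Gamma> \<Longrightarrow> K' \<in> \<Gamma> \<Longrightarrow> a \<in> K \<Longrightarrow> keys b \<subseteq> V \<Longrightarrow> a + b \<in> K' \<Longrightarrow> K' = K \<or> w a < w (a + b)"
    and "up_closed V (U \<union> \<Union>\<Gamma>)" "polys.weakly_regular V (monomial_ideal V (U \<union> \<Union>\<Gamma>)) fs"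
  shows "polys.weakly_regular V (monomial_ideal V U) fs"
  using assms
proof (induction "card \<Gamma>" arbitrary: \<Gamma>)
  case 0
  then show ?case by simp
next
  case (Suc k)
  have "\<Gamma> \<noteq> {}" using Suc.hyps(2) by auto
  define W where "W K = w (SOME a. a \<in> K)" for K
  have ne: "\<exists>a. a \<in> K" if K: "K \<in> \<Gamma>" for K
  proof -
    obtain u \<sigma> where "K = {u + b | b. keys b \<subseteq> V - \<sigma>}" using Suc.prems(4)[OF K] by blast
    then have "u + 0 \<in> K" by (metis (mono_tags, lifting) empty_subsetI keys_zero mem_Collect_eq)
    then show ?thesis by blast
  qed
  have W: "w a = W K" if "K \<in> \<Gamma>" "a \<in> K" for K a
    unfolding W_def by (rule Suc.prems(7)[OF that someI_ex[OF ne[OF that(1)]]])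
  \<comment> \<open>A cone of least weight cannot be entered from another cone, since the weight
    would have to grow strictly on the way. So U with the remaining cones is still closed under
    multiplication.\<close>
  obtain K where K: "K \<in> \<Gamma>" and min: "\<And>K'. K' \<in> \<Gamma> \<Longrightarrow> W K \<le> W K'"
    using obtains_MIN[OF Suc.prems(1) \<open>\<Gamma> \<noteq> {}\<close>, of W] Suc.prems(1)
    by (metis Min_le finite_imageI imageI)
  let ?\<Gamma> = "\<Gamma> - {K}"
  have split: "U \<union> \<Union>\<Gamma> = (U \<union> \<Union>?\<Gamma>) \<union> K" using K by blast
  have up: "up_closed V (U \<union> \<Union>?\<Gamma>)"
    unfolding up_closed_def
  proof (intro ballI allI impI)
    fix a b :: "'x \<Rightarrow>\<^sub>0 nat" assume a: "a \<in> U \<union> \<Union>?\<Gamma>" and b: "keys b \<subseteq> V"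
    show "a + b \<in> U \<union> \<Union>?\<Gamma>"
    proof (cases "a \<in> U")
      case True
      then show ?thesis using Suc.prems(3) b by (auto simp: up_closed_def)
    next
      case False
      then obtain K' where K': "K' \<in> \<Gamma>" "K' \<noteq> K" "a \<in> K'" using a by blast
      have "a + b \<in> U \<union> \<Union>\<Gamma>" using Suc.prems(9) a b unfolding up_closed_def by blast
      moreover have "a + b \<notin> K"
      proof
        assume ab: "a + b \<in> K"
        have "w a < w (a + b)" using Suc.prems(8)[OF K'(1) K K'(3) b ab] K'(2) by metis
        then show False using W[OF K'(1,3)] W[OF K ab] min[OF K'(1)] by linarith
      qed
      ultimately show ?thesis by blast
    qed
  qed
  obtain u \<sigma> where u: "keys u \<subseteq> V" "finite \<sigma>" "K = {u + b | b. keys b \<subseteq> V - \<sigma>}"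
    "polys.weakly_regular V (monomial_ideal V {a. 1 \<le> multidegree \<sigma> a}) fs"
    using Suc.prems(4)[OF K] by blast
  have "polys.weakly_regular V (monomial_ideal V (U \<union> \<Union>?\<Gamma>)) fs"
  proof (rule weakly_regular_remove_cone[OF up _ _ u(3,1,2) fs _ u(4)])
    show "up_closed V (U \<union> \<Union>?\<Gamma> \<union> K)" using Suc.prems(9) split by simp
    show "polys.weakly_regular V (monomial_ideal V (U \<union> \<Union>?\<Gamma> \<union> K)) fs" using Suc.prems(10) split by simp
    show "(U \<union> \<Union>?\<Gamma>) \<inter> K = {}" using Suc.prems(5)[OF K] Suc.prems(6)[OF _ K] by blast
  qed
  note regular = this
  show ?case
  proof (rule Suc.hyps(1)[of ?\<Gamma>, OF _ _ fs U])
    show "k = card ?\<Gamma>" using Suc.hyps(2) K Suc.prems(1) by simp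
    show "finite ?\<Gamma>" using Suc.prems(1) by simp
  next
    fix K' assume K': "K' \<in> ?\<Gamma>"
    then have K'\<Gamma>: "K' \<in> \<Gamma>" by simp
    show "\<exists>u \<sigma>. keys u \<subseteq> V \<and> finite \<sigma> \<and> K' = {u + b | b. keys b \<subseteq> V - \<sigma>} \<and>
      polys.weakly_regular V (monomial_ideal V {a. 1 \<le> multidegree \<sigma> a}) fs"
      by (rule Suc.prems(4)[OF K'\<Gamma>])
    show "K' \<inter> U = {}" by (rule Suc.prems(5)[OF K'\<Gamma>])
    show "w a = w b" if "a \<in> K'" "b \<in> K'" for a b by (rule Suc.prems(7)[OF K'\<Gamma> that])
    fix K'' assume "K'' \<in> ?\<Gamma>"
    then have K''\<Gamma>: "K'' \<in> \<Gamma>" by simp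
    show "K' \<inter> K'' = {}" if "K' \<noteq> K''" by (rule Suc.prems(6)[OF K'\<Gamma> K''\<Gamma> that])
    show "K'' = K' \<or> w a < w (a + b)" if "a \<in> K'" "keys b \<subseteq> V" "a + b \<in> K''" for a b
      by (rule Suc.prems(8)[OF K'\<Gamma> K''\<Gamma> that])
  qed (fact up regular)+
qed

text \<open>The invariant Q records that J contains the \<open>y j\<close> with
  \<open>j \<in> G\<close> and is extended from the ring without any given variable outside G, so
  that each further \<open>y j\<close> is regular modulo J. It starts at
  \<open>G = \<sigma>\<close>: without constant term, \<open>y j\<close> is divisible by the
  variable j.\<close>

lemma weakly_regular_esyms_prime:
  fixes y :: "'x \<Rightarrow> ('x, 'k::field) mpolynomial"
  assumes V: "finite V" and \<sigma>: "\<sigma> \<subseteq> V" and d: "card (V - \<sigma>) = d"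
    and y: "\<And>j. j \<in> V \<Longrightarrow> y j \<in> polys {j}" "\<And>j. j \<in> V \<Longrightarrow> y j \<noteq> 0"
      "\<And>j. j \<in> V \<Longrightarrow> lookup (y j) 0 = 0"
  shows "polys.weakly_regular V (monomial_ideal V {a. 1 \<le> multidegree \<sigma> a}) (esyms y V d)"
proof -
  define Q where "Q J G \<longleftrightarrow> polys.ideal_of V J \<and> (\<forall>j\<in>G. y j \<in> J) \<and>
    (\<forall>j\<in>V - G. \<forall>t. \<forall>f\<in>J. slice j t f \<in> J)" for J :: "('x, 'k) mpolynomial set" and G
  have yV: "y j \<in> polys V" if "j \<in> V" for j using y(1)[OF that] polys_mono[of "{j}" V] that by blast
  have fin: "finite \<sigma>" using \<sigma> V finite_subset by blast
  show ?thesis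
  proof (rule polys.weakly_regular_esyms[OF V yV, where Q = Q])
    fix J G j assume QJ: "Q J G" and j: "j \<in> V - G"
    show "polys.nonzerodivisor_mod V J (y j)"
      using QJ j y by (intro nonzerodivisor_univariate) (auto simp: Q_def)
    have J: "polys.ideal_of V J" using QJ by (simp add: Q_def)
    have yj: "y j \<in> polys V" using yV j by blast
    have adj: "polys.ideal_of V (polys.adjoin V J (y j))" by (rule polys.ideal_of_adjoin[OF J yj])
    show "Q (polys.adjoin V J (y j)) (insert j G)"
      unfolding Q_def
    proof (intro conjI ballI allI adj)
      show "y i \<in> polys.adjoin V J (y j)" if "i \<in> insert j G" for i
        using that QJ polys.self_adjoin[OF J, of "y j"] by (auto simp: Q_def intro: polys.subset_adjoin)
      fix i t f assume i: "i \<in> V - insert j G" and f: "f \<in> polys.adjoin V J (y j)"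
      obtain g a where g: "g \<in> J" "a \<in> polys V" "f = g + a * y j" using f by (rule polys.adjoinE)
      \<comment> \<open>The variable i does not occur in \<open>y j\<close>, so slicing in i is
        linear over \<open>y j\<close> and the enlarged ideal stays stable.\<close>
      have "y j \<in> polys (UNIV - {i})" using y(1)[of j] polys_mono[of "{j}" "UNIV - {i}"] i j by auto
      then have "slice i t f = slice i t g + slice i t a * y j"
        unfolding g(3) by (simp add: slice_add slice_mult mult.commute[of _ "y j"])
      moreover have "slice i t g \<in> J" using QJ g(1) i by (simp add: Q_def)
      moreover have "slice i t a \<in> polys V" using slice_mem_polys[OF g(2)] polys_mono[of "V - {i}" V] by blast
      ultimately show "slice i t f \<in> polys.adjoin V J (y j)" by (simp add: polys.adjoinI)
    qed
  next
    let ?P = "monomial_ideal V {a. 1 \<le> multidegree \<sigma> a} :: ('x, 'k) mpolynomial set"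
    show "Q ?P \<sigma>"
      unfolding Q_def
    proof (intro conjI ballI allI)
      show "polys.ideal_of V ?P" by (rule ideal_of_monomial_ideal[OF up_closed_multidegree])
      show "y j \<in> ?P" if j: "j \<in> \<sigma>" for j
      proof -
        have "multidegree \<sigma> a \<noteq> 0" if a: "a \<in> keys (y j)" for a
        proof -
          have "keys a \<subseteq> {j}" using a y(1)[of j] j \<sigma> by (auto simp: polys_def)
          moreover have "a \<noteq> 0" using a y(3)[of j] j \<sigma> by (auto simp: in_keys_iff)
          ultimately have "j \<in> keys a"
            by (metis in_keys_iff lookup_zero poly_mapping_eqI singletonD subsetD)
          then show ?thesis using multidegree_eq_0_iff[OF fin] j by blast
        qed
        then show ?thesis using yV j \<sigma> by (auto simp: monomial_ideal_def Suc_le_eq)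
      qed
      fix j t f assume j: "j \<in> V - \<sigma>" and f: "f \<in> ?P"
      have "1 \<le> multidegree \<sigma> b" if b: "b \<in> keys (slice j t f)" for b
      proof -
        have "1 \<le> multidegree \<sigma> (b + single j t)" using keys_slice[OF b] f by (auto simp: monomial_ideal_def)
        moreover have "multidegree \<sigma> (single j t) = 0" using j fin by (auto simp: multidegree_eq_0_iff)
        ultimately show ?thesis by (simp add: multidegree_add)
      qed
      moreover have "slice j t f \<in> polys V"
        using slice_mem_polys[of f V j t] polys_mono[of "V - {j}" V] f by (auto simp: monomial_ideal_def)
      ultimately show "slice j t f \<in> ?P" by (auto simp: monomial_ideal_def)
    qed
  qed (use d in \<open>auto simp: Q_def\<close>)
qed

section \<open>Steiner systems\<close>

text \<open>Local minimality of the weight implies global minimality, as for the bases of a matroid.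
  The best exchange between \<open>\<sigma>\<close> and \<open>\<tau>\<close> can fail only by
  producing a block; every exchange that shares just one of its two points would then produce a set
  too close to that block to be a block, so none of these may improve either, and this bounds the
  weights against the assumption.\<close>

lemma exists_improving_exchange:
  fixes A :: "nat \<Rightarrow> nat"
  assumes V: "finite V" and C: "C = subsets_of_size V n - B"
    and B: "\<And>\<beta> \<beta>'. \<beta> \<in> B \<Longrightarrow> \<beta>' \<in> B \<Longrightarrow> \<beta> \<noteq> \<beta>' \<Longrightarrow> Suc (card (\<beta> \<inter> \<beta>')) < n"
    and \<sigma>: "\<sigma> \<in> C" and \<tau>: "\<tau> \<in> C" and less: "sum A \<tau> < sum A \<sigma>"
  shows "\<exists>x\<in>\<sigma>. \<exists>y\<in>V - \<sigma>. A y < A x \<and> insert y (\<sigma> - {x}) \<in> C"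
proof (rule ccontr)
  assume none: "\<not> ?thesis"
  have \<sigma>V: "\<sigma> \<subseteq> V" "card \<sigma> = n" and \<tau>V: "\<tau> \<subseteq> V" "card \<tau> = n"
    using \<sigma> \<tau> by (auto simp: C subsets_of_size_def)
  have fin: "finite \<sigma>" "finite \<tau>" using V \<sigma>V \<tau>V finite_subset by auto
  let ?S = "\<sigma> - \<tau>" and ?T = "\<tau> - \<sigma>"
  have split: "sum A \<sigma> = sum A ?S + sum A (\<sigma> \<inter> \<tau>)" "sum A \<tau> = sum A ?T + sum A (\<sigma> \<inter> \<tau>)"
    using fin sum.Int_Diff[of \<sigma> A \<tau>] sum.Int_Diff[of \<tau> A \<sigma>] by (simp_all add: Int_commute)
  have card_eq: "card ?S = card ?T"
    using fin \<sigma>V \<tau>V card_Diff_subset_Int[of \<sigma> \<tau>] card_Diff_subset_Int[of \<tau> \<sigma>] by (simp add: Int_commute)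
  have lessD: "sum A ?T < sum A ?S" using less split by simp
  then have "sum A ?S \<noteq> 0" by linarith
  have neS: "?S \<noteq> {}"
  proof
    assume e: "?S = {}"
    show False using \<open>sum A ?S \<noteq> 0\<close> unfolding e by simp
  qed
  then have "card ?S > 0" using fin by (simp add: card_gt_0_iff)
  then have neT: "?T \<noteq> {}" using card_eq by (metis card.empty less_irrefl)
  have "Max (A ` ?S) \<in> A ` ?S" using neS fin by (intro Max_in) simp_all
  then obtain x where x: "Max (A ` ?S) = A x" "x \<in> ?S" by (rule imageE)
  have xmax: "A x' \<le> A x" if "x' \<in> ?S" for x'
    unfolding x(1)[symmetric] using that fin by (intro Max_ge) simp_all
  note x = x(2)
  have "Min (A ` ?T) \<in> A ` ?T" using neT fin by (intro Min_in) simp_all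
  then obtain y where y: "Min (A ` ?T) = A y" "y \<in> ?T" by (rule imageE)
  have ymin: "A y \<le> A y'" if "y' \<in> ?T" for y'
    unfolding y(1)[symmetric] using that fin by (intro Min_le) simp_all
  note y = y(2)
  let ?r = "card ?S"
  \<comment> \<open>Averaging: the differences have the same size and that of \<open>\<tau>\<close>
    weighs less, so its lightest point is lighter than the heaviest point of the other.\<close>
  have "?r * A y \<le> sum A ?T" using sum_bounded_below[of ?T "A y" A] ymin card_eq by simp
  also have "\<dots> < sum A ?S" by (rule lessD)
  also have "\<dots> \<le> ?r * A x" using sum_bounded_above[of ?S A "A x"] xmax by simp
  finally have yx: "A y < A x" by simp
  have swap: "insert q (\<sigma> - {p}) \<in> subsets_of_size V n" if "p \<in> \<sigma>" "q \<in> V - \<sigma>" for p q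
  proof -
    have "card (insert q (\<sigma> - {p})) = Suc (card (\<sigma> - {p}))" using that fin by simp
    also have "\<dots> = card \<sigma>" by (rule card.remove[symmetric, OF fin(1) that(1)])
    finally show ?thesis using that \<sigma>V by (auto simp: subsets_of_size_def)
  qed
  have n_pos: "n > 0" using x \<sigma>V fin by (auto simp: card_gt_0_iff)
  have xy: "x \<in> \<sigma>" "y \<in> V - \<sigma>" using x y \<tau>V by auto
  then have block: "insert y (\<sigma> - {x}) \<in> B" using none yx swap[of x y] by (auto simp: C)
  \<comment> \<open>An exchange sharing exactly one of x and y yields a set that meets the block in
    at least n - 1 points without being equal to it. Two distinct blocks never do this, so the set
    belongs to C and cannot improve on \<open>\<sigma>\<close>.\<close>
  have le: "A p \<le> A q" if pq: "p \<in> \<sigma>" "q \<in> V - \<sigma>" "(p = x) \<noteq> (q = y)" for p q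
  proof (rule ccontr)
    assume "\<not> A p \<le> A q"
    then have "insert q (\<sigma> - {p}) \<in> B" using none pq swap[of p q] by (auto simp: C)
    moreover have "insert q (\<sigma> - {p}) \<noteq> insert y (\<sigma> - {x})"
    proof
      assume eq: "insert q (\<sigma> - {p}) = insert y (\<sigma> - {x})"
      show False
      proof (cases "p = x")
        case True
        have "q \<in> insert y (\<sigma> - {x})" unfolding eq[symmetric] by simp
        then show False using True pq by simp
      next
        case False
        have "x \<in> insert y (\<sigma> - {x})" unfolding eq[symmetric] using False xy(1) by simp
        then show False using xy by auto
      qed
    qed
    ultimately have "Suc (card (insert q (\<sigma> - {p}) \<inter> insert y (\<sigma> - {x}))) < n" using B block by blast
    moreover have "n - 1 \<le> card (insert q (\<sigma> - {p}) \<inter> insert y (\<sigma> - {x}))"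
    proof (cases "p = x")
      case True
      then have "\<sigma> - {x} \<subseteq> insert q (\<sigma> - {p}) \<inter> insert y (\<sigma> - {x})" by blast
      then show ?thesis using card_mono[of _ "\<sigma> - {x}"] fin \<sigma>V xy by (metis card_Diff_singleton finite_Diff finite_Int finite_insert)
    next
      case False
      then have q: "q = y" using pq by blast
      have "insert y (\<sigma> - {p, x}) \<subseteq> insert q (\<sigma> - {p}) \<inter> insert y (\<sigma> - {x})" using q by blast
      moreover have "card (insert y (\<sigma> - {p, x})) = Suc (n - 2)"
      proof -
        have "card (\<sigma> - {p, x}) = card \<sigma> - card {p, x}"
          using pq xy by (intro card_Diff_subset) auto
        then show ?thesis using fin xy \<sigma>V False by auto
      qed
      ultimately have "Suc (n - 2) \<le> card (insert q (\<sigma> - {p}) \<inter> insert y (\<sigma> - {x}))"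
        using fin(1) card_mono[of "insert q (\<sigma> - {p}) \<inter> insert y (\<sigma> - {x})" "insert y (\<sigma> - {p, x})"]
        by (metis finite_Diff finite_Int finite_insert)
      then show ?thesis by simp
    qed
    ultimately show False using n_pos by linarith
  qed
  \<comment> \<open>If the two sets differed by one point each, the block would be
    \<open>\<tau>\<close> itself.\<close>
  have "?r \<noteq> 1"
  proof
    assume "?r = 1"
    then obtain p q where "?S = {p}" "?T = {q}" using card_eq by (auto simp: card_1_singleton_iff)
    then have S: "{x} = ?S" and T: "{y} = ?T" using x y by auto
    have "insert y (\<sigma> - {x}) = {y} \<union> (\<sigma> - {x})" by simp
    also have "\<dots> = ?T \<union> (\<sigma> - ?S)" by (simp only: S T)
    also have "\<dots> = \<tau>" by auto
    finally have "insert y (\<sigma> - {x}) = \<tau>" .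
    then show False using block \<tau> by (simp add: C)
  qed
  \<comment> \<open>Apart from x and y, points of \<open>\<sigma> - \<tau>\<close> weigh at most
    \<open>A y\<close> and points of \<open>\<tau> - \<sigma>\<close> at least \<open>A x\<close>.
    With r at least 2 and \<open>A y < A x\<close> the second sum cannot be the smaller one.\<close>
  then have "2 \<le> ?r" using \<open>card ?S > 0\<close> by linarith
  then obtain k where "?r = 2 + k" by (auto dest: le_Suc_ex)
  then have k: "?r = Suc (Suc k)" by simp
  have "sum A ?S = A x + sum A (?S - {x})" by (rule sum.remove) (use x fin in simp_all)
  also have "sum A (?S - {x}) \<le> card (?S - {x}) * A y"
    using sum_bounded_above[of "?S - {x}" A "A y"] le xy by auto
  also have "card (?S - {x}) = Suc k" using k x fin by simp
  finally have S: "sum A ?S \<le> A x + Suc k * A y" by simp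
  have "card (?T - {y}) = Suc k" using k card_eq y fin by simp
  moreover have "card (?T - {y}) * A x \<le> sum A (?T - {y})"
    using sum_bounded_below[of "?T - {y}" "A x" A] le xy \<tau>V by auto
  moreover have "sum A ?T = A y + sum A (?T - {y})" by (rule sum.remove) (use y fin in simp_all)
  ultimately have "A y + Suc k * A x \<le> sum A ?T" by simp
  moreover have "k * A y \<le> k * A x" using yx by simp
  ultimately show False using S lessD unfolding mult_Suc by linarith
qed

text \<open>As t is at most n - 1, two blocks sharing n - 1 points would share a t-subset, against
  its unique block.\<close>

lemma steiner_blocks_meet:
  assumes st: "steiner_system V B t n v" and "t < n"
    and \<beta>: "\<beta> \<in> B" "\<beta>' \<in> B" "\<beta> \<noteq> \<beta>'"
  shows "Suc (card (\<beta> \<inter> \<beta>')) < n"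
proof (rule ccontr)
  assume "\<not> ?thesis"
  then have "t \<le> card (\<beta> \<inter> \<beta>')" using \<open>t < n\<close> by simp
  then obtain \<tau> where "\<tau> \<subseteq> \<beta> \<inter> \<beta>'" "card \<tau> = t" by (meson obtain_subset_with_card_n)
  moreover have "\<beta> \<subseteq> V" using st \<beta> by (auto simp: steiner_system_def subsets_of_size_def)
  ultimately have "\<tau> \<in> subsets_of_size V t" "\<tau> \<subseteq> \<beta>" "\<tau> \<subseteq> \<beta>'"
    by (auto simp: subsets_of_size_def)
  then show False using st \<beta> unfolding steiner_system_def by blast
qed

text \<open>The weight of \<open>\<sigma>\<close> at \<open>a\<close>: the degree in the variables of \<open>\<sigma>\<close>, with ties broken by \<open>\<sigma>\<close> itself.\<close>

definition weight :: "nat \<Rightarrow> (nat \<Rightarrow>\<^sub>0 nat) \<Rightarrow> nat set \<Rightarrow> nat" where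
  "weight N a \<sigma> = (\<Sum>i\<in>\<sigma>. lookup a i * 2 ^ N + 2 ^ i)"

text \<open>A two-digit expansion in base \<open>2 ^ N\<close>: for
  \<open>\<sigma> \<subseteq> {..<N}\<close> the code of \<open>\<sigma>\<close> is the remainder
  and the degree is the quotient. Hence distinct sets have distinct weights, and a set of least
  weight also has least degree.\<close>

lemma weight_eq: "weight N a \<sigma> = multidegree \<sigma> a * 2 ^ N + set_encode \<sigma>"
  by (simp add: weight_def multidegree_def set_encode_def sum.distrib sum_distrib_right)

lemma weight_add: "weight N (a + b) \<sigma> = weight N a \<sigma> + multidegree \<sigma> b * 2 ^ N"
  by (simp add: weight_eq multidegree_add distrib_right)

lemma set_encode_less: "\<sigma> \<subseteq> {..<N} \<Longrightarrow> set_encode \<sigma> < 2 ^ N"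
proof -
  assume "\<sigma> \<subseteq> {..<N}"
  then have "set_encode \<sigma> \<le> (\<Sum>i<N. 2 ^ i)"
    unfolding set_encode_def by (intro sum_mono2) auto
  also have "\<dots> < 2 ^ N" by (simp add: sum_power2 flip: atLeast0LessThan)
  finally show ?thesis .
qed

lemma weight_inj:
  assumes "\<sigma> \<subseteq> {..<N}" "\<tau> \<subseteq> {..<N}" "weight N a \<sigma> = weight N a \<tau>"
  shows "\<sigma> = \<tau>"
proof -
  have "weight N a \<sigma> mod 2 ^ N = set_encode \<sigma>" "weight N a \<tau> mod 2 ^ N = set_encode \<tau>"
    using set_encode_less assms(1,2) by (simp_all add: weight_eq)
  then have "set_encode \<sigma> = set_encode \<tau>" using assms(3) by simp
  moreover have "finite \<sigma>" "finite \<tau>" using assms(1,2) finite_subset by blast+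
  ultimately show ?thesis by (simp add: set_encode_eq)
qed

lemma multidegree_le_if_weight_le:
  assumes "\<sigma> \<subseteq> {..<N}" "\<tau> \<subseteq> {..<N}" "weight N a \<sigma> \<le> weight N a \<tau>"
  shows "multidegree \<sigma> a \<le> multidegree \<tau> a"
proof -
  have "weight N a \<sigma> div 2 ^ N = multidegree \<sigma> a" "weight N a \<tau> div 2 ^ N = multidegree \<tau> a"
    using set_encode_less assms(1,2) by (simp_all add: weight_eq)
  then show ?thesis using div_le_mono[OF assms(3), of "2 ^ N"] by simp
qed

text \<open>Every exponent outside \<open>U\<close> is sorted into a cone according to the \<open>\<sigma> \<in> C\<close> of least weight
  and its restriction to \<open>\<sigma>\<close>. That the classes are orthants is the place where the Steiner property enters,
  through the equivalence of local and global minimality of \<open>\<sigma>\<close>.\<close>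

lemma weakly_regular_steiner:
  fixes V :: "nat set" and fs :: "(nat, 'k::comm_ring_1) mpolynomial list"
  assumes V: "finite V" and C: "C = subsets_of_size V n - B"
    and B: "\<And>\<beta> \<beta>'. \<beta> \<in> B \<Longrightarrow> \<beta>' \<in> B \<Longrightarrow> \<beta> \<noteq> \<beta>' \<Longrightarrow> Suc (card (\<beta> \<inter> \<beta>')) < n"
    and fs: "set fs \<subseteq> polys V"
    and prime: "\<And>\<sigma>. \<sigma> \<in> C \<Longrightarrow> polys.weakly_regular V (monomial_ideal V {a. 1 \<le> multidegree \<sigma> a}) fs"
  shows "polys.weakly_regular V (monomial_ideal V {a. keys a \<subseteq> V \<and> (\<forall>\<sigma>\<in>C. m \<le> multidegree \<sigma> a)}) fs"
proof -
  obtain N where N: "V \<subseteq> {..<N}" using finite_nat_bounded[OF V] by blast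
  let ?W = "weight N"
  define U where "U = {a. keys a \<subseteq> V \<and> (\<forall>\<sigma>\<in>C. m \<le> multidegree \<sigma> a)}"
  have CV: "\<sigma> \<subseteq> V" if "\<sigma> \<in> C" for \<sigma> using that by (auto simp: C subsets_of_size_def)
  have CN: "\<sigma> \<subseteq> {..<N}" if "\<sigma> \<in> C" for \<sigma> using CV[OF that] N by blast
  have finC: "finite C" using V CV by (intro finite_subset[of C "Pow V"]) auto
  have finS: "finite \<sigma>" if "\<sigma> \<in> C" for \<sigma> using CV[OF that] V finite_subset by blast
  define sel where "sel a = arg_min_on (?W a) C" for a
  define S where "S = {a. keys a \<subseteq> V} - U"
  have C_ne: "C \<noteq> {}" if "a \<in> S" for a using that by (auto simp: S_def U_def)
  have sel_in: "sel a \<in> C" if "C \<noteq> {}" for a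
    unfolding sel_def by (rule arg_min_if_finite(1)[OF finC that])
  have sel_le: "?W a (sel a) \<le> ?W a \<sigma>" if "C \<noteq> {}" "\<sigma> \<in> C" for a \<sigma>
    unfolding sel_def by (rule arg_min_least[OF finC that])
  have sel_eq: "sel a = \<sigma>" if "\<sigma> \<in> C" "\<And>\<tau>. \<tau> \<in> C \<Longrightarrow> ?W a \<sigma> \<le> ?W a \<tau>" for a \<sigma>
  proof -
    have ne: "C \<noteq> {}" using that by blast
    have "?W a (sel a) = ?W a \<sigma>" using that sel_in[OF ne, of a] sel_le[OF ne, where a = a] by (intro order.antisym) auto
    then show ?thesis using weight_inj CN sel_in[OF ne] that(1) by blast
  qed
  define w where "w a = ?W a (sel a)" for a
  define cls where "cls a = {b. keys b \<subseteq> V \<and> sel b = sel a \<and> (\<forall>i\<in>sel a. lookup b i = lookup a i)}" for a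
  have cls_eq: "cls b = cls a" if "b \<in> cls a" for a b using that by (auto simp: cls_def)
  have deg_cong: "multidegree \<sigma> a = multidegree \<sigma> b" if "\<forall>i\<in>\<sigma>. lookup a i = lookup b i" for \<sigma> a b
    using that by (simp add: multidegree_def)
  have S_iff: "a \<in> S \<longleftrightarrow> keys a \<subseteq> V \<and> C \<noteq> {} \<and> multidegree (sel a) a < m" for a
  proof
    assume a: "a \<in> S"
    then obtain \<sigma> where \<sigma>: "\<sigma> \<in> C" "multidegree \<sigma> a < m" by (auto simp: S_def U_def not_le)
    then have "multidegree (sel a) a \<le> multidegree \<sigma> a"
      using sel_in[OF C_ne[OF a]] sel_le[OF C_ne[OF a]] CN by (intro multidegree_le_if_weight_le[of _ N]) auto
    then show "keys a \<subseteq> V \<and> C \<noteq> {} \<and> multidegree (sel a) a < m" using \<sigma> a by (auto simp: S_def)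
  next
    assume a: "keys a \<subseteq> V \<and> C \<noteq> {} \<and> multidegree (sel a) a < m"
    then show "a \<in> S" using sel_in[of a] by (auto simp: S_def U_def not_le)
  qed
  have cls_S: "cls a \<subseteq> S" if "a \<in> S" for a
  proof
    fix b assume b: "b \<in> cls a"
    then have "multidegree (sel b) b = multidegree (sel a) a" by (auto simp: cls_def intro: deg_cong)
    then show "b \<in> S" using that b unfolding S_iff by (simp add: cls_def)
  qed
  have orthant: "\<exists>u. keys u \<subseteq> V \<and> cls a = {u + b | b. keys b \<subseteq> V - sel a}" if a: "a \<in> S" for a
  proof -
    note ne = C_ne[OF a]
    let ?\<sigma> = "sel a"
    have \<sigma>: "?\<sigma> \<in> C" by (rule sel_in[OF ne])
    have aa: "a \<in> cls a" using a by (simp add: cls_def S_iff)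
    \<comment> \<open>The apex of the cone is the coordinatewise minimum of the class. Different
      coordinates may reach their minimum at different members, so it is not evident that the apex
      belongs to the class.\<close>
    define l where "l i = (LEAST x. \<exists>b\<in>cls a. lookup b i = x)" for i
    have l_ex: "\<exists>b\<in>cls a. lookup b i = l i" for i
      unfolding l_def by (rule LeastI_ex) (use aa in blast)
    have l_le: "l i \<le> lookup b i" if "b \<in> cls a" for b i
      unfolding l_def by (rule Least_le) (use that in blast)
    have l0: "l i = 0" if "i \<notin> V" for i
    proof -
      have "i \<notin> keys a" using that aa by (auto simp: cls_def)
      then show ?thesis using l_le[OF aa, of i] by (simp add: in_keys_iff)
    qed
    have lV: "{i. l i \<noteq> 0} \<subseteq> V" by (rule subsetI, rule ccontr) (simp add: l0)
    then have "finite {i. l i \<noteq> 0}" using V by (rule finite_subset)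
    then have u_lookup: "lookup (Abs_poly_mapping l) i = l i" for i by simp
    define u where "u = Abs_poly_mapping l"
    have u: "lookup u i = l i" for i using u_lookup by (simp add: u_def)
    have uV: "keys u \<subseteq> V" using lV by (simp add: subset_iff in_keys_iff u)
    have l_sel: "l i = lookup a i" if "i \<in> ?\<sigma>" for i
      using l_ex[of i] that by (auto simp: cls_def)
    have "u + b \<in> cls a" if b: "keys b \<subseteq> V - ?\<sigma>" for b
    proof -
      have b0: "lookup b i = 0" if "i \<in> ?\<sigma>" for i using b that by (auto simp: in_keys_iff)
      have "sel (u + b) = ?\<sigma>"
      proof (rule sel_eq[OF \<sigma>], rule ccontr)
        fix \<tau> assume \<tau>: "\<tau> \<in> C" and "\<not> ?W (u + b) ?\<sigma> \<le> ?W (u + b) \<tau>"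
        then have less: "?W (u + b) \<tau> < ?W (u + b) ?\<sigma>" by simp
        define A where "A c i = lookup c i * 2 ^ N + 2 ^ i" for c :: "nat \<Rightarrow>\<^sub>0 nat" and i
        have W: "?W c \<rho> = sum (A c) \<rho>" for c \<rho> by (simp add: weight_def A_def)
        obtain x y where xy: "x \<in> ?\<sigma>" "y \<in> V - ?\<sigma>" "A (u + b) y < A (u + b) x" "insert y (?\<sigma> - {x}) \<in> C"
          using exists_improving_exchange[OF V C B \<sigma> \<tau> less[unfolded W]] by blast
        \<comment> \<open>The exchange involves a single point y outside \<open>sel a\<close>, so
          one member with the least y-coordinate is enough as a witness: \<open>sel a\<close> is
          minimal at c, the x-coordinate agrees with that of \<open>u + b\<close>, and the
          y-coordinate is no larger.\<close>
        obtain c where c: "c \<in> cls a" "lookup c y = l y" using l_ex by blast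
        then have selc: "sel c = ?\<sigma>" and cx: "lookup c x = lookup a x" using xy(1) by (auto simp: cls_def)
        have "?W c ?\<sigma> \<le> ?W c (insert y (?\<sigma> - {x}))" using sel_le[OF ne xy(4), where a = c] selc by simp
        moreover have "?W c ?\<sigma> = A c x + sum (A c) (?\<sigma> - {x})"
          unfolding W using xy(1) finS[OF \<sigma>] by (simp add: sum.remove)
        moreover have "?W c (insert y (?\<sigma> - {x})) = A c y + sum (A c) (?\<sigma> - {x})"
          unfolding W using xy(2) finS[OF \<sigma>] by simp
        ultimately have "A c x \<le> A c y" by simp
        moreover have "A c y \<le> A (u + b) y" using c(2) by (simp add: A_def lookup_add u)
        moreover have "A (u + b) x = A c x"
          using xy(1) b0 cx by (simp add: A_def lookup_add u l_sel)
        ultimately show False using xy(3) by simp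
      qed
      then show ?thesis using uV b b0 by (auto simp: cls_def keys_exponent_add lookup_add u l_sel)
    qed
    moreover have "\<exists>b. c = u + b \<and> keys b \<subseteq> V - ?\<sigma>" if c: "c \<in> cls a" for c
    proof (intro exI conjI)
      show "c = u + (c - u)" by (rule exponent_add_diff[symmetric]) (simp add: u l_le[OF c])
      have "lookup (c - u) i = 0" if "i \<notin> V - ?\<sigma>" for i
      proof (cases "i \<in> ?\<sigma>")
        case True
        then show ?thesis using c by (simp add: lookup_exponent_diff u l_sel cls_def)
      next
        case False
        then have "i \<notin> keys c" using that c by (auto simp: cls_def)
        then show ?thesis by (simp add: lookup_exponent_diff in_keys_iff)
      qed
      then show "keys (c - u) \<subseteq> V - ?\<sigma>" by (auto simp: in_keys_iff)
    qed
    ultimately have "cls a = {u + b | b. keys b \<subseteq> V - ?\<sigma>}" by blast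
    then show ?thesis using uV by blast
  qed
  have finG: "finite (cls ` S)"
  proof -
    \<comment> \<open>A class is determined by the minimizer and the exponents on it, and outside U
      these exponents are below m.\<close>
    define T where "T = C \<times> {f. \<forall>x. (x \<in> V \<longrightarrow> f x \<in> {..m}) \<and> (x \<notin> V \<longrightarrow> f x = (0::nat))}"
    define D where "D p = {b. keys b \<subseteq> V \<and> sel b = fst p \<and> (\<forall>i\<in>fst p. lookup b i = snd p i)}" for p
    have "finite T" unfolding T_def using finC finite_set_of_finite_funs[OF V finite_atMost] by blast
    moreover have "cls ` S \<subseteq> D ` T"
    proof (rule image_subsetI)
      fix a assume a: "a \<in> S"
      note \<sigma> = sel_in[OF C_ne[OF a], of a]
      let ?f = "\<lambda>i. if i \<in> sel a then lookup a i else 0"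
      have "lookup a i \<le> m" if "i \<in> sel a" for i
      proof -
        have "lookup a i \<le> multidegree (sel a) a"
          unfolding multidegree_def using that finS[OF \<sigma>] by (intro member_le_sum) auto
        then show ?thesis using a by (simp add: S_iff)
      qed
      then have "(sel a, ?f) \<in> T" using \<sigma> CV[OF \<sigma>] by (auto simp: T_def)
      moreover have "cls a = D (sel a, ?f)" by (simp add: cls_def D_def)
      ultimately show "cls a \<in> D ` T" by blast
    qed
    ultimately show ?thesis using finite_subset by blast
  qed
  \<comment> \<open>Multiplying by a monomial never lowers the least weight. If it stays the same,
    the minimizer is the same and no variable of it occurs in the factor, so the class does not
    change.\<close>
  have mono: "w a \<le> w (a + b)" "w (a + b) = w a \<Longrightarrow> keys b \<subseteq> V \<Longrightarrow> a + b \<in> cls a"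
    if "a \<in> S" for a b
  proof -
    note ne = C_ne[OF that]
    have 1: "w a \<le> ?W a (sel (a + b))" unfolding w_def by (rule sel_le[OF ne sel_in[OF ne]])
    have 2: "w (a + b) = ?W a (sel (a + b)) + multidegree (sel (a + b)) b * 2 ^ N"
      unfolding w_def by (rule weight_add)
    show "w a \<le> w (a + b)" using 1 2 by simp
    assume eq: "w (a + b) = w a" and b: "keys b \<subseteq> V"
    have "?W a (sel (a + b)) = ?W a (sel a)" using 1 2 eq by (simp add: w_def)
    then have s: "sel (a + b) = sel a" using weight_inj CN sel_in[OF ne] by blast
    have "multidegree (sel a) b = 0" using 1 2 eq unfolding s by simp
    then have "lookup b i = 0" if "i \<in> sel a" for i
      using that finS[OF sel_in[OF ne]] by (simp add: multidegree_def)
    then show "a + b \<in> cls a" using s b \<open>a \<in> S\<close> by (auto simp: cls_def S_iff keys_exponent_add lookup_add)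
  qed
  have S_cls: "a \<in> cls a" if "a \<in> S" for a using that by (simp add: cls_def S_iff)
  have union: "U \<union> \<Union>(cls ` S) = {a. keys a \<subseteq> V}"
  proof -
    have "\<Union>(cls ` S) = S" using cls_S S_cls by blast
    then show ?thesis by (auto simp: S_def U_def)
  qed
  have "polys.weakly_regular V (monomial_ideal V U) fs"
  proof (rule weakly_regular_remove_cones[OF finG fs, where w = w])
    show "up_closed V U"
      by (auto simp: up_closed_def U_def keys_exponent_add multidegree_add trans_le_add1)
    show "\<exists>u \<sigma>. keys u \<subseteq> V \<and> finite \<sigma> \<and> K = {u + b | b. keys b \<subseteq> V - \<sigma>} \<and>
      polys.weakly_regular V (monomial_ideal V {a. 1 \<le> multidegree \<sigma> a}) fs" if K: "K \<in> cls ` S" for K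
    proof -
      obtain a where a: "a \<in> S" "K = cls a" using K by blast
      note \<sigma> = sel_in[OF C_ne[OF a(1)], of a]
      show ?thesis using orthant[OF a(1)] finS[OF \<sigma>] prime[OF \<sigma>] a(2) by blast
    qed
    show "K \<inter> U = {}" if "K \<in> cls ` S" for K
      using that cls_S by (auto simp: S_def)
    show "K \<inter> K' = {}" if "K \<in> cls ` S" "K' \<in> cls ` S" "K \<noteq> K'" for K K'
      using that cls_eq by blast
    show "w a = w b" if K: "K \<in> cls ` S" and "a \<in> K" "b \<in> K" for K a b
    proof -
      obtain c where c: "K = cls c" using K by blast
      have "w a = w c" if "a \<in> cls c" for a
      proof -
        have "sel a = sel c" "multidegree (sel c) a = multidegree (sel c) c"
          using that by (auto simp: cls_def intro: deg_cong)
        then show ?thesis by (simp add: w_def weight_eq)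
      qed
      then show ?thesis using c \<open>a \<in> K\<close> \<open>b \<in> K\<close> by metis
    qed
    show "K' = K \<or> w a < w (a + b)"
      if K: "K \<in> cls ` S" "K' \<in> cls ` S" and a: "a \<in> K" and b: "keys b \<subseteq> V" and ab: "a + b \<in> K'" for K K' a b
    proof -
      have aS: "a \<in> S" using K(1) a cls_S by blast
      have "cls a = K" using K(1) a cls_eq by blast
      moreover have "cls (a + b) = K'" using K(2) ab cls_eq by blast
      moreover have "cls (a + b) = cls a" if "w (a + b) = w a"
        by (rule cls_eq[OF mono(2)[OF aS that b]])
      ultimately show ?thesis using mono(1)[OF aS, of b] by (cases "w (a + b) = w a") auto
    qed
    show "up_closed V (U \<union> \<Union>(cls ` S))"
      unfolding union by (auto simp: up_closed_def keys_exponent_add)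
    have "monomial_ideal V {a. keys a \<subseteq> V} = (polys V :: (nat, 'k) mpolynomial set)"
      by (auto simp: monomial_ideal_def polys_def)
    then show "polys.weakly_regular V (monomial_ideal V (U \<union> \<Union>(cls ` S))) fs"
      unfolding union using polys.weakly_regular_whole[OF fs] by simp
  qed
  then show ?thesis by (simp add: U_def)
qed

section \<open>Dickson's lemma and the basis theorem\<close>

text \<open>Indices whose value is at most every later value occur beyond any bound; their
  enumeration is the subsequence.\<close>

lemma nat_seq_mono_subseq:
  fixes s :: "nat \<Rightarrow> nat"
  shows "\<exists>r :: nat \<Rightarrow> nat. strict_mono r \<and> (\<forall>m n. m \<le> n \<longrightarrow> s (r m) \<le> s (r n))"
proof -
  let ?S = "{n. \<forall>m\<ge>n. s n \<le> s m}"
  have inf: "infinite ?S"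
    unfolding infinite_nat_iff_unbounded_le
  proof
    fix N
    obtain n where "n \<ge> N" "\<And>m. m \<ge> N \<Longrightarrow> s n \<le> s m"
      using ex_has_least_nat[of "\<lambda>n. N \<le> n" N s] by auto
    then show "\<exists>n\<ge>N. n \<in> ?S" by (intro exI[of _ n]) auto
  qed
  have mono: "strict_mono (enumerate ?S)" using inf by (rule strict_mono_enumerate)
  have "s (enumerate ?S m) \<le> s (enumerate ?S n)" if "m \<le> n" for m n
    using enumerate_in_set[OF inf, of m] strict_mono_less_eq[OF mono] that by auto
  with mono show ?thesis by blast
qed

lemma dickson_subseq:
  fixes s :: "nat \<Rightarrow> 'x \<Rightarrow> nat"
  assumes "finite V"
  shows "\<exists>r :: nat \<Rightarrow> nat. strict_mono r \<and> (\<forall>i\<in>V. \<forall>m n. m \<le> n \<longrightarrow> s (r m) i \<le> s (r n) i)"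
  using assms
proof induction
  case empty
  show ?case by (intro exI[of _ id]) (simp add: strict_mono_def)
next
  case (insert j V)
  then obtain r :: "nat \<Rightarrow> nat" where r: "strict_mono r" "\<And>i m n. i \<in> V \<Longrightarrow> m \<le> n \<Longrightarrow> s (r m) i \<le> s (r n) i" by blast
  obtain q :: "nat \<Rightarrow> nat" where q: "strict_mono q" "\<And>m n. m \<le> n \<Longrightarrow> s (r (q m)) j \<le> s (r (q n)) j"
    using nat_seq_mono_subseq[of "\<lambda>n. s (r n) j"] by blast
  have "strict_mono (r \<circ> q)" using r(1) q(1) by (rule strict_mono_o)
  moreover have "s ((r \<circ> q) m) i \<le> s ((r \<circ> q) n) i" if "i \<in> insert j V" "m \<le> n" for i m n
    using that r(2)[of i "q m" "q n"] q(2)[of m n] strict_mono_less_eq[OF q(1)] by auto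
  ultimately show ?case by blast
qed

text \<open>Otherwise exponents could be chosen forever, none divisible by an earlier one; a
  subsequence that is nondecreasing in every coordinate contradicts this at its first two
  members.\<close>

lemma dickson:
  fixes S :: "('x \<Rightarrow>\<^sub>0 nat) set"
  assumes V: "finite V" and S: "\<And>a. a \<in> S \<Longrightarrow> keys a \<subseteq> V"
  shows "\<exists>B\<subseteq>S. finite B \<and> (\<forall>a\<in>S. \<exists>b\<in>B. \<exists>c. a = b + c)"
proof (rule ccontr)
  assume no: "\<not> ?thesis"
  have ex: "\<exists>a. a \<in> S \<and> (\<forall>b\<in>B. \<forall>c. a \<noteq> b + c)" if "finite B" "B \<subseteq> S" for B
  proof (rule ccontr)
    assume "\<not> ?thesis"
    then have "\<forall>a\<in>S. \<exists>b\<in>B. \<exists>c. a = b + c" by simp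
    with that have "\<exists>B\<subseteq>S. finite B \<and> (\<forall>a\<in>S. \<exists>b\<in>B. \<exists>c. a = b + c)" by (intro exI[of _ B] conjI)
    with no show False by (rule notE)
  qed
  define g where "g B = (SOME a. a \<in> S \<and> (\<forall>b\<in>B. \<forall>c. a \<noteq> b + c))" for B
  have g_ex: "g B \<in> S \<and> (\<forall>b\<in>B. \<forall>c. g B \<noteq> b + c)" if "finite B" "B \<subseteq> S" for B
    unfolding g_def by (rule someI_ex[OF ex[OF that]])
  have g: "finite B \<Longrightarrow> B \<subseteq> S \<Longrightarrow> g B \<in> S"
    "finite B \<Longrightarrow> B \<subseteq> S \<Longrightarrow> b \<in> B \<Longrightarrow> g B \<noteq> b + c" for B b c
    using g_ex[of B] by auto
  define F where "F = rec_nat {} (\<lambda>_ B. insert (g B) B)"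
  have F_Suc: "F (Suc n) = insert (g (F n)) (F n)" and F_0: "F 0 = {}" for n by (simp_all add: F_def)
  have F: "finite (F n) \<and> F n \<subseteq> S" for n
    by (induction n) (use g(1) in \<open>simp_all add: F_Suc F_0\<close>)
  have mem: "g (F m) \<in> F n" if "m < n" for m n
    using that by (induction n) (auto simp: F_Suc less_Suc_eq)
  obtain r :: "nat \<Rightarrow> nat" where r: "strict_mono r" "\<And>i m n. i \<in> V \<Longrightarrow> m \<le> n \<Longrightarrow> lookup (g (F (r m))) i \<le> lookup (g (F (r n))) i"
    using dickson_subseq[OF V, of "\<lambda>n. lookup (g (F n))"] by blast
  let ?a = "g (F (r 0))" and ?b = "g (F (r 1))"
  have "lookup ?a i \<le> lookup ?b i" for i
  proof (cases "i \<in> V")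
    case True
    then show ?thesis using r(2) by simp
  next
    case False
    then have "i \<notin> keys ?a" using S g(1) F by blast
    then show ?thesis by (simp add: in_keys_iff)
  qed
  then have "?b = ?a + (?b - ?a)" by (rule exponent_add_diff[symmetric])
  moreover have "?a \<in> F (r 1)" using mem strict_mono_less[OF r(1)] by simp
  ultimately show False using g(2) F by blast
qed

text \<open>With this the lexicographic order on exponents is a monomial order: linear, compatible
  with addition, and with least element 0.\<close>

lemma exponent_nonneg: "0 \<le> (b :: 'x::linorder \<Rightarrow>\<^sub>0 nat)"
proof -
  have "\<not> b < 0"
  proof
    assume "b < 0"
    then have "less_fun (lookup b) (lookup 0)" by (simp only: less_poly_mapping.rep_eq)
    then show False by (rule less_funE) simp
  qed
  then show ?thesis by simp
qed

text \<open>The least member of a finite Dickson basis lies below all multiples of the basis. So the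
  order is a well-order on the exponents over finitely many variables.\<close>

lemma exponent_set_has_least:
  fixes S :: "('x::linorder \<Rightarrow>\<^sub>0 nat) set"
  assumes V: "finite V" and S: "\<And>a. a \<in> S \<Longrightarrow> keys a \<subseteq> V" and "S \<noteq> {}"
  shows "\<exists>m\<in>S. \<forall>a\<in>S. m \<le> a"
proof -
  from dickson[OF V S] obtain B where "B \<subseteq> S \<and> finite B \<and> (\<forall>a\<in>S. \<exists>b\<in>B. \<exists>c. a = b + c)" ..
  then have B: "B \<subseteq> S" "finite B" "\<And>a. a \<in> S \<Longrightarrow> \<exists>b\<in>B. \<exists>c. a = b + c" by simp_all
  have "B \<noteq> {}" using B(3) assms(3) by blast
  have "Min B \<le> a" if a: "a \<in> S" for a
  proof -
    obtain b c where b: "b \<in> B" "a = b + c" using B(3)[OF a] by blast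
    have "Min B \<le> b" using b B(2) by simp
    also have "b \<le> b + c" using add_left_mono[OF exponent_nonneg[of c], of b] by simp
    finally show ?thesis using b by simp
  qed
  moreover have "Min B \<in> S" using B Min_in[OF B(2) \<open>B \<noteq> {}\<close>] by blast
  ultimately show ?thesis by (intro bexI[of _ "Min B"] ballI)
qed

text \<open>Elements whose leading exponents form a Dickson basis generate the ideal: an element
  outside their span with least leading exponent could have its leading term cancelled.\<close>

lemma noetherian_mpoly_ring:
  fixes V :: "'x::linorder set"
  assumes V: "finite V"
  shows "noetherian_ring (mpoly_ring V :: ('x, 'k::field) mpolynomial ring)"
proof -
  let ?R = "mpoly_ring V :: ('x, 'k) mpolynomial ring"
  interpret R: cring ?R by (rule cring_mpoly_ring)
  show ?thesis
  proof (rule R.noetherian_ringI)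
    fix I :: "('x, 'k) mpolynomial set" assume "ideal I ?R"
    then have I: "polys.ideal_of V I" by (simp only: ideal_of_iff_ideal)
    note IV = polys.ideal_ofD(1)[OF I]
    define lm where "lm f = Max (keys f)" for f :: "('x, 'k) mpolynomial"
    have lm: "lm f \<in> keys f" if "f \<noteq> 0" for f
      unfolding lm_def using that by (intro Max_in) (auto simp: keys_eq_empty)
    have lm_ge: "a \<le> lm f" if "a \<in> keys f" for a f unfolding lm_def using that by simp
    have lmV: "keys (lm f) \<subseteq> V" if "f \<in> I" "f \<noteq> 0" for f
      using lm[OF that(2)] IV[OF that(1)] by (auto simp: polys_def)
    have "keys a \<subseteq> V" if "a \<in> lm ` (I - {0})" for a using that lmV by auto
    from dickson[OF V this] obtain B
      where "B \<subseteq> lm ` (I - {0}) \<and> finite B \<and> (\<forall>a\<in>lm ` (I - {0}). \<exists>b\<in>B. \<exists>c. a = b + c)" ..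
    then have B: "B \<subseteq> lm ` (I - {0})" "finite B" "\<And>a. a \<in> lm ` (I - {0}) \<Longrightarrow> \<exists>b\<in>B. \<exists>c. a = b + c"
      by blast+
    obtain G where G: "G \<subseteq> I - {0}" "finite G" "B = lm ` G" using finite_subset_image[OF B(2,1)] by blast
    have GR: "G \<subseteq> carrier ?R" using G(1) IV by (auto simp: carrier_mpoly_ring)
    let ?J = "Idl\<^bsub>?R\<^esub> G"
    have J: "polys.ideal_of V ?J" unfolding ideal_of_iff_ideal by (rule R.genideal_ideal[OF GR])
    have GJ: "G \<subseteq> ?J" by (rule R.genideal_self[OF GR])
    have "I \<subseteq> ?J"
    proof (rule ccontr)
      assume "\<not> I \<subseteq> ?J"
      have ne0: "f \<noteq> 0" if "f \<in> I - ?J" for f using that polys.ideal_ofD(2)[OF J] by blast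
      have "keys a \<subseteq> V" if "a \<in> lm ` (I - ?J)" for a using that lmV ne0 by auto
      moreover have "lm ` (I - ?J) \<noteq> {}" using \<open>\<not> I \<subseteq> ?J\<close> by auto
      ultimately have "\<exists>m\<in>lm ` (I - ?J). \<forall>a\<in>lm ` (I - ?J). m \<le> a"
        by (rule exponent_set_has_least[OF V])
      then obtain f where f: "f \<in> I - ?J" and min: "\<And>f'. f' \<in> I - ?J \<Longrightarrow> lm f \<le> lm f'" by auto
      have "lm f \<in> lm ` (I - {0})" using f ne0[OF f] by simp
      from B(3)[OF this] obtain g c where g: "g \<in> G" "lm f = lm g + c" unfolding G(3) by auto
      have g0: "g \<noteq> 0" "g \<in> I" using g G by auto
      define t where "t = single c (lookup f (lm f) / lookup g (lm g))"
      have "keys c \<subseteq> V" using lmV[of f] f ne0[OF f] unfolding g(2) keys_exponent_add by blast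
      then have tV: "t \<in> polys V" unfolding t_def by (rule single_mem_polys)
      define f' where "f' = f - t * g"
      have "t * g \<in> ?J" using tV g GJ by (intro polys.ideal_ofD(4)[OF J]) auto
      moreover have "t * g \<in> I" using tV g0 by (intro polys.ideal_ofD(4)[OF I]) auto
      ultimately have f': "f' \<in> I - ?J"
        using f polys.ideal_ofD(7)[OF I, of f "t * g"] polys.ideal_ofD(3)[OF J, of f' "t * g"] unfolding f'_def by auto
      have "lookup (t * g) (lm f) = lookup f (lm f)"
        using lookup_single_mult_add[of c _ g "lm g"] lm[OF g0(1)]
        unfolding t_def g(2) by (simp add: add.commute in_keys_iff)
      then have "lookup f' (lm f) = 0" by (simp add: f'_def lookup_minus)
      then have "lm f' \<noteq> lm f" using lm[OF ne0[OF f']] by (auto simp: in_keys_iff)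
      moreover have "lm f' \<le> lm f"
      proof -
        have "lm f' \<in> keys f \<union> keys (t * g)"
          using lm[OF ne0[OF f']] unfolding f'_def by (auto simp: in_keys_iff lookup_minus)
        moreover have "a \<le> lm f" if a: "a \<in> keys (t * g)" for a
        proof -
          obtain b where b: "a = c + b" "b \<in> keys g" using a keys_mult[of t g] by (auto simp: t_def split: if_splits)
          then show ?thesis unfolding b(1) g(2) using add_left_mono[OF lm_ge[OF b(2)], of c] by (simp add: add.commute)
        qed
        ultimately show ?thesis using lm_ge by blast
      qed
      ultimately show False using min[OF f'] by simp
    qed
    moreover have "?J \<subseteq> I" using G(1) I by (intro R.genideal_minimal) (auto simp: ideal_of_iff_ideal)
    ultimately show "\<exists>A\<subseteq>carrier ?R. finite A \<and> I = Idl\<^bsub>?R\<^esub> A" using G(2) GR by blast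
  qed
qed

lemma lookup_mult_Max:
  fixes f g :: "('x::linorder, 'k::field) mpolynomial"
  assumes "f \<noteq> 0" "g \<noteq> 0"
  shows "lookup (f * g) (Max (keys f) + Max (keys g)) = lookup f (Max (keys f)) * lookup g (Max (keys g))"
proof -
  let ?m = "Max (keys f)" and ?n = "Max (keys g)"
  have m: "?m \<in> keys f" using assms by (intro Max_in) (auto simp: keys_eq_empty)
  have zero: "lookup (single a c * g) (?m + ?n) = 0" if a: "a \<in> keys f - {?m}" for a c
  proof (rule ccontr)
    assume "lookup (single a c * g) (?m + ?n) \<noteq> 0"
    then have "?m + ?n \<in> keys (single a c * g)" by (simp add: in_keys_iff)
    then obtain b where b: "?m + ?n = a + b" "b \<in> keys g"
      using keys_mult[of "single a c" g] by (auto split: if_splits)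
    have "a \<le> ?m" "b \<le> ?n" using a b(2) by simp_all
    moreover have "a \<noteq> ?m" using a by simp
    ultimately have "a + b < ?m + ?n" by (intro add_less_le_mono) auto
    then show False using b(1) by simp
  qed
  have "f * g = (\<Sum>a\<in>keys f. single a (lookup f a) * g)"
    by (simp add: sum_distrib_right[symmetric] sum_monomials)
  also have "\<dots> = single ?m (lookup f ?m) * g + (\<Sum>a\<in>keys f - {?m}. single a (lookup f a) * g)"
    using m by (simp add: sum.remove)
  finally show ?thesis
    by (simp add: lookup_add lookup_sum zero lookup_single_mult_add)
qed

lemma mpolynomial_dvd_one:
  fixes f :: "('x::linorder, 'k::field) mpolynomial"
  assumes "f dvd 1"
  shows "keys f \<subseteq> {0}"
proof -
  obtain g where g: "f * g = 1" using assms by (metis dvdE)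
  then have "f \<noteq> 0" "g \<noteq> 0" by auto
  then have "lookup f (Max (keys f)) \<noteq> 0" "lookup g (Max (keys g)) \<noteq> 0"
    using Max_in[of "keys f"] Max_in[of "keys g"] by (auto simp: keys_eq_empty in_keys_iff)
  then have "lookup (1 :: ('x, 'k) mpolynomial) (Max (keys f) + Max (keys g)) \<noteq> 0"
    using lookup_mult_Max[OF \<open>f \<noteq> 0\<close> \<open>g \<noteq> 0\<close>] g by simp
  then have sum0: "Max (keys f) + Max (keys g) = 0" by (simp add: lookup_one when_def split: if_splits)
  have "Max (keys f) \<le> Max (keys f) + Max (keys g)"
    using add_left_mono[OF exponent_nonneg[of "Max (keys g)"], of "Max (keys f)"] by simp
  then have "Max (keys f) \<le> 0" using sum0 by simp
  then have "a \<le> 0" if "a \<in> keys f" for a using that Max_ge[of "keys f" a] by (meson finite_keys order.trans)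
  then show ?thesis using exponent_nonneg by (auto intro: order.antisym)
qed

section \<open>Transcendence bases\<close>

text \<open>More unknowns than equations, solved by elimination without division, so that the
  solution stays in B. The entries N are the two-by-two minors through the pivot
  \<open>M i e\<close>.\<close>

lemma linear_dependence:
  fixes M :: "'j \<Rightarrow> 'e \<Rightarrow> 'b::idom"
  assumes B: "comm_subring B" and "finite E" "finite J" "card E < card J" "\<And>j e. j \<in> J \<Longrightarrow> e \<in> E \<Longrightarrow> M j e \<in> B"
  shows "\<exists>c. (\<forall>j\<in>J. c j \<in> B) \<and> (\<exists>j\<in>J. c j \<noteq> 0) \<and> (\<forall>e\<in>E. (\<Sum>j\<in>J. c j * M j e) = 0)"
  using assms(2-)
proof (induction E arbitrary: J M rule: finite_induct)
  case empty
  then have "J \<noteq> {}" by auto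
  then show ?case using comm_subring.one_mem[OF B] by (intro exI[of _ "\<lambda>_. 1"]) auto
next
  case (insert e E)
  interpret B: comm_subring B by (rule B)
  show ?case
  proof (cases "\<forall>j\<in>J. M j e = 0")
    case True
    have "card E < card J" using insert by simp
    then obtain c where "\<forall>j\<in>J. c j \<in> B" "\<exists>j\<in>J. c j \<noteq> 0" "\<forall>e\<in>E. (\<Sum>j\<in>J. c j * M j e) = 0"
      using insert.IH[of J M] insert.prems by auto
    then show ?thesis using True by (intro exI[of _ c]) auto
  next
    case False
    then obtain i where i: "i \<in> J" "M i e \<noteq> 0" by blast
    let ?J = "J - {i}"
    define N where "N j e' = M i e * M j e' - M j e * M i e'" for j e'
    have "card E < card ?J" using insert i by simp
    moreover have "N j e' \<in> B" if "j \<in> ?J" "e' \<in> E" for j e'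
      unfolding N_def using that insert.prems i by (intro B.diff_mem B.mult_mem) auto
    ultimately obtain c where c: "\<forall>j\<in>?J. c j \<in> B" "\<exists>j\<in>?J. c j \<noteq> 0" "\<forall>e'\<in>E. (\<Sum>j\<in>?J. c j * N j e') = 0"
      using insert.IH[of ?J N] insert.prems by auto
    \<comment> \<open>Back substitution: the value at the pivot index i is chosen to make equation e
      hold, and scaling the others by the pivot avoids a denominator.\<close>
    define b where "b j = (if j = i then - (\<Sum>j\<in>?J. c j * M j e) else M i e * c j)" for j
    have sum_b: "(\<Sum>j\<in>J. b j * M j e') = (\<Sum>j\<in>?J. c j * N j e')" for e'
    proof -
      have "(\<Sum>j\<in>J. b j * M j e') = b i * M i e' + (\<Sum>j\<in>?J. b j * M j e')"
        using insert.prems(1) i by (simp add: sum.remove)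
      also have "(\<Sum>j\<in>?J. b j * M j e') = (\<Sum>j\<in>?J. M i e * c j * M j e')"
        by (intro sum.cong) (auto simp: b_def)
      also have "b i * M i e' = - (\<Sum>j\<in>?J. c j * M j e * M i e')"
        by (simp add: b_def sum_distrib_right)
      finally show ?thesis by (simp add: N_def sum_subtractf[symmetric] algebra_simps)
    qed
    have "\<forall>j\<in>J. b j \<in> B"
      using c(1) i insert.prems by (auto simp: b_def intro!: B.uminus_mem B.sum_mem B.mult_mem)
    moreover have "\<exists>j\<in>J. b j \<noteq> 0" using c(2) i by (auto simp: b_def)
    moreover have "(\<Sum>j\<in>J. b j * M j e') = 0" if "e' \<in> insert e E" for e'
    proof (cases "e' = e")
      case True
      then show ?thesis unfolding sum_b by (simp add: N_def)
    next
      case False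
      then show ?thesis using that c(3) unfolding sum_b by blast
    qed
    ultimately show ?thesis by blast
  qed
qed

lemma finite_bounded_exponents:
  assumes "finite V"
  shows "finite {e :: 'x \<Rightarrow>\<^sub>0 nat. keys e \<subseteq> V \<and> (\<forall>i. lookup e i \<le> N)}"
proof (rule finite_imageD)
  show "inj_on lookup {e :: 'x \<Rightarrow>\<^sub>0 nat. keys e \<subseteq> V \<and> (\<forall>i. lookup e i \<le> N)}"
    by (intro inj_onI poly_mapping_eqI) simp
  show "finite (lookup ` {e :: 'x \<Rightarrow>\<^sub>0 nat. keys e \<subseteq> V \<and> (\<forall>i. lookup e i \<le> N)})"
    by (rule finite_subset[OF _ finite_set_of_finite_funs[OF assms finite_atMost, of N 0]])
      (auto simp: in_keys_iff)
qed

definition alg_independent_mod :: "('x, 'k::comm_ring_1) mpolynomial set \<Rightarrow> 'x set \<Rightarrow> bool" where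
  "alg_independent_mod P W \<longleftrightarrow> polys W \<inter> P \<subseteq> {0}"

lemma maximal_alg_independent_mod:
  assumes "finite V" "W \<subseteq> V" "alg_independent_mod P W"
  obtains W' where "W \<subseteq> W'" "W' \<subseteq> V" "alg_independent_mod P W'"
    "\<And>i. i \<in> V - W' \<Longrightarrow> \<not> alg_independent_mod P (insert i W')"
proof -
  have "finite {U. U \<subseteq> V \<and> alg_independent_mod P U}" using assms(1) by simp
  then obtain W' where W': "W' \<in> {U. U \<subseteq> V \<and> alg_independent_mod P U}" "W \<subseteq> W'"
    and max: "\<And>U. U \<in> {U. U \<subseteq> V \<and> alg_independent_mod P U} \<Longrightarrow> W' \<subseteq> U \<Longrightarrow> W' = U"
    using finite_has_maximal2[of "{U. U \<subseteq> V \<and> alg_independent_mod P U}" W] assms(2,3) by auto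
  show thesis
  proof (rule that[of W'])
    show "\<not> alg_independent_mod P (insert i W')" if "i \<in> V - W'" for i
      using max[of "insert i W'"] that W'(1) by auto
  qed (use W' in auto)
qed

text \<open>A maximal independent set W of variables is a transcendence basis of k[V]/P, and k[W]
  embeds in that quotient as a polynomial ring. Fields of fractions are replaced by explicit
  denominators from k[W].\<close>

locale prime_with_transcendence_basis =
  fixes V :: "'x::linorder set" and P :: "('x, 'k::field) mpolynomial set" and W
  assumes V: "finite V" and P: "polys.ideal_of V P" and one: "1 \<notin> P"
    and prime: "f \<in> polys V \<Longrightarrow> g \<in> polys V \<Longrightarrow> f * g \<in> P \<Longrightarrow> f \<in> P \<or> g \<in> P"
    and W: "W \<subseteq> V" and indep: "alg_independent_mod P W"
    and maximal: "i \<in> V - W \<Longrightarrow> \<not> alg_independent_mod P (insert i W)"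
begin

abbreviation "A \<equiv> polys W :: ('x, 'k) mpolynomial set"

lemma A_V: "f \<in> A \<Longrightarrow> f \<in> polys V"
  using polys_mono[OF W] by blast

lemma A_P: "f \<in> A \<Longrightarrow> f \<in> P \<Longrightarrow> f = 0"
  using indep by (auto simp: alg_independent_mod_def)

definition span :: "('x, 'k) mpolynomial set \<Rightarrow> ('x, 'k) mpolynomial set" where
  "span F = {\<Sum>e\<in>F. c e * e | c. \<forall>e\<in>F. c e \<in> A}"

text \<open>The elements of k[V] that fall into the k[W]-span of F modulo P once a is
  inverted.\<close>

definition gen :: "('x, 'k) mpolynomial \<Rightarrow> ('x, 'k) mpolynomial set \<Rightarrow> ('x, 'k) mpolynomial set" where
  "gen a F = {f \<in> polys V. \<exists>s. \<exists>g\<in>span F. a ^ s * f - g \<in> P}"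

definition indep_mod :: "('x, 'k) mpolynomial set \<Rightarrow> bool" where
  "indep_mod F \<longleftrightarrow> (\<forall>c. (\<forall>e\<in>F. c e \<in> A) \<longrightarrow> (\<Sum>e\<in>F. c e * e) \<in> P \<longrightarrow> (\<forall>e\<in>F. c e = 0))"

lemma indep_modD:
  "indep_mod F \<Longrightarrow> \<forall>e\<in>F. c e \<in> A \<Longrightarrow> (\<Sum>e\<in>F. c e * e) \<in> P \<Longrightarrow> \<forall>e\<in>F. c e = 0"
  unfolding indep_mod_def by (drule spec[of _ c]) (erule (1) impE)+

lemma spanI: "(\<And>e. e \<in> F \<Longrightarrow> c e \<in> A) \<Longrightarrow> (\<Sum>e\<in>F. c e * e) \<in> span F"
  unfolding span_def by blast

lemma spanE:
  assumes "g \<in> span F" obtains c where "\<forall>e\<in>F. c e \<in> A" "g = (\<Sum>e\<in>F. c e * e)"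
  using assms unfolding span_def by blast

lemma span_add:
  assumes "f \<in> span F" "g \<in> span F" shows "f + g \<in> span F"
proof -
  obtain c where c: "\<forall>e\<in>F. c e \<in> A" "f = (\<Sum>e\<in>F. c e * e)" using assms(1) by (rule spanE)
  obtain d where d: "\<forall>e\<in>F. d e \<in> A" "g = (\<Sum>e\<in>F. d e * e)" using assms(2) by (rule spanE)
  have "(\<Sum>e\<in>F. (c e + d e) * e) \<in> span F" by (intro spanI polys.add_mem bspec[OF c(1)] bspec[OF d(1)])
  then show ?thesis by (simp add: c(2) d(2) sum.distrib distrib_right)
qed

lemma span_mult:
  assumes "f \<in> span F" "a \<in> A" shows "a * f \<in> span F"
proof -
  obtain c where c: "\<forall>e\<in>F. c e \<in> A" "f = (\<Sum>e\<in>F. c e * e)" using assms(1) by (rule spanE)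
  have "(\<Sum>e\<in>F. (a * c e) * e) \<in> span F" by (intro spanI polys.mult_mem assms(2) bspec[OF c(1)])
  then show ?thesis by (simp add: c(2) sum_distrib_left mult.assoc)
qed

lemma span_zero: "0 \<in> span F"
  using spanI[of F "\<lambda>_. 0"] by simp

lemma span_sum: "(\<And>i. i \<in> S \<Longrightarrow> f i \<in> span F) \<Longrightarrow> sum f S \<in> span F"
  by (induction S rule: infinite_finite_induct) (auto intro: span_add span_zero)

lemma span_self:
  assumes "finite F" "e \<in> F" shows "e \<in> span F"
proof -
  have "(\<Sum>e'\<in>F. (if e' = e then 1 else 0) * e') = (\<Sum>e'\<in>F. if e' = e then e' else 0)"
    by (intro sum.cong) auto
  also have "\<dots> = e" using assms by simp
  finally show ?thesis using spanI[of F "\<lambda>e'. if e' = e then 1 else 0"] by simp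
qed

lemma span_V: "F \<subseteq> polys V \<Longrightarrow> g \<in> span F \<Longrightarrow> g \<in> polys V"
  by (erule spanE) (auto intro!: polys.sum_mem polys.mult_mem intro: A_V bspec)

lemma genI: "f \<in> polys V \<Longrightarrow> g \<in> span F \<Longrightarrow> a ^ s * f - g \<in> P \<Longrightarrow> f \<in> gen a F"
  unfolding gen_def by blast

lemma genE:
  assumes "f \<in> gen a F" obtains s g where "f \<in> polys V" "g \<in> span F" "a ^ s * f - g \<in> P"
  using assms unfolding gen_def by blast

lemma gen_add:
  assumes a: "a \<in> A" and "f \<in> gen a F" "g \<in> gen a F"
  shows "f + g \<in> gen a F"
proof -
  obtain s f' where f: "f \<in> polys V" "f' \<in> span F" "a ^ s * f - f' \<in> P" using assms(2) by (rule genE)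
  obtain t g' where g: "g \<in> polys V" "g' \<in> span F" "a ^ t * g - g' \<in> P" using assms(3) by (rule genE)
  show ?thesis
  proof (rule genI)
    show "f + g \<in> polys V" using f g by (intro polys.add_mem)
    show "a ^ t * f' + a ^ s * g' \<in> span F" using a f g by (intro span_add span_mult polys.power_mem)
    have "a ^ (s + t) * (f + g) - (a ^ t * f' + a ^ s * g')
        = a ^ t * (a ^ s * f - f') + a ^ s * (a ^ t * g - g')"
      by (simp add: algebra_simps power_add)
    also have "\<dots> \<in> P"
      using f g a by (intro polys.ideal_ofD(3)[OF P] polys.ideal_ofD(4)[OF P] polys.power_mem A_V)
    finally show "a ^ (s + t) * (f + g) - (a ^ t * f' + a ^ s * g') \<in> P" .
  qed
qed

lemma gen_mult:
  assumes "f \<in> gen a F" "c \<in> A"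
  shows "c * f \<in> gen a F"
proof -
  obtain s f' where f: "f \<in> polys V" "f' \<in> span F" "a ^ s * f - f' \<in> P" using assms(1) by (rule genE)
  show ?thesis
  proof (rule genI)
    show "c * f \<in> polys V" by (rule polys.mult_mem[OF A_V[OF assms(2)] f(1)])
    show "c * f' \<in> span F" using f assms by (intro span_mult)
    have "a ^ s * (c * f) - c * f' = c * (a ^ s * f - f')" by (simp add: algebra_simps)
    then show "a ^ s * (c * f) - c * f' \<in> P"
      using f assms by (auto intro: polys.ideal_ofD(4)[OF P] A_V)
  qed
qed

lemma gen_zero: "0 \<in> gen a F"
  using genI[of 0 0 F a 0] span_zero polys.ideal_ofD(2)[OF P] by simp

lemma gen_sum: "a \<in> A \<Longrightarrow> (\<And>i. i \<in> S \<Longrightarrow> f i \<in> gen a F) \<Longrightarrow> sum f S \<in> gen a F"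
  by (induction S rule: infinite_finite_induct) (auto intro: gen_add gen_zero)

lemma span_gen: "F \<subseteq> polys V \<Longrightarrow> g \<in> span F \<Longrightarrow> g \<in> gen a F"
  using genI[of g g F a 0] polys.ideal_ofD(2)[OF P] span_V by simp

lemma gen_cong: "f \<in> gen a F \<Longrightarrow> f' \<in> polys V \<Longrightarrow> f' - f \<in> P \<Longrightarrow> a \<in> A \<Longrightarrow> f' \<in> gen a F"
proof (elim genE)
  fix s g assume *: "f' \<in> polys V" "f' - f \<in> P" "a \<in> A" "f \<in> polys V" "g \<in> span F" "a ^ s * f - g \<in> P"
  have "a ^ s * f' - g = a ^ s * (f' - f) + (a ^ s * f - g)" by (simp add: algebra_simps)
  also have "\<dots> \<in> P"
    using * by (intro polys.ideal_ofD(3)[OF P] polys.ideal_ofD(4)[OF P] polys.power_mem A_V)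
  finally show ?thesis using * by (intro genI)
qed

text \<open>A divisor c of a becomes invertible together with a.\<close>

lemma gen_cancel:
  assumes cf: "c * f \<in> gen a F" and f: "f \<in> polys V" and q: "q \<in> A" "c * q = a"
  shows "f \<in> gen a F"
proof -
  obtain s g where g: "g \<in> span F" "a ^ s * (c * f) - g \<in> P" using cf by (rule genE)
  show ?thesis
  proof (rule genI[OF f])
    show "q * g \<in> span F" using g q by (intro span_mult)
    have "a ^ Suc s * f - q * g = q * (a ^ s * (c * f) - g)" unfolding q(2)[symmetric] by (simp add: algebra_simps)
    then show "a ^ Suc s * f - q * g \<in> P" using g q by (auto intro: polys.ideal_ofD(4)[OF P] A_V)
  qed
qed

lemma gen_cancel_power:
  assumes q: "q \<in> A" "c \<in> A" "c * q = a"
  shows "c ^ s * f \<in> gen a F \<Longrightarrow> f \<in> polys V \<Longrightarrow> f \<in> gen a F"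
proof (induction s)
  case (Suc s)
  have "c * (c ^ s * f) \<in> gen a F" using Suc.prems by (simp add: mult.assoc)
  moreover have "c ^ s * f \<in> polys V" using Suc.prems q by (auto intro: polys.power_mem A_V)
  ultimately have "c ^ s * f \<in> gen a F" by (rule gen_cancel[OF _ _ q(1,3)])
  then show ?case using Suc by simp
qed simp

lemma gen_trans:
  assumes a: "a \<in> A" and F: "F \<subseteq> gen a F'" and q: "q \<in> A" "c \<in> A" "c * q = a" and f: "f \<in> gen c F"
  shows "f \<in> gen a F'"
proof -
  obtain s g where g: "f \<in> polys V" "g \<in> span F" "c ^ s * f - g \<in> P" using f by (rule genE)
  obtain d where d: "\<forall>e\<in>F. d e \<in> A" "g = (\<Sum>e\<in>F. d e * e)" using g(2) by (rule spanE)
  have "g \<in> gen a F'" unfolding d(2) using d(1) F by (intro gen_sum gen_mult a) auto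
  have "c ^ s * f \<in> polys V" by (rule polys.mult_mem[OF polys.power_mem[OF A_V[OF q(2)]] g(1)])
  then have "c ^ s * f \<in> gen a F'" by (rule gen_cong[OF \<open>g \<in> gen a F'\<close> _ g(3) a])
  then show ?thesis using gen_cancel_power q g(1) by blast
qed

text \<open>Maximality of W gives a nonzero element of P over W and i. It is expanded in powers of
  the variable i, with l the leading coefficient; the degree n is positive because k[W] meets P only
  in 0.\<close>

lemma algebraic_relation:
  assumes i: "i \<in> V - W"
  shows "\<exists>n l p. n > 0 \<and> l \<in> A \<and> l \<noteq> 0 \<and> (\<forall>t. p t \<in> A) \<and>
    l * single (single i n) 1 + (\<Sum>t<n. p t * single (single i t) 1) \<in> P"
proof -
  obtain g where g: "g \<in> polys (insert i W)" "g \<in> P" "g \<noteq> 0"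
    using maximal[OF i] by (auto simp: alg_independent_mod_def)
  obtain N where N: "\<And>a. a \<in> keys g \<Longrightarrow> lookup a i \<le> N" using exponent_bound[of g i] by metis
  have g_sum: "(\<Sum>t\<le>N. slice i t g * single (single i t) 1) = g" by (rule sum_slices) (rule N)
  have slA: "slice i t g \<in> A" for t
    using slice_mem_polys[OF g(1), of i t] i by (simp add: Diff_insert_absorb)
  have "\<exists>t\<in>{..N}. slice i t g \<noteq> 0"
  proof (rule ccontr)
    assume "\<not> ?thesis"
    then have "(\<Sum>t\<le>N. slice i t g * single (single i t) 1) = 0" by simp
    then show False using g_sum g(3) by simp
  qed
  then have ne: "{t \<in> {..N}. slice i t g \<noteq> 0} \<noteq> {}" by blast
  define n where "n = Max {t \<in> {..N}. slice i t g \<noteq> 0}"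
  have n: "n \<le> N" "slice i n g \<noteq> 0" and above: "\<And>t. n < t \<Longrightarrow> t \<le> N \<Longrightarrow> slice i t g = 0"
    using Max_in[OF _ ne] Max_ge[of "{t \<in> {..N}. slice i t g \<noteq> 0}"] unfolding n_def[symmetric] by fastforce+
  have "g = (\<Sum>t\<le>N. slice i t g * single (single i t) 1)" using g_sum by simp
  also have "\<dots> = (\<Sum>t\<in>{..n}. slice i t g * single (single i t) 1)"
    using n above by (intro sum.mono_neutral_right) auto
  also have "\<dots> = (\<Sum>t<n. slice i t g * single (single i t) 1) + slice i n g * single (single i n) 1"
    by (simp add: lessThan_Suc_atMost[symmetric])
  finally have g_eq: "g = slice i n g * single (single i n) 1 + (\<Sum>t<n. slice i t g * single (single i t) 1)"
    by (rule trans) (rule add.commute)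
  have "n > 0"
  proof (rule ccontr)
    assume "\<not> n > 0"
    then have "g = slice i n g" using g_eq by simp
    then have "g \<in> A" using slA by metis
    then show False using A_P g by blast
  qed
  then show ?thesis using slA n g(2) g_eq by (intro exI[of _ n] exI[of _ "slice i n g"] exI[of _ "\<lambda>t. slice i t g"]) auto
qed

text \<open>Inverting the leading coefficients \<open>l i\<close> makes every variable outside W
  integral of degree \<open>n i\<close>, so the monomials in these variables with exponents below
  \<open>n i\<close> generate.\<close>

lemma finite_generation:
  "\<exists>a E. a \<in> A \<and> a \<noteq> 0 \<and> finite E \<and> E \<subseteq> polys V \<and> 1 \<in> E \<and> polys V \<subseteq> gen a E"
proof -
  define R where "R i r \<longleftrightarrow> (case r of (n, l, p) \<Rightarrow> n > 0 \<and> l \<in> A \<and> l \<noteq> 0 \<and> (\<forall>t. p t \<in> A) \<and>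
    l * single (single i n) 1 + (\<Sum>t<n. p t * single (single i t) 1) \<in> P)"
    for i and r :: "nat \<times> ('x, 'k) mpolynomial \<times> (nat \<Rightarrow> ('x, 'k) mpolynomial)"
  have "\<forall>i\<in>V - W. \<exists>r. R i r"
  proof
    fix i assume "i \<in> V - W"
    from algebraic_relation[OF this] show "\<exists>r. R i r" by (auto simp: R_def)
  qed
  from bchoice[OF this] obtain r where r: "\<forall>i\<in>V - W. R i (r i)" ..
  define n l p where "n i = fst (r i)" and "l i = fst (snd (r i))" and "p i = snd (snd (r i))" for i
  have np: "n i > 0" "l i \<in> A" "l i \<noteq> 0" "p i t \<in> A"
    "l i * single (single i (n i)) 1 + (\<Sum>t<n i. p i t * single (single i t) 1) \<in> P"
    if "i \<in> V - W" for i t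
    using bspec[OF r that] by (simp_all add: R_def n_def l_def p_def split_beta)
  have finU: "finite (V - W)" using V by simp
  define a where "a = (\<Prod>i\<in>V - W. l i)"
  have aA: "a \<in> A" unfolding a_def using np by (intro polys.prod_mem)
  have a0: "a \<noteq> 0" unfolding a_def using np finU by simp
  define D where "D = {e. keys e \<subseteq> V - W \<and> (\<forall>i\<in>V - W. lookup e i < n i)}"
  define E where "E = (\<lambda>e. single e 1 :: ('x, 'k) mpolynomial) ` D"
  have "D \<subseteq> {e. keys e \<subseteq> V - W \<and> (\<forall>i. lookup e i \<le> (\<Sum>i\<in>V - W. n i))}"
  proof (clarsimp simp: D_def)
    fix e i assume e: "keys e \<subseteq> V - W" "\<forall>i\<in>V - W. lookup e i < n i"
    show "lookup e i \<le> (\<Sum>i\<in>V - W. n i)"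
    proof (cases "i \<in> V - W")
      case True
      then have "lookup e i \<le> n i" using e by (simp add: less_imp_le)
      also have "n i \<le> (\<Sum>i\<in>V - W. n i)" by (rule member_le_sum[OF True _ finU]) simp
      finally show ?thesis .
    next
      case False
      then have "i \<notin> keys e" using e(1) by blast
      then show ?thesis by (simp add: in_keys_iff)
    qed
  qed
  then have "finite D" by (rule finite_subset[OF _ finite_bounded_exponents[OF finU]])
  then have finE: "finite E" unfolding E_def by (rule finite_imageI)
  have EV: "E \<subseteq> polys V" unfolding E_def D_def by (auto intro!: single_mem_polys)
  have oneE: "1 \<in> E" unfolding E_def D_def using np(1) by (auto intro!: image_eqI[of _ _ 0])
  have EI: "single e 1 \<in> E" if "keys e \<subseteq> V - W" "\<And>i. i \<in> V - W \<Longrightarrow> lookup e i < n i" for e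
    using that unfolding E_def D_def by blast
  have var: "single (single i 1) 1 \<in> polys V" if "i \<in> V" for i using that by (intro single_mem_polys) simp
  have step_E: "single (single i 1) 1 * e \<in> gen a E" if i: "i \<in> V - W" and "e \<in> E" for i e
  proof -
    obtain b where b: "e = single b 1" "keys b \<subseteq> V - W" "\<And>i. i \<in> V - W \<Longrightarrow> lookup b i < n i"
      using \<open>e \<in> E\<close> by (auto simp: E_def D_def)
    have eq: "single (single i 1) 1 * e = single (single i 1 + b) 1" by (simp add: b(1) mult_single)
    show ?thesis
    proof (cases "Suc (lookup b i) < n i")
      case True
      then have "single (single i 1 + b) 1 \<in> E"
        using i b by (intro EI) (auto simp: keys_exponent_add lookup_add lookup_single when_def)
      then show ?thesis unfolding eq using span_gen[OF EV] span_self[OF finE] by blast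
    next
      case False
      then have ni: "n i = Suc (lookup b i)" using b(3)[OF i] by simp
      define b' where "b' = b - single i (lookup b i)"
      have sum: "single i 1 + b = b' + single i (n i)"
        unfolding b'_def ni by (intro poly_mapping_eqI) (auto simp: lookup_add lookup_exponent_diff lookup_single when_def)
      have b'_le: "lookup b' k \<le> lookup b k" for k by (simp add: b'_def lookup_exponent_diff)
      have "keys b' \<subseteq> keys b"
      proof
        fix k assume "k \<in> keys b'"
        then show "k \<in> keys b" using b'_le[of k] by (simp add: in_keys_iff)
      qed
      then have b': "keys b' \<subseteq> V - W" "lookup b' i = 0" "\<And>k. lookup b' k \<le> lookup b k"
        using b(2) b'_le by (auto simp: b'_def lookup_exponent_diff)
      have low: "single (b' + single i t) 1 \<in> E" if t: "t < n i" for t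
      proof (rule EI)
        show "keys (b' + single i t) \<subseteq> V - W" using b' i by (auto simp: keys_exponent_add)
        fix k assume k: "k \<in> V - W"
        have "lookup b' k < n k" using b'(3)[of k] b(3)[OF k] by simp
        then show "lookup (b' + single i t) k < n k" using t b'(2) by (auto simp: lookup_add lookup_single when_def)
      qed
      \<comment> \<open>The factor \<open>b'\<close> is free of the variable i, so the product is
        \<open>b'\<close> times the power \<open>n i\<close> of that variable. The relation for i
        rewrites \<open>l i\<close> times it through smaller powers, all of them in E.\<close>
      define g where "g = (\<Sum>t<n i. (- p i t) * single (b' + single i t) 1)"
      have g: "g \<in> span E"
        unfolding g_def using low np(4)[OF i] by (intro span_sum span_mult span_self[OF finE]) auto
      have mon: "single b' 1 \<in> polys V" using b' by (intro single_mem_polys) auto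
      have "l i * single (single i 1 + b) 1 - g
          = single b' 1 * (l i * single (single i (n i)) 1 + (\<Sum>t<n i. p i t * single (single i t) 1))"
        unfolding sum g_def
        by (simp add: distrib_left sum_distrib_left sum_negf mult_single mult.left_commute[of "single b' 1"])
      also have "\<dots> \<in> P" by (intro polys.ideal_ofD(4)[OF P] mon np(5) i)
      finally have mem: "l i * single (single i 1 + b) 1 - g \<in> P" .
      have xeV: "single (single i 1 + b) 1 \<in> polys V"
        using i b(2) by (intro single_mem_polys) (auto simp: keys_exponent_add)
      have "l i * single (single i 1 + b) 1 \<in> gen a E"
        using gen_cong[OF span_gen[OF EV g] _ mem aA] xeV np(2)[OF i] A_V by blast
      moreover have "l i * (\<Prod>k\<in>V - W - {i}. l k) = a"
        unfolding a_def using i finU by (simp add: prod.remove)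
      moreover have "(\<Prod>k\<in>V - W - {i}. l k) \<in> A" using np(2) by (intro polys.prod_mem) auto
      ultimately show ?thesis unfolding eq using xeV gen_cancel by blast
    qed
  qed
  have step: "single (single i 1) 1 * f \<in> gen a E" if i: "i \<in> V" and f: "f \<in> gen a E" for i f
  proof (cases "i \<in> W")
    case True
    then have "single (single i 1) 1 \<in> A" by (intro single_mem_polys) simp
    then show ?thesis using gen_mult f by blast
  next
    case False
    obtain s g where g: "f \<in> polys V" "g \<in> span E" "a ^ s * f - g \<in> P" using f by (rule genE)
    obtain c where c: "\<forall>e\<in>E. c e \<in> A" "g = (\<Sum>e\<in>E. c e * e)" using g(2) by (rule spanE)
    have "single (single i 1) 1 * g = (\<Sum>e\<in>E. c e * (single (single i 1) 1 * e))"
      unfolding c(2) by (simp add: sum_distrib_left mult.left_commute)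
    moreover have "\<dots> \<in> gen a E"
    proof (rule gen_sum[OF aA])
      fix e assume e: "e \<in> E"
      have "single (single i 1) 1 * e \<in> gen a E" using i False e by (intro step_E) auto
      then show "c e * (single (single i 1) 1 * e) \<in> gen a E" using bspec[OF c(1) e] by (rule gen_mult)
    qed
    ultimately have xg: "single (single i 1) 1 * g \<in> gen a E" by simp
    have "single (single i 1) 1 * (a ^ s * f - g) \<in> P" using g var[OF i] by (intro polys.ideal_ofD(4)[OF P])
    then have diff: "a ^ s * (single (single i 1) 1 * f) - single (single i 1) 1 * g \<in> P"
      by (simp add: algebra_simps)
    have xf: "single (single i 1) 1 * f \<in> polys V" by (rule polys.mult_mem[OF var[OF i] g(1)])
    have "a ^ s * (single (single i 1) 1 * f) \<in> polys V"
      by (rule polys.mult_mem[OF polys.power_mem[OF A_V[OF aA]] xf])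
    then have "a ^ s * (single (single i 1) 1 * f) \<in> gen a E"
      by (rule gen_cong[OF xg _ diff aA])
    then show ?thesis by (rule gen_cancel_power[OF polys.one_mem aA mult_1_right _ xf])
  qed
  have mono: "single b c \<in> gen a E" if "keys b \<subseteq> V" for b c
    using that
  proof (induction "\<Sum>i\<in>V. lookup b i" arbitrary: b)
    case 0
    then have "lookup b i = 0" for i using V by (cases "i \<in> V") (auto simp: in_keys_iff)
    then have "b = 0" by (intro poly_mapping_eqI) simp
    moreover have "single 0 c \<in> A" by (rule single_mem_polys) simp
    ultimately show ?case using gen_mult[OF span_gen[OF EV span_self[OF finE oneE]], of "single 0 c"] by simp
  next
    case (Suc m)
    have "\<exists>i\<in>V. lookup b i \<noteq> 0"
    proof (rule ccontr)
      assume "\<not> ?thesis"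
      then have "(\<Sum>i\<in>V. lookup b i) = 0" by simp
      then show False using Suc.hyps(2) by simp
    qed
    then obtain i where i: "i \<in> V" "lookup b i \<noteq> 0" by auto
    define b' where "b' = b - single i 1"
    have b: "b = single i 1 + b'"
      unfolding b'_def using i by (intro poly_mapping_eqI) (auto simp: lookup_add lookup_exponent_diff lookup_single when_def)
    have "(\<Sum>k\<in>V. lookup b k) = (\<Sum>k\<in>V. if k = i then 1 else 0) + (\<Sum>k\<in>V. lookup b' k)"
      unfolding sum.distrib[symmetric] by (intro sum.cong) (auto simp: b lookup_add lookup_single when_def)
    then have "m = (\<Sum>k\<in>V. lookup b' k)" using Suc.hyps(2) i V by simp
    moreover have "keys b' \<subseteq> V" using Suc.prems unfolding b keys_exponent_add by blast
    ultimately have "single b' c \<in> gen a E" by (rule Suc.hyps(1))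
    from step[OF i(1) this] show ?case unfolding b by (simp add: mult_single)
  qed
  have "f \<in> gen a E" if f: "f \<in> polys V" for f
  proof -
    have "(\<Sum>b\<in>keys f. single b (lookup f b)) \<in> gen a E"
      using f mono by (intro gen_sum aA) (auto simp: polys_def)
    then show ?thesis by (simp add: sum_monomials)
  qed
  then show ?thesis using aA a0 finE EV oneE by blast
qed

text \<open>Every generator has a nonzero multiple in the span of a maximal independent subset, and
  these multipliers join the denominator. The subset is chosen to contain 1 so that later the
  coefficient at 1 can be compared.\<close>

lemma finite_free_generation:
  "\<exists>a E. a \<in> A \<and> a \<noteq> 0 \<and> finite E \<and> E \<subseteq> polys V \<and> 1 \<in> E \<and> indep_mod E \<and> polys V \<subseteq> gen a E"
proof -
  obtain a E where a: "a \<in> A" "a \<noteq> 0" and E: "finite E" "E \<subseteq> polys V" "1 \<in> E" and gen: "polys V \<subseteq> gen a E"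
    using finite_generation by blast
  have "indep_mod {1}"
    unfolding indep_mod_def using A_P by auto
  define S where "S = {F. F \<subseteq> E \<and> 1 \<in> F \<and> indep_mod F}"
  have "finite S" unfolding S_def using E(1) by simp
  moreover have "{1} \<in> S" unfolding S_def using \<open>indep_mod {1}\<close> E by simp
  ultimately have "\<exists>F\<in>S. {1} \<subseteq> F \<and> (\<forall>F'\<in>S. F \<subseteq> F' \<longrightarrow> F = F')" by (rule finite_has_maximal2)
  then obtain F where "F \<in> S" and max: "\<forall>F'\<in>S. F \<subseteq> F' \<longrightarrow> F = F'" by auto
  then have F: "F \<subseteq> E" "1 \<in> F" "indep_mod F" by (simp_all add: S_def)
  have finF: "finite F" using F E finite_subset by blast
  have FV: "F \<subseteq> polys V" using F E by blast
  have "\<exists>k\<in>A. k \<noteq> 0 \<and> (\<exists>g\<in>span F. k * e - g \<in> P)" if e: "e \<in> E" for e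
  proof (cases "e \<in> F")
    case True
    then show ?thesis using span_self[OF finF True] polys.ideal_ofD(2)[OF P]
      by (intro bexI[of _ 1] conjI bexI[of _ e]) simp_all
  next
    case False
    have "\<not> indep_mod (insert e F)"
    proof
      assume "indep_mod (insert e F)"
      then have "insert e F \<in> S" using F e by (simp add: S_def)
      then have "F = insert e F" using max by (simp add: subset_insertI)
      then show False using False by auto
    qed
    then obtain c where c: "\<And>e'. e' \<in> insert e F \<Longrightarrow> c e' \<in> A" "(\<Sum>e'\<in>insert e F. c e' * e') \<in> P" "\<exists>e'\<in>insert e F. c e' \<noteq> 0"
      unfolding indep_mod_def by blast
    have sum: "(\<Sum>e'\<in>insert e F. c e' * e') = c e * e + (\<Sum>e'\<in>F. c e' * e')"
      using False finF by simp
    have "c e \<noteq> 0"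
    proof
      assume "c e = 0"
      then have sum_P: "(\<Sum>e'\<in>F. c e' * e') \<in> P" using c(2) sum by simp
      have c_A: "\<forall>e'\<in>F. c e' \<in> A" using c(1) by simp
      have "\<forall>e'\<in>F. c e' = 0" by (rule indep_modD[OF F(3) c_A sum_P])
      then show False using c(3) \<open>c e = 0\<close> by blast
    qed
    moreover have "(\<Sum>e'\<in>F. (- c e') * e') \<in> span F" using c(1) by (intro spanI) auto
    moreover have "c e * e - (\<Sum>e'\<in>F. (- c e') * e') \<in> P" using c(2) sum by (simp add: sum_negf)
    ultimately show ?thesis using c(1) by blast
  qed
  then obtain k where k: "\<And>e. e \<in> E \<Longrightarrow> k e \<in> A" "\<And>e. e \<in> E \<Longrightarrow> k e \<noteq> 0"
    "\<And>e. e \<in> E \<Longrightarrow> \<exists>g\<in>span F. k e * e - g \<in> P" by metis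
  define b where "b = a * (\<Prod>e\<in>E. k e)"
  have kA: "(\<Prod>e\<in>E. k e) \<in> A" using k by (intro polys.prod_mem)
  then have bA: "b \<in> A" using a by (auto simp: b_def)
  have b0: "b \<noteq> 0" using a k E by (simp add: b_def)
  have "E \<subseteq> gen b F"
  proof
    fix e assume e: "e \<in> E"
    obtain g where g: "g \<in> span F" "k e * e - g \<in> P" using k(3)[OF e] by blast
    have eV: "e \<in> polys V" using e E by blast
    have "k e * e \<in> gen b F" using gen_cong[OF span_gen[OF FV g(1)] _ g(2) bA] k(1)[OF e] eV A_V by blast
    moreover have "k e * (a * (\<Prod>e'\<in>E - {e}. k e')) = b"
      unfolding b_def using E(1) e by (simp add: prod.remove[of E e] mult.left_commute)
    moreover have "a * (\<Prod>e'\<in>E - {e}. k e') \<in> A" using a k by (intro polys.mult_mem polys.prod_mem) auto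
    ultimately show "e \<in> gen b F" using gen_cancel eV by blast
  qed
  then have "f \<in> gen b F" if "f \<in> polys V" for f
    using gen_trans[OF bA _ kA a(1) b_def[symmetric], of E F f] gen that by blast
  then show ?thesis using bA b0 finF FV F by blast
qed

text \<open>The elements 1 and \<open>e * f\<close> number one more than the basis E, so they are
  dependent over k[W] modulo P. The coefficient of 1 is nonzero, as otherwise f would annihilate a
  nontrivial combination of E.\<close>

lemma exists_nonzero_multiple:
  assumes f: "f \<in> polys V" "f \<notin> P"
  shows "\<exists>c\<in>A. c \<noteq> 0 \<and> (\<exists>q\<in>polys V. c - q * f \<in> P)"
proof -
  obtain a E where a: "a \<in> A" "a \<noteq> 0" and E: "finite E" "E \<subseteq> polys V" "indep_mod E" and gen: "polys V \<subseteq> gen a E"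
    using finite_free_generation by blast
  \<comment> \<open>Indexing by options keeps the family at \<open>card E + 1\<close> members even
    if some of the elements coincide.\<close>
  define v where "v j = (case j of None \<Rightarrow> 1 | Some e \<Rightarrow> e * f)" for j
  define J where "J = insert None (Some ` E)"
  have J: "finite J" "card E < card J"
    using E(1) by (auto simp: J_def card_image)
  have vV: "v j \<in> polys V" if "j \<in> J" for j 
    using that E(2) by (auto simp: v_def J_def intro!: polys.mult_mem[OF _ f(1)])
  define R where "R j r \<longleftrightarrow> (\<forall>e\<in>E. snd r e \<in> A) \<and> a ^ fst r * v j - (\<Sum>e\<in>E. snd r e * e) \<in> P"
    for j and r :: "nat \<times> (('x, 'k) mpolynomial \<Rightarrow> ('x, 'k) mpolynomial)"
  have "\<forall>j\<in>J. \<exists>r. R j r"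
  proof
    fix j assume "j \<in> J"
    then have "v j \<in> gen a E" using gen vV by (intro subsetD[OF gen])
    then obtain s g where g: "g \<in> span E" "a ^ s * v j - g \<in> P" by (rule genE)
    obtain c where "\<forall>e\<in>E. c e \<in> A" "g = (\<Sum>e\<in>E. c e * e)" using g(1) by (rule spanE)
    then have "R j (s, c)" using g(2) by (simp add: R_def)
    then show "\<exists>r. R j r" by (rule exI)
  qed
  from bchoice[OF this] obtain r where r: "\<forall>j\<in>J. R j (r j)" ..
  define s m where "s j = fst (r j)" and "m j = snd (r j)" for j
  have m: "j \<in> J \<Longrightarrow> e \<in> E \<Longrightarrow> m j e \<in> A" "j \<in> J \<Longrightarrow> a ^ s j * v j - (\<Sum>e\<in>E. m j e * e) \<in> P" for j e
    using r by (simp_all add: R_def s_def m_def)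
  from linear_dependence[OF polys.comm_subring_axioms E(1) J m(1)] obtain c
    where "(\<forall>j\<in>J. c j \<in> A) \<and> (\<exists>j\<in>J. c j \<noteq> 0) \<and> (\<forall>e\<in>E. (\<Sum>j\<in>J. c j * m j e) = 0)" ..
  then have c: "\<And>j. j \<in> J \<Longrightarrow> c j \<in> A" "\<exists>j\<in>J. c j \<noteq> 0" "\<And>e. e \<in> E \<Longrightarrow> (\<Sum>j\<in>J. c j * m j e) = 0"
    by simp_all
  define d where "d j = c j * a ^ s j" for j
  have dA: "d j \<in> A" if "j \<in> J" for j using that c a by (auto simp: d_def intro: polys.power_mem)
  have "(\<Sum>j\<in>J. c j * (a ^ s j * v j - (\<Sum>e\<in>E. m j e * e))) \<in> P"
    using c(1) m(2) by (intro polys.ideal_of_sum[OF P] polys.ideal_ofD(4)[OF P] A_V)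
  also have "(\<Sum>j\<in>J. c j * (a ^ s j * v j - (\<Sum>e\<in>E. m j e * e)))
      = (\<Sum>j\<in>J. d j * v j) - (\<Sum>j\<in>J. \<Sum>e\<in>E. c j * m j e * e)"
    by (simp add: right_diff_distrib sum_subtractf d_def sum_distrib_left mult.assoc)
  also have "(\<Sum>j\<in>J. \<Sum>e\<in>E. c j * m j e * e) = (\<Sum>e\<in>E. (\<Sum>j\<in>J. c j * m j e) * e)"
    by (subst sum.swap) (simp add: sum_distrib_right)
  also have "\<dots> = 0" using c(3) by simp
  also have "(\<Sum>j\<in>J. d j * v j) = d None + (\<Sum>e\<in>E. d (Some e) * (e * f))"
    unfolding J_def using E(1) by (subst sum.insert) (auto simp: v_def sum.reindex)
  also have "(\<Sum>e\<in>E. d (Some e) * (e * f)) = (\<Sum>e\<in>E. d (Some e) * e) * f"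
    by (simp add: sum_distrib_right mult.assoc)
  finally have rel: "d None + (\<Sum>e\<in>E. d (Some e) * e) * f \<in> P" by simp
  have qV: "(\<Sum>e\<in>E. d (Some e) * e) \<in> polys V"
  proof (intro polys.sum_mem polys.mult_mem)
    fix e assume e: "e \<in> E"
    show "d (Some e) \<in> polys V" using A_V dA e by (simp add: J_def)
    show "e \<in> polys V" using e E(2) by blast
  qed
  have d_nz: "d None \<noteq> 0"
  proof
    assume d0: "d None = 0"
    then have "(\<Sum>e\<in>E. d (Some e) * e) * f \<in> P" using rel by simp
    then have sum_P: "(\<Sum>e\<in>E. d (Some e) * e) \<in> P" using prime[OF qV f(1)] f(2) by simp
    have d_A: "\<forall>e\<in>E. d (Some e) \<in> A" using dA by (simp add: J_def)
    have "\<forall>e\<in>E. d (Some e) = 0" by (rule indep_modD[OF E(3) d_A sum_P])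
    then have "\<forall>j\<in>J. d j = 0" using d0 by (auto simp: J_def)
    then show False using c(2) a by (auto simp: d_def)
  qed
  have mem: "d None - (- (\<Sum>e\<in>E. d (Some e) * e)) * f \<in> P" using rel by simp
  have ex: "\<exists>q\<in>polys V. d None - q * f \<in> P"
    using mem polys.uminus_mem[OF qV] by (rule bexI[where x = "- (\<Sum>e\<in>E. d (Some e) * e)"])
  have "d None \<in> A" by (rule dA) (simp add: J_def)
  with conjI[OF d_nz ex] show ?thesis by (rule bexI[where x = "d None"])
qed

end

section \<open>Maximal ideals and chains of prime ideals\<close>

lemma maximalideal_inverse:
  fixes M :: "('x, 'k::comm_ring_1) mpolynomial set"
  assumes M: "maximalideal M (mpoly_ring V)" and c: "c \<in> polys V" "c \<notin> M"
  shows "\<exists>f\<in>polys V. c * f - 1 \<in> M"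
proof -
  have I: "polys.ideal_of V M"
    using maximalideal.axioms(1)[OF M] by (simp only: ideal_of_iff_ideal)
  have J: "polys.ideal_of V (polys.adjoin V M c)" by (rule polys.ideal_of_adjoin[OF I c(1)])
  have "polys.adjoin V M c = M \<or> polys.adjoin V M c = carrier (mpoly_ring V)"
  proof (rule maximalideal.I_maximal[OF M])
    show "ideal (polys.adjoin V M c) (mpoly_ring V)" using J by (simp only: ideal_of_iff_ideal)
    show "M \<subseteq> polys.adjoin V M c" using polys.subset_adjoin by blast
    show "polys.adjoin V M c \<subseteq> carrier (mpoly_ring V)"
      using polys.ideal_ofD(1)[OF J] by (auto simp: carrier_mpoly_ring)
  qed
  moreover have "polys.adjoin V M c \<noteq> M"
    using polys.self_adjoin[OF I, of c] c(2) by metis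
  ultimately have adj: "polys.adjoin V M c = polys V" by (simp add: carrier_mpoly_ring)
  have "1 \<in> polys.adjoin V M c" unfolding adj by (rule polys.one_mem)
  then obtain x f where x: "x \<in> M" "f \<in> polys V" "1 = x + f * c" by (rule polys.adjoinE)
  have "c * f - 1 = - x" unfolding x(3) by (simp add: mult.commute)
  then have "c * f - 1 \<in> M" using polys.ideal_ofD(6)[OF I x(1)] by (simp only:)
  then show ?thesis using x(2) by (rule bexI)
qed

lemma prime_with_transcendence_basisI:
  fixes P :: "('x::linorder, 'k::field) mpolynomial set"
  assumes "finite V" and P: "primeideal P (mpoly_ring V)" and "W \<subseteq> V" "alg_independent_mod P W"
    and "\<And>i. i \<in> V - W \<Longrightarrow> \<not> alg_independent_mod P (insert i W)"
  shows "prime_with_transcendence_basis V P W"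
proof
  have I: "ideal P (mpoly_ring V)" by (rule primeideal.axioms(1)[OF P])
  then show "polys.ideal_of V P" by (simp only: ideal_of_iff_ideal)
  show "1 \<notin> P"
    using ideal.one_imp_carrier[OF I] primeideal.I_notcarr[OF P] by auto
  show "f \<in> P \<or> g \<in> P" if "f \<in> polys V" "g \<in> polys V" "f * g \<in> P" for f g
    using primeideal.I_prime[OF P, of f g] that by (simp add: carrier_mpoly_ring)
qed (use assms in auto)

text \<open>If \<open>x\<^sub>j\<close> were transcendental modulo \<open>M\<close>, it would extend to a transcendence basis \<open>W\<close>. For \<open>a \<in> k[W]\<close>
  such that \<open>k[V]/M\<close> is free and finite over \<open>k[W]\<close> after inverting \<open>a\<close>, the inverse of \<open>1 + x\<^sub>j a\<close>
  modulo \<open>M\<close> shows that \<open>1 + x\<^sub>j a\<close> divides a power of \<open>a\<close> in \<open>k[W]\<close>, hence is a unit.\<close>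

lemma maximalideal_contains_univariate:
  fixes M :: "('x::linorder, 'k::field) mpolynomial set"
  assumes V: "finite V" and M: "maximalideal M (mpoly_ring V)" and j: "j \<in> V"
  shows "\<not> alg_independent_mod M {j}"
proof
  assume "alg_independent_mod M {j}"
  then obtain W where basis: "{j} \<subseteq> W" "W \<subseteq> V" "alg_independent_mod M W"
    "\<And>i. i \<in> V - W \<Longrightarrow> \<not> alg_independent_mod M (insert i W)"
    using maximal_alg_independent_mod[OF V, of "{j}" M] j by auto
  have prime: "primeideal M (mpoly_ring V)"
    by (rule cring.maximalideal_prime[OF cring_mpoly_ring M])
  interpret prime_with_transcendence_basis V M W
    by (rule prime_with_transcendence_basisI[OF V prime basis(2,3,4)])
  obtain a E where a: "a \<in> A" "a \<noteq> 0" and E: "finite E" "E \<subseteq> polys V" "1 \<in> E" "indep_mod E"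
    and gen: "polys V \<subseteq> gen a E"
    using finite_free_generation by blast
  define x where "x = (single (single j 1) 1 :: ('x, 'k) mpolynomial)"
  \<comment> \<open>The constant term 1 makes c nonzero and \<open>x * a\<close> makes it
    nonconstant; the factor x is there because a itself may be constant.\<close>
  define c where "c = 1 + x * a"
  have xA: "x \<in> A" unfolding x_def using basis(1) by (intro single_mem_polys) simp
  have cA: "c \<in> A" unfolding c_def by (intro polys.add_mem polys.one_mem polys.mult_mem xA a(1))
  have keys_xa: "keys (x * a) = (+) (single j 1) ` keys a" unfolding x_def by (rule keys_single_mult)
  have not0: "0 \<notin> keys (x * a)"
  proof
    assume "0 \<in> keys (x * a)"
    then obtain b where "(0 :: 'x \<Rightarrow>\<^sub>0 nat) = single j 1 + b" unfolding keys_xa by blast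
    then have "lookup 0 j = lookup (single j 1 + b) j" by simp
    then show False by (simp add: lookup_add)
  qed
  then have "lookup c 0 = 1" by (simp add: c_def lookup_add in_keys_iff)
  then have "c \<noteq> 0" by auto
  then have "c \<notin> M" using A_P cA by blast
  then obtain f where f: "f \<in> polys V" "c * f - 1 \<in> M"
    using maximalideal_inverse[OF M A_V[OF cA]] by blast
  have "f \<in> gen a E" using gen f(1) by (rule subsetD)
  then obtain s g where g: "g \<in> span E" "a ^ s * f - g \<in> M" by (rule genE)
  obtain b where b: "\<forall>e\<in>E. b e \<in> A" "g = (\<Sum>e\<in>E. b e * e)" using g(1) by (rule spanE)
  \<comment> \<open>The coefficients of \<open>c * g - a ^ s\<close> over E. As g stands for
    \<open>a ^ s * f\<close> and f inverts c, this element lies in M, and its coefficient at 1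
    yields \<open>c * b 1 = a ^ s\<close>.\<close>
  define d where "d e = c * b e - (if e = 1 then a ^ s else 0)" for e
  have asA: "a ^ s \<in> A" by (rule polys.power_mem[OF a(1)])
  have "(\<Sum>e\<in>E. d e * e) = c * g - a ^ s"
    unfolding d_def b(2) using E(1,3) by (simp add: left_diff_distrib sum_subtractf sum_distrib_left mult.assoc if_distrib[of "\<lambda>x. x * _"] cong: if_cong)
  also have "\<dots> = a ^ s * (c * f - 1) - c * (a ^ s * f - g)" by (simp add: algebra_simps)
  also have "\<dots> \<in> M"
    by (intro polys.ideal_ofD(7)[OF P] polys.ideal_ofD(4)[OF P] A_V[OF asA] A_V[OF cA] f(2) g(2))
  finally have "(\<Sum>e\<in>E. d e * e) \<in> M" .
  moreover have "\<forall>e\<in>E. d e \<in> A"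
    using b(1) cA asA unfolding d_def by (auto intro!: polys.diff_mem polys.mult_mem)
  ultimately have "d 1 = 0" using indep_modD[OF E(4), of d] E(3) by blast
  then have "c dvd a ^ s" by (simp add: d_def) (metis dvd_triv_left)
  \<comment> \<open>Since \<open>x * a = c - 1\<close>, the factor \<open>x ^ s\<close> turns the
    power of a into a power of \<open>c - 1\<close>, which is a unit modulo c.\<close>
  then have "c dvd x ^ s * a ^ s" by (rule dvd_mult)
  then have "c dvd (c - 1) ^ s" by (simp add: c_def power_mult_distrib)
  moreover have "c dvd (c - 1) ^ n \<Longrightarrow> c dvd 1" for n
  proof (induction n)
    case (Suc n)
    have "(c - 1) ^ n = c * (c - 1) ^ n - (c - 1) ^ Suc n" by (simp add: algebra_simps)
    then have "c dvd (c - 1) ^ n" using Suc.prems by (metis dvd_diff dvd_triv_left)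
    then show ?case by (rule Suc.IH)
  qed simp
  ultimately have "keys c \<subseteq> {0}" using mpolynomial_dvd_one by blast
  moreover have "keys (x * a) \<subseteq> keys c"
  proof
    fix b assume b: "b \<in> keys (x * a)"
    then have "b \<noteq> 0" using not0 by auto
    then show "b \<in> keys c" using b by (simp add: c_def in_keys_iff lookup_add lookup_one)
  qed
  ultimately have "keys (x * a) = {}" using not0 by blast
  then show False using a(2) unfolding keys_xa by (simp add: keys_eq_empty)
qed

text \<open>Multiplying a univariate element of M by its variable removes the constant term without
  leaving M.\<close>

lemma maximalideal_univariate_elements:
  fixes M :: "('x::linorder, 'k::field) mpolynomial set"
  assumes V: "finite V" and M: "maximalideal M (mpoly_ring V)"
  obtains y where "\<And>j. j \<in> V \<Longrightarrow> y j \<in> polys {j}" "\<And>j. j \<in> V \<Longrightarrow> y j \<noteq> 0"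
    "\<And>j. j \<in> V \<Longrightarrow> lookup (y j) 0 = 0" "\<And>j. j \<in> V \<Longrightarrow> y j \<in> M"
proof -
  have I: "polys.ideal_of V M"
    using maximalideal.axioms(1)[OF M] by (simp only: ideal_of_iff_ideal)
  have "\<exists>y. y \<in> polys {j} \<and> y \<noteq> 0 \<and> lookup y 0 = 0 \<and> y \<in> M" if j: "j \<in> V" for j
  proof -
    obtain z where z: "z \<in> polys {j}" "z \<in> M" "z \<noteq> 0"
      using maximalideal_contains_univariate[OF V M j] by (auto simp: alg_independent_mod_def)
    define x where "x = (single (single j 1) 1 :: ('x, 'k) mpolynomial)"
    have x: "x \<in> polys {j}" unfolding x_def by (rule single_mem_polys) simp
    have "x \<in> polys V" using x polys_mono[of "{j}" V] j by blast
    have "x \<noteq> 0"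
    proof
      assume "x = 0"
      then have "lookup x (single j 1) = 0" by simp
      then show False by (simp add: x_def)
    qed
    have "0 \<notin> keys (x * z)"
    proof
      assume "0 \<in> keys (x * z)"
      then obtain b where "(0 :: 'x \<Rightarrow>\<^sub>0 nat) = single j 1 + b" unfolding x_def keys_single_mult by blast
      then have "lookup 0 j = lookup (single j 1 + b) j" by simp
      then show False by (simp add: lookup_add)
    qed
    then have "lookup (x * z) 0 = 0" by (simp add: in_keys_iff)
    moreover have "x * z \<in> M" by (rule polys.ideal_ofD(4)[OF I \<open>x \<in> polys V\<close> z(2)])
    moreover have "x * z \<in> polys {j}" by (rule polys.mult_mem[OF x z(1)])
    moreover have "x * z \<noteq> 0" using \<open>x \<noteq> 0\<close> z(3) by simp
    ultimately show ?thesis by blast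
  qed
  then obtain y where "\<forall>j\<in>V. y j \<in> polys {j} \<and> y j \<noteq> 0 \<and> lookup (y j) 0 = 0 \<and> y j \<in> M" by metis
  then show thesis using that[of y] by blast
qed

text \<open>Otherwise W would be a transcendence basis modulo P as well, and an element of Q outside
  P would have a nonzero multiple in k[W] modulo P; that multiple lies in Q.\<close>

lemma alg_independent_mod_extend:
  fixes P :: "('x::linorder, 'k::field) mpolynomial set"
  assumes V: "finite V" and P: "primeideal P (mpoly_ring V)" and Q: "primeideal Q (mpoly_ring V)"
    and PQ: "P \<subset> Q" and indQ: "W \<subseteq> V" "alg_independent_mod Q W"
  shows "\<exists>i\<in>V - W. alg_independent_mod P (insert i W)"
proof (rule ccontr)
  assume none: "\<not> ?thesis"
  have WP: "alg_independent_mod P W" using indQ(2) PQ by (auto simp: alg_independent_mod_def)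
  interpret prime_with_transcendence_basis V P W
    by (rule prime_with_transcendence_basisI[OF V P indQ(1) WP]) (use none in blast)
  have Qid: "polys.ideal_of V Q" using primeideal.axioms(1)[OF Q] by (simp only: ideal_of_iff_ideal)
  obtain f where f: "f \<in> Q" "f \<notin> P" using PQ by blast
  obtain c q where c: "c \<in> A" "c \<noteq> 0" "q \<in> polys V" "c - q * f \<in> P"
    using exists_nonzero_multiple[OF polys.ideal_ofD(1)[OF Qid f(1)] f(2)] by blast
  have "c - q * f \<in> Q" using c(4) PQ by blast
  then have "(c - q * f) + q * f \<in> Q"
    by (rule polys.ideal_ofD(3)[OF Qid _ polys.ideal_ofD(4)[OF Qid c(3) f(1)]])
  then have "c \<in> polys W \<inter> Q" using c(1) by simp
  then show False using indQ(2) c(2) by (auto simp: alg_independent_mod_def)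
qed

text \<open>The chain is descended from its top, where the empty set is independent because a prime
  contains no nonzero constant; each step down gains a variable.\<close>

lemma prime_chain_alg_independent:
  fixes P :: "nat \<Rightarrow> ('x::linorder, 'k::field) mpolynomial set"
  assumes V: "finite V" and P: "\<And>i. i \<le> e \<Longrightarrow> primeideal (P i) (mpoly_ring V)"
    and chain: "\<And>i. i < e \<Longrightarrow> P i \<subset> P (Suc i)" and "k \<le> e"
  shows "\<exists>W\<subseteq>V. alg_independent_mod (P (e - k)) W \<and> card W = k"
  using \<open>k \<le> e\<close>
proof (induction k)
  case 0
  interpret prime: primeideal "P e" "mpoly_ring V" by (rule P) simp
  have I: "polys.ideal_of V (P e)" using prime.is_ideal by (simp only: ideal_of_iff_ideal)
  have "f = 0" if f: "f \<in> polys {}" "f \<in> P e" for f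
  proof (rule ccontr)
    assume "f \<noteq> 0"
    have keys: "keys f \<subseteq> {0}" using f(1) by (auto simp: polys_def keys_eq_empty)
    have f0: "f = single 0 (lookup f 0)"
    proof (rule poly_mapping_eqI)
      fix b show "lookup f b = lookup (single 0 (lookup f 0)) b"
        using keys by (cases "b = 0") (auto simp: lookup_single in_keys_iff)
    qed
    then have "lookup f 0 \<noteq> 0" using \<open>f \<noteq> 0\<close> by auto
    then have "single 0 (inverse (lookup f 0)) * f = 1"
      by (subst f0) (simp add: mult_single)
    moreover have "single 0 (inverse (lookup f 0)) * f \<in> P e"
      by (rule polys.ideal_ofD(4)[OF I _ f(2)]) (simp add: single_mem_polys)
    ultimately have "1 \<in> P e" by simp
    then show False using prime.one_imp_carrier prime.I_notcarr by simp
  qed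
  then show ?case by (intro exI[of _ "{}"]) (auto simp: alg_independent_mod_def)
next
  case (Suc k)
  then obtain W where W: "W \<subseteq> V" "alg_independent_mod (P (e - k)) W" "card W = k" by auto
  have eq: "Suc (e - Suc k) = e - k" using Suc.prems by simp
  have sub: "P (e - Suc k) \<subset> P (e - k)" using chain[of "e - Suc k"] Suc.prems unfolding eq by simp
  obtain i where i: "i \<in> V - W" "alg_independent_mod (P (e - Suc k)) (insert i W)"
    using alg_independent_mod_extend[OF V P P sub W(1,2)] by auto
  moreover have "card (insert i W) = Suc k" using i(1) W finite_subset[OF W(1) V] by simp
  ultimately show ?case using W(1) by (intro exI[of _ "insert i W"]) auto
qed

text \<open>If each \<open>\<sigma>\<close> had a variable outside P, the product over C of the m-th
  powers of these variables would lie in every power of a prime, hence in P.\<close>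

lemma primeideal_over_symbolic_power:
  fixes P :: "('x, 'k::comm_ring_1) mpolynomial set"
  assumes V: "finite V" and C: "\<And>\<sigma>. \<sigma> \<in> C \<Longrightarrow> \<sigma> \<subseteq> V"
    and P: "primeideal P (mpoly_ring V)" and sub: "symbolic_power V C m \<subseteq> P"
  shows "\<exists>\<sigma>\<in>C. var ` \<sigma> \<subseteq> P"
proof (rule ccontr)
  assume "\<not> ?thesis"
  then have "\<forall>\<sigma>\<in>C. \<exists>i\<in>\<sigma>. var i \<notin> P" by blast
  then obtain i where i: "\<And>\<sigma>. \<sigma> \<in> C \<Longrightarrow> i \<sigma> \<in> \<sigma>" "\<And>\<sigma>. \<sigma> \<in> C \<Longrightarrow> var (i \<sigma>) \<notin> P" by metis
  interpret P: primeideal P "mpoly_ring V" by (rule P)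
  have one: "1 \<notin> P" using P.one_imp_carrier P.I_notcarr by auto
  have prime: "f * g \<notin> P" if "f \<in> polys V" "g \<in> polys V" "f \<notin> P" "g \<notin> P" for f g
    using P.I_prime[of f g] that by (auto simp: carrier_mpoly_ring)
  have finC: "finite C" using V C by (intro finite_subset[of C "Pow V"]) auto
  define q where "q \<sigma> = (var (i \<sigma>) ^ m :: ('x, 'k) mpolynomial)" for \<sigma>
  have varV: "var (i \<sigma>) \<in> (polys V :: ('x, 'k) mpolynomial set)" if "\<sigma> \<in> C" for \<sigma>
    using var_in_mpoly_ring[of "i \<sigma>" V] C[OF that] i(1)[OF that] by (auto simp: carrier_mpoly_ring)
  have qV: "q \<sigma> \<in> polys V" if "\<sigma> \<in> C" for \<sigma>
    unfolding q_def by (rule polys.power_mem[OF varV[OF that]])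
  have qP: "q \<sigma> \<notin> P" if \<sigma>: "\<sigma> \<in> C" for \<sigma>
  proof -
    have "var (i \<sigma>) ^ n \<notin> P" for n
      by (induction n) (use one prime[OF varV[OF \<sigma>] polys.power_mem[OF varV[OF \<sigma>]] i(2)[OF \<sigma>]] in auto)
    then show ?thesis by (simp add: q_def)
  qed
  have "prod q D \<in> polys V \<and> prod q D \<notin> P" if "finite D" "D \<subseteq> C" for D
    using that by induction (use one prime qV qP in \<open>auto intro: polys.mult_mem\<close>)
  then have prod: "prod q C \<in> polys V" "prod q C \<notin> P" using finC by auto
  have "prod q C \<in> monomial_prime V \<sigma> [^]\<^bsub>ideals_set (mpoly_ring V)\<^esub> m" if \<sigma>: "\<sigma> \<in> C" for \<sigma>
  proof -
    let ?D = "monomial_ideal V {a. m \<le> multidegree \<sigma> a} :: ('x, 'k) mpolynomial set"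
    have D: "polys.ideal_of V ?D" by (rule ideal_of_monomial_ideal[OF up_closed_multidegree])
    have pow: "(var j :: ('x, 'k) mpolynomial) ^ n = single (single j n) 1" for j n
      by (induction n) (simp_all add: var_def mult_single flip: single_add)
    have "finite \<sigma>" using C[OF \<sigma>] V finite_subset by blast
    then have "multidegree \<sigma> (single (i \<sigma>) m) = m"
      using i(1)[OF \<sigma>] by (simp add: multidegree_def lookup_single when_def)
    then have "q \<sigma> \<in> ?D"
      unfolding q_def pow using C[OF \<sigma>] i(1)[OF \<sigma>] by (intro monomial_mem_monomial_ideal) auto
    moreover have "prod q (C - {\<sigma>}) \<in> polys V" using qV by (intro polys.prod_mem) auto
    ultimately have "q \<sigma> * prod q (C - {\<sigma>}) \<in> ?D" by (intro polys.ideal_ofD(5)[OF D])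
    then show ?thesis
      unfolding monomial_prime_pow[OF C[OF \<sigma>] V] using prod.remove[OF finC \<sigma>, of q] by simp
  qed
  then have "prod q C \<in> symbolic_power V C m"
    using prod(1) by (simp add: symbolic_power_def carrier_mpoly_ring)
  then show False using sub prod(2) by blast
qed

section \<open>Depth and dimension combined\<close>

theorem proposition3p5:
  fixes V :: "nat set" and B :: "nat set set" and t n v :: nat
  assumes "steiner_system V B t n v"
    and "t < n" and "n \<le> v"
  shows "\<forall>m\<ge>1. cohen_macaulay
           ((mpoly_ring V :: (nat, 'k::field) mpolynomial ring)
              Quot symbolic_power V (subsets_of_size V n - B) m)"
proof (intro allI impI)
  fix m :: nat
  let ?R = "mpoly_ring V :: (nat, 'k) mpolynomial ring"
  define C where "C = subsets_of_size V n - B"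
  define d where "d = v - n"
  let ?I = "symbolic_power V C m :: (nat, 'k) mpolynomial set"
  have V: "finite V" "card V = v" using assms(1) by (simp_all add: steiner_system_def)
  have C: "\<sigma> \<subseteq> V" "card (V - \<sigma>) = d" if "\<sigma> \<in> C" for \<sigma>
    using that V by (auto simp: C_def d_def subsets_of_size_def card_Diff_subset finite_subset)
  have I: "ideal ?I ?R" by (rule ideal_symbolic_power[OF C(1)])
  interpret R: cring ?R by (rule cring_mpoly_ring)
  show "cohen_macaulay (?R Quot symbolic_power V (subsets_of_size V n - B) m)"
    unfolding C_def[symmetric]
  proof (rule R.cohen_macaulay_QuotI[OF noetherian_mpoly_ring[OF V(1)] I, where d = d])
    fix P :: "nat \<Rightarrow> (nat, 'k) mpolynomial set" and e
    assume P: "\<forall>i\<le>e. primeideal (P i) ?R" "\<forall>i<e. P i \<subset> P (Suc i)" "?I \<subseteq> P 0"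
    obtain \<sigma> where \<sigma>: "\<sigma> \<in> C" "var ` \<sigma> \<subseteq> P 0"
      using primeideal_over_symbolic_power[OF V(1) C(1) _ P(3)] P(1) by auto
    obtain W where W: "W \<subseteq> V" "alg_independent_mod (P 0) W" "card W = e"
      using prime_chain_alg_independent[OF V(1), of e P e] P(1,2) by auto
    \<comment> \<open>The variables of \<open>\<sigma>\<close> lie in \<open>P 0\<close> and thus
      cannot be independent modulo it, so the e independent variables fit into
      \<open>V - \<sigma>\<close>, which has v - n points.\<close>
    have "i \<notin> \<sigma>" if i: "i \<in> W" for i
    proof
      assume "i \<in> \<sigma>"
      then have "(var i :: (nat, 'k) mpolynomial) \<in> P 0" using \<sigma>(2) by blast
      moreover have "(var i :: (nat, 'k) mpolynomial) \<in> polys W"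
        unfolding var_def using i by (intro single_mem_polys) simp
      ultimately have "(var i :: (nat, 'k) mpolynomial) = 0" using W(2) by (auto simp: alg_independent_mod_def)
      then have "lookup (var i :: (nat, 'k) mpolynomial) (single i 1) = 0" by simp
      then show False by (simp add: var_def)
    qed
    then have "W \<subseteq> V - \<sigma>" using W(1) by blast
    then have "card W \<le> card (V - \<sigma>)" using V(1) by (intro card_mono) simp_all
    then show "e \<le> d" using W(3) C(2)[OF \<sigma>(1)] by simp
  next
    fix M assume M: "maximalideal M ?R" and "?I \<subseteq> M"
    obtain y where y: "\<And>j. j \<in> V \<Longrightarrow> y j \<in> polys {j}" "\<And>j. j \<in> V \<Longrightarrow> y j \<noteq> 0"
      "\<And>j. j \<in> V \<Longrightarrow> lookup (y j) 0 = 0" "\<And>j. j \<in> V \<Longrightarrow> y j \<in> M"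
      using maximalideal_univariate_elements[OF V(1) M] by blast
    let ?fs = "esyms y V d"
    have MI: "polys.ideal_of V M" using maximalideal.axioms(1)[OF M] by (simp only: ideal_of_iff_ideal)
    have fsM: "set ?fs \<subseteq> M" by (rule polys.esyms_subset[OF MI y(4)])
    then have fsV: "set ?fs \<subseteq> polys V" using polys.ideal_ofD(1)[OF MI] by blast
    have "polys.weakly_regular V (monomial_ideal V {a. keys a \<subseteq> V \<and> (\<forall>\<sigma>\<in>C. m \<le> multidegree \<sigma> a)}) ?fs"
    proof (rule weakly_regular_steiner[OF V(1) C_def _ fsV])
      show "Suc (card (\<beta> \<inter> \<beta>')) < n" if "\<beta> \<in> B" "\<beta>' \<in> B" "\<beta> \<noteq> \<beta>'" for \<beta> \<beta>'
        by (rule steiner_blocks_meet[OF assms(1,2) that])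
      show "polys.weakly_regular V (monomial_ideal V {a. 1 \<le> multidegree \<sigma> a}) ?fs" if "\<sigma> \<in> C" for \<sigma>
        by (rule weakly_regular_esyms_prime[OF V(1) C[OF that] y(1-3)])
    qed
    moreover have "?I = monomial_ideal V {a. keys a \<subseteq> V \<and> (\<forall>\<sigma>\<in>C. m \<le> multidegree \<sigma> a)}"
      by (rule symbolic_power_eq[OF V(1) C(1)])
    ultimately have wr: "polys.weakly_regular V ?I ?fs" by simp
    have "a \<in> Idl\<^bsub>?R\<^esub> (?I \<union> set (take i ?fs))"
      if "i < d" "a \<in> carrier ?R" "?fs ! i \<otimes>\<^bsub>?R\<^esub> a \<in> Idl\<^bsub>?R\<^esub> (?I \<union> set (take i ?fs))" for i a
      using weakly_regular_nth[OF wr I[folded ideal_of_iff_ideal] fsV, of i a] that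
      by (simp add: carrier_mpoly_ring)
    then show "\<exists>fs. length fs = d \<and> set fs \<subseteq> M \<and> (\<forall>i<d. \<forall>a\<in>carrier ?R.
        fs ! i \<otimes>\<^bsub>?R\<^esub> a \<in> Idl\<^bsub>?R\<^esub> (?I \<union> set (take i fs)) \<longrightarrow> a \<in> Idl\<^bsub>?R\<^esub> (?I \<union> set (take i fs)))"
      using fsM by (intro exI[of _ ?fs]) simp
  qed
qed

end
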